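(* For values of $-\kappa$ arbitrarily large there exist examples in which a stratum of ${\cal V}$ does not lie in the closure of the union of the strata of ${\cal V}$ on which the centralizer is trivial, and is of dimension higher than the expected one. Precisely: for every $N$ there exist $n$, $p$ and conjugacy classes $c_1,\dots,c_{p+1}\subset gl(n,{\bf C})$ (and likewise conjugacy classes $C_1,\dots,C_{p+1}\subset GL(n,{\bf C})$) admissible in the sense of the context, with $-\kappa\ge N$, such that the set ${\cal V}^0\subset{\cal V}$ of tuples with trivial centralizer is non-empty and there exists a non-empty stratum ${\cal U}\subset{\cal V}$, consisting of tuples with non-trivial centralizer, which is not contained in the closure of ${\cal V}^0$ and satisfies $\dim{\cal U}>1-\kappa+n^2$.
   Context: ${\cal V}={\cal V}(c_1,\dots,c_{p+1})=\{(A_1,\dots,A_{p+1})\mid A_j\in c_j,\ A_1+\dots+A_{p+1}=0\}$; in the multiplicative version ${\cal V}=\{(M_1,\dots,M_{p+1})\mid M_j\in C_j,\ M_1\cdots M_{p+1}=I\}$. The centralizer of a tuple is the set of matrices commuting with all its members; it is trivial if it consists of scalar matrices only. A stratum means here a (constructible) subset of ${\cal V}$ invariant under simultaneous conjugation, determined by the type of block-decomposition of its tuples up to conjugacy. Dimension is complex dimension. For a conjugacy class $C$ let $d(C)$ be its dimension and $r(C)=\min_{\lambda\in{\bf C}}{\rm rank}(Y-\lambda I)$ for $Y\in C$; put $d_j=d(c_j)$, $r_j=r(c_j)$ (resp. $d(C_j)$, $r(C_j)$). These depend only on the Jordan normal form (JNF) of the class. The index of rigidity is $\kappa=2n^2-d_1-\dots-d_{p+1}$,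 and the expected dimension of ${\cal V}$ is $1-\kappa+n^2$. Conditions on a $(p+1)$-tuple of JNFs of size $n$: $(\beta_n)$: $\sum_{i\ne j}r_i\ge n$ for all $j$; $(\omega_n)$: $r_1+\dots+r_{p+1}\ge 2n$. For a $(p+1)$-tuple of JNFs $J_j^n$ with $n>1$ satisfying $(\beta_n)$ and not $(\omega_n)$, set $n_1=r_1+\dots+r_{p+1}-n<n$ and define $\Psi(J_1^n,\dots,J_{p+1}^n)=(J_1^{n_1},\dots,J_{p+1}^{n_1})$, where $J_j^{n_1}$ is obtained from $J_j^n$ by choosing an eigenvalue with the greatest number $n-r_j$ of Jordan blocks, decreasing by $1$ the sizes of the $n-n_1$ smallest Jordan blocks with this eigenvalue and deleting blocks of size $0$. Admissible means: the sum of the traces of the $c_j$ is $0$ (resp. the product of the determinants of the $C_j$ is $1$), the JNFs satisfy $(\beta_n)$, and either they satisfy $(\omega_n)$ or the map $\Psi$, iterated as long as it is defined, stops at a $(p+1)$-tuple of JNFs of some size $n'$ either satisfying $(\omega_{n'})$ or with $n'=1$. *)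

theory Defs
  imports
    "HOL-Analysis.Abstract_Topology"
    "HOL-Library.Extended_Nat"
    "Jordan_Normal_Form.Jordan_Normal_Form"
    "Jordan_Normal_Form.DL_Rank"
begin

section \<open>The Zariski topology on tuples of matrices, dimension\<close>

definition tuples :: "nat \<Rightarrow> nat \<Rightarrow> complex mat list set" where
  "tuples n q = {As. length As = q \<and> set As \<subseteq> carrier_mat n n}"

inductive_set poly_fun :: "nat \<Rightarrow> nat \<Rightarrow> (complex mat list \<Rightarrow> complex) set" for n q where
  const: "(\<lambda>_. c) \<in> poly_fun n q"
| coord: "k < q \<Longrightarrow> i < n \<Longrightarrow> j < n \<Longrightarrow> (\<lambda>As. (As ! k) $$ (i, j)) \<in> poly_fun n q"
| add: "f \<in> poly_fun n q \<Longrightarrow> g \<in> poly_fun n q \<Longrightarrow> (\<lambda>As. f As + g As) \<in> poly_fun n q"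
| mult: "f \<in> poly_fun n q \<Longrightarrow> g \<in> poly_fun n q \<Longrightarrow> (\<lambda>As. f As * g As) \<in> poly_fun n q"

definition zariski_open :: "nat \<Rightarrow> nat \<Rightarrow> complex mat list set \<Rightarrow> bool" where
  "zariski_open n q S \<longleftrightarrow>
     (\<exists>F \<subseteq> poly_fun n q. S = {As \<in> tuples n q. \<exists>f\<in>F. f As \<noteq> 0})"

definition zariski :: "nat \<Rightarrow> nat \<Rightarrow> complex mat list topology" where
  "zariski n q = topology (zariski_open n q)"

lemma istopology_zariski_open: "istopology (zariski_open n q)"
  unfolding istopology_def
proof (intro conjI allI impI)
  fix S T assume "zariski_open n q S" "zariski_open n q T"
  then obtain F G where F: "F \<subseteq> poly_fun n q" "S = {As \<in> tuples n q. \<exists>f\<in>F. f As \<noteq> 0}"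
    and G: "G \<subseteq> poly_fun n q" "T = {As \<in> tuples n q. \<exists>f\<in>G. f As \<noteq> 0}"
    unfolding zariski_open_def by blast
  define H where "H = {\<lambda>As. f As * g As | f g. f \<in> F \<and> g \<in> G}"
  have sub: "H \<subseteq> poly_fun n q"
  proof
    fix h assume "h \<in> H"
    then obtain f g where "h = (\<lambda>As. f As * g As)" "f \<in> F" "g \<in> G" unfolding H_def by blast
    then show "h \<in> poly_fun n q" using poly_fun.mult F(1) G(1) by (metis subsetD)
  qed
  have H: "(\<exists>h\<in>H. h As \<noteq> 0) \<longleftrightarrow> (\<exists>f\<in>F. f As \<noteq> 0) \<and> (\<exists>g\<in>G. g As \<noteq> 0)" for As
  proof
    assume "\<exists>h\<in>H. h As \<noteq> 0"
    then obtain f g where "f \<in> F" "g \<in> G" "f As * g As \<noteq> 0" unfolding H_def by auto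
    then show "(\<exists>f\<in>F. f As \<noteq> 0) \<and> (\<exists>g\<in>G. g As \<noteq> 0)" using mult_not_zero by blast
  next
    assume "(\<exists>f\<in>F. f As \<noteq> 0) \<and> (\<exists>g\<in>G. g As \<noteq> 0)"
    then obtain f g where fg: "f \<in> F" "g \<in> G" "f As \<noteq> 0" "g As \<noteq> 0" by (elim conjE bexE)
    then have "(\<lambda>As. f As * g As) \<in> H" unfolding H_def by (intro CollectI exI[of _ f] exI[of _ g]) simp
    moreover have "(\<lambda>As. f As * g As) As \<noteq> 0" using fg by simp
    ultimately show "\<exists>h\<in>H. h As \<noteq> 0" by (intro bexI[of _ "\<lambda>As. f As * g As"]) simp_all
  qed
  have "S \<inter> T = {As \<in> tuples n q. \<exists>h\<in>H. h As \<noteq> 0}"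
    unfolding F(2) G(2) H by (rule Set.set_eqI) (simp only: Int_iff mem_Collect_eq conj_ac conj_left_absorb)
  then show "zariski_open n q (S \<inter> T)" unfolding zariski_open_def using sub by (intro exI[of _ H] conjI)
next
  fix K assume K: "\<forall>S\<in>K. zariski_open n q S"
  define H where "H = {f \<in> poly_fun n q. {As \<in> tuples n q. f As \<noteq> 0} \<subseteq> \<Union>K}"
  have "\<Union>K \<subseteq> {As \<in> tuples n q. \<exists>f\<in>H. f As \<noteq> 0}"
  proof
    fix As assume "As \<in> \<Union>K"
    then obtain S where S: "S \<in> K" "As \<in> S" by (elim UnionE)
    from K S(1) have "zariski_open n q S" by (rule bspec)
    then obtain F where F: "F \<subseteq> poly_fun n q" "S = {As \<in> tuples n q. \<exists>f\<in>F. f As \<noteq> 0}"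
      unfolding zariski_open_def by (elim exE conjE)
    have "As \<in> {As \<in> tuples n q. \<exists>f\<in>F. f As \<noteq> 0}" using S(2) F(2) by simp
    then obtain f where f: "As \<in> tuples n q" "f \<in> F" "f As \<noteq> 0" by (elim CollectE conjE bexE)
    have "{As \<in> tuples n q. f As \<noteq> 0} \<subseteq> S" unfolding F(2) using f(2) by (intro Collect_mono impI conjI bexI[of _ f]) (elim conjE, assumption)+
    then have "{As \<in> tuples n q. f As \<noteq> 0} \<subseteq> \<Union>K" using S(1) by (meson Union_upper subset_trans)
    then have "f \<in> H" unfolding H_def using subsetD[OF F(1) f(2)] by (intro CollectI conjI)
    then show "As \<in> {As \<in> tuples n q. \<exists>f\<in>H. f As \<noteq> 0}" using f by (intro CollectI conjI bexI)
  qed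
  moreover have "{As \<in> tuples n q. \<exists>f\<in>H. f As \<noteq> 0} \<subseteq> \<Union>K"
  proof
    fix As assume "As \<in> {As \<in> tuples n q. \<exists>f\<in>H. f As \<noteq> 0}"
    then obtain f where f: "As \<in> tuples n q" "f \<in> H" "f As \<noteq> 0" by (elim CollectE conjE bexE)
    have "As \<in> {As \<in> tuples n q. f As \<noteq> 0}" using f(1,3) by (intro CollectI conjI)
    moreover have "{As \<in> tuples n q. f As \<noteq> 0} \<subseteq> \<Union>K"
      using f(2) unfolding H_def by (elim CollectE conjE)
    ultimately show "As \<in> \<Union>K" by (rule rev_subsetD)
  qed
  ultimately have "\<Union>K = {As \<in> tuples n q. \<exists>f\<in>H. f As \<noteq> 0}" by (rule subset_antisym)
  moreover have "H \<subseteq> poly_fun n q" unfolding H_def by (rule Collect_restrict)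
  ultimately show "zariski_open n q (\<Union>K)" unfolding zariski_open_def by (intro exI[of _ H] conjI)
qed

lemma openin_zariski: "openin (zariski n q) S \<longleftrightarrow> zariski_open n q S"
  unfolding zariski_def using istopology_zariski_open by (simp add: topology_inverse')

text \<open>For constructible sets the closure in this topology is the closure in the usual topology.\<close>

definition irreducible_closedin :: "'a topology \<Rightarrow> 'a set \<Rightarrow> bool" where
  "irreducible_closedin X Z \<longleftrightarrow> closedin X Z \<and> Z \<noteq> {} \<and>
     (\<forall>C D. closedin X C \<longrightarrow> closedin X D \<longrightarrow> Z \<subseteq> C \<union> D \<longrightarrow> Z \<subseteq> C \<or> Z \<subseteq> D)"

text \<open>The dimension of a topological space is the supremum of the lengths of strictly increasing
  chains of irreducible closed subsets. For a constructible subset of affine space with its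
  Zariski topology this is the complex dimension.\<close>

definition krull_dim :: "'a topology \<Rightarrow> enat" where
  "krull_dim X = Sup {enat d | d. \<exists>Z. (\<forall>i\<le>d. irreducible_closedin X (Z i)) \<and>
     (\<forall>i<d. Z i \<subset> Z (Suc i))}"

definition zdim :: "nat \<Rightarrow> nat \<Rightarrow> complex mat list set \<Rightarrow> enat" where
  "zdim n q S = krull_dim (subtopology (zariski n q) S)"

section \<open>Conjugacy classes, centralizers, the varieties\<close>

definition conj_class :: "complex mat \<Rightarrow> complex mat set" where
  "conj_class A = {B. similar_mat B A}"

definition gl_classes :: "nat \<Rightarrow> complex mat set set" where
  "gl_classes n = conj_class ` carrier_mat n n"

definition GL_classes :: "nat \<Rightarrow> complex mat set set" where
  "GL_classes n = conj_class ` {A \<in> carrier_mat n n. invertible_mat A}"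

definition class_dim :: "nat \<Rightarrow> complex mat set \<Rightarrow> nat" where
  "class_dim n C = the_enat (zdim n 1 ((\<lambda>A. [A]) ` C))"

definition \<kappa> :: "nat \<Rightarrow> complex mat set list \<Rightarrow> int" where
  "\<kappa> n cs = 2 * (int n)\<^sup>2 - (\<Sum>c\<leftarrow>cs. int (class_dim n c))"

definition expected_dim :: "nat \<Rightarrow> complex mat set list \<Rightarrow> int" where
  "expected_dim n cs = 1 - \<kappa> n cs + (int n)\<^sup>2"

definition \<V>_add :: "nat \<Rightarrow> complex mat set list \<Rightarrow> complex mat list set" where
  "\<V>_add n cs = {As. list_all2 (\<in>) As cs \<and> foldr (+) As (0\<^sub>m n n) = 0\<^sub>m n n}"

definition \<V>_mult :: "nat \<Rightarrow> complex mat set list \<Rightarrow> complex mat list set" where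
  "\<V>_mult n Cs = {Ms. list_all2 (\<in>) Ms Cs \<and> foldr (*) Ms (1\<^sub>m n) = 1\<^sub>m n}"

definition centralizer :: "nat \<Rightarrow> complex mat list \<Rightarrow> complex mat set" where
  "centralizer n As = {X \<in> carrier_mat n n. \<forall>A\<in>set As. X * A = A * X}"

definition trivial_centralizer :: "nat \<Rightarrow> complex mat list \<Rightarrow> bool" where
  "trivial_centralizer n As \<longleftrightarrow> centralizer n As \<subseteq> range (\<lambda>a. a \<cdot>\<^sub>m 1\<^sub>m n)"

definition trivial_part :: "nat \<Rightarrow> complex mat list set \<Rightarrow> complex mat list set" where
  "trivial_part n V = {As \<in> V. trivial_centralizer n As}"

section \<open>Strata\<close>

definition simult_conj :: "complex mat list \<Rightarrow> complex mat list \<Rightarrow> bool" where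
  "simult_conj As Bs \<longleftrightarrow> length As = length Bs \<and>
     (\<exists>P Q. \<forall>k<length As. similar_mat_wit (As ! k) (Bs ! k) P Q)"

definition block_diag :: "nat \<Rightarrow> complex mat list list \<Rightarrow> complex mat list" where
  "block_diag q Bss = map (\<lambda>k. diag_block_mat (map (\<lambda>Bs. Bs ! k) Bss)) [0..<q]"

definition indecomposable :: "nat \<Rightarrow> nat \<Rightarrow> complex mat list \<Rightarrow> bool" where
  "indecomposable m q Bs \<longleftrightarrow> 0 < m \<and> Bs \<in> tuples m q \<and>
     \<not> (\<exists>k l Cs Ds. 0 < k \<and> 0 < l \<and> Cs \<in> tuples k q \<and> Ds \<in> tuples l q \<and>
          simult_conj Bs (block_diag q [Cs, Ds]))"

text \<open>The type of a diagonal block: its size, the conjugacy classes of its matrices, and whether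
  its centralizer is trivial. The last entry makes the triviality of the centralizer constant
  on each stratum; it can only vary when the whole tuple is a single block.\<close>

type_synonym block_type = "nat \<times> complex mat set list \<times> bool"

definition block_type :: "nat \<Rightarrow> complex mat list \<Rightarrow> block_type" where
  "block_type m Bs = (m, map conj_class Bs, trivial_centralizer m Bs)"

text \<open>A decomposition into indecomposable diagonal blocks, up to simultaneous conjugation. By the
  Krull-Schmidt theorem the multiset of block types depends only on the tuple.\<close>

definition has_type :: "nat \<Rightarrow> complex mat list \<Rightarrow> block_type multiset \<Rightarrow> bool" where
  "has_type q As \<tau> \<longleftrightarrow>
     (\<exists>blocks. (\<forall>(m, Bs)\<in>set blocks. indecomposable m q Bs) \<and>
        simult_conj As (block_diag q (map snd blocks)) \<and>
        \<tau> = mset (map (\<lambda>(m, Bs). block_type m Bs) blocks))"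

definition is_stratum :: "nat \<Rightarrow> complex mat list set \<Rightarrow> complex mat list set \<Rightarrow> bool" where
  "is_stratum q V U \<longleftrightarrow> (\<exists>\<tau>. U = {As \<in> V. has_type q As \<tau>})"

section \<open>Jordan normal forms and admissibility\<close>

text \<open>A JNF records, for each eigenvalue, the multiset of sizes of its Jordan blocks, but not the
  value of the eigenvalue.\<close>

type_synonym jnf = "nat multiset multiset"

definition jnf_of_blocks :: "(nat \<times> complex) list \<Rightarrow> jnf" where
  "jnf_of_blocks bs =
     image_mset (\<lambda>a. image_mset fst (filter_mset (\<lambda>b. snd b = a) (mset bs)))
       (mset_set (snd ` set bs))"

definition mats_of_jnf :: "nat \<Rightarrow> jnf \<Rightarrow> complex mat set" where
  "mats_of_jnf n J = {A \<in> carrier_mat n n. \<exists>bs. jordan_nf A bs \<and> J = jnf_of_blocks bs}"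

text \<open>The minimal rank of \<open>Y - \<lambda>I\<close> for \<open>Y\<close> in \<open>X\<close>; here \<open>X\<close> is the set of all matrices
  with a given JNF, on which the minimum over \<open>\<lambda>\<close> does not depend on \<open>Y\<close>.\<close>

definition min_rank :: "nat \<Rightarrow> complex mat set \<Rightarrow> nat" where
  "min_rank n X = Inf {vec_space.rank n (Y - l \<cdot>\<^sub>m 1\<^sub>m n) | Y l. Y \<in> X}"

definition ranks :: "nat \<Rightarrow> jnf list \<Rightarrow> nat list" where
  "ranks n Js = map (\<lambda>J. min_rank n (mats_of_jnf n J)) Js"

definition cond_\<beta> :: "nat \<Rightarrow> jnf list \<Rightarrow> bool" where
  "cond_\<beta> n Js \<longleftrightarrow> (\<forall>j<length Js. n \<le> (\<Sum>i\<in>{..<length Js} - {j}. ranks n Js ! i))"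

definition cond_\<omega> :: "nat \<Rightarrow> jnf list \<Rightarrow> bool" where
  "cond_\<omega> n Js \<longleftrightarrow> 2 * n \<le> sum_list (ranks n Js)"

definition decrease_smallest :: "nat \<Rightarrow> nat multiset \<Rightarrow> nat multiset" where
  "decrease_smallest k E =
     (let bs = sorted_list_of_multiset E in
      filter_mset (\<lambda>b. 0 < b) (mset (map (\<lambda>b. b - 1) (take k bs) @ drop k bs)))"

text \<open>A relation rather than a function, since several eigenvalues may have the greatest number
  of Jordan blocks. An eigenvalue left without blocks is dropped.\<close>

definition jnf_step :: "nat \<Rightarrow> jnf \<Rightarrow> jnf \<Rightarrow> bool" where
  "jnf_step k J J' \<longleftrightarrow>
     (\<exists>E\<in>#J. (\<forall>F\<in>#J. size F \<le> size E) \<and>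
        J' = filter_mset (\<lambda>F. F \<noteq> {#}) (add_mset (decrease_smallest k E) (J - {#E#})))"

definition psi_step :: "nat \<times> jnf list \<Rightarrow> nat \<times> jnf list \<Rightarrow> bool" where
  "psi_step = (\<lambda>(n, Js) (n1, Js1).
     1 < n \<and> cond_\<beta> n Js \<and> \<not> cond_\<omega> n Js \<and>
     n1 = sum_list (ranks n Js) - n \<and> list_all2 (jnf_step (n - n1)) Js Js1)"

definition admissible_jnfs :: "nat \<Rightarrow> jnf list \<Rightarrow> bool" where
  "admissible_jnfs n Js \<longleftrightarrow> cond_\<beta> n Js \<and>
     (cond_\<omega> n Js \<or>
      (\<exists>n' Js'. psi_step\<^sup>*\<^sup>* (n, Js) (n', Js') \<and> \<not> Domainp psi_step (n', Js') \<and>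
         (cond_\<omega> n' Js' \<or> n' = 1)))"

definition admissible_classes :: "nat \<Rightarrow> complex mat set list \<Rightarrow> bool" where
  "admissible_classes n cs \<longleftrightarrow>
     (\<exists>Js. list_all2 (\<lambda>c J. c \<subseteq> mats_of_jnf n J) cs Js \<and> admissible_jnfs n Js)"

definition mat_trace :: "complex mat \<Rightarrow> complex" where
  "mat_trace A = (\<Sum>i<dim_row A. A $$ (i, i))"

definition admissible_add :: "nat \<Rightarrow> complex mat set list \<Rightarrow> bool" where
  "admissible_add n cs \<longleftrightarrow> set cs \<subseteq> gl_classes n \<and>
     (\<forall>As. list_all2 (\<in>) As cs \<longrightarrow> (\<Sum>A\<leftarrow>As. mat_trace A) = 0) \<and> admissible_classes n cs"

definition admissible_mult :: "nat \<Rightarrow> complex mat set list \<Rightarrow> bool" where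
  "admissible_mult n Cs \<longleftrightarrow> set Cs \<subseteq> GL_classes n \<and>
     (\<forall>Ms. list_all2 (\<in>) Ms Cs \<longrightarrow> (\<Prod>M\<leftarrow>Ms. det M) = 1) \<and> admissible_classes n Cs"

end

theory Submission
  imports Defs
begin

text \<open>All the classes are equal to the class of \<open>\<epsilon> I + N\<close> with \<open>N\<close> of rank one and
  \<open>N\<^sup>2 = 0\<close>, where \<open>\<epsilon>\<close> is \<open>0\<close> or \<open>1\<close>, and \<open>p + 1 = n + 2\<close>; then \<open>-\<kappa> = 2 n - 4\<close>.
  The stratum consists of the tuples conjugate to the direct sum of a block of size \<open>n - 1\<close> with
  trivial centralizer and a scalar block. It contains tuples whose images span only a
  three-dimensional space; for these the equation is essentially one for \<open>3 \<times> 3\<close>-matrices. All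
  but three of the matrices can be chosen freely, and since the inverse of their product is a
  companion matrix in a suitable basis, three further matrices of the class close up the tuple.
  This gives \<open>n\<^sup>2 + 3 n - 16\<close> parameters, while the expected dimension is \<open>n\<^sup>2 + 2 n - 3\<close>.
  On the other hand, if the last three matrices (minus \<open>\<epsilon> I\<close>) have independent images and
  independent coimages, then all images lie in the span of the images of the other \<open>n - 1\<close>
  matrices, and likewise for the coimages, so the centralizer is not trivial. Hence a minor that does not
  vanish on the stratum vanishes on the tuples with trivial centralizer.\<close>

section \<open>Zariski closed sets\<close>

text \<open>Why confining the images pays off: it gives up about n entries in each of the n + 2
  images, but the equation then has only three nonzero rows, so about 3n of the n^2 scalar
  conditions remain. The quadratic terms cancel. The position of the three-space and of the common
  kernel adds about 4n parameters, and the outcome is a surplus in the linear term only; therefore n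
  has to reach 14. The number n + 2 is tied to the obstruction: besides the last three there are n -
  1 matrices, and n - 1 vectors never span the whole space. Dimension means the length of chains of
  irreducible closed sets. A lower bound thus needs explicit rational formulas for points of the
  stratum and, for each parameter, a polynomial in the matrix entries that recovers it; this is why
  the family below is normalised so rigidly. An upper bound is needed for the conjugacy class only,
  whose exact dimension enters \<kappa>.\<close>

lemma topspace_zariski: "topspace (zariski n q) = tuples n q"
proof (rule antisym)
  show "topspace (zariski n q) \<subseteq> tuples n q"
    unfolding topspace_def openin_zariski zariski_open_def by blast
  have "zariski_open n q (tuples n q)"
    unfolding zariski_open_def
    by (intro exI[of _ "{\<lambda>_. 1}"]) (auto intro: poly_fun.const)
  then show "tuples n q \<subseteq> topspace (zariski n q)"
    by (simp add: openin_subset openin_zariski)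
qed

lemma closedin_zariski_iff:
  "closedin (zariski n q) C \<longleftrightarrow>
     (\<exists>F \<subseteq> poly_fun n q. C = {As \<in> tuples n q. \<forall>f\<in>F. f As = 0})"
proof
  assume "closedin (zariski n q) C"
  then have C: "C \<subseteq> tuples n q" and "zariski_open n q (tuples n q - C)"
    by (simp_all add: closedin_def topspace_zariski openin_zariski)
  then obtain F where F: "F \<subseteq> poly_fun n q" "tuples n q - C = {As \<in> tuples n q. \<exists>f\<in>F. f As \<noteq> 0}"
    unfolding zariski_open_def by blast
  have "C = {As \<in> tuples n q. \<forall>f\<in>F. f As = 0}"
    using C F(2) by blast
  with F(1) show "\<exists>F \<subseteq> poly_fun n q. C = {As \<in> tuples n q. \<forall>f\<in>F. f As = 0}" by blast
next
  assume "\<exists>F \<subseteq> poly_fun n q. C = {As \<in> tuples n q. \<forall>f\<in>F. f As = 0}"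
  then obtain F where F: "F \<subseteq> poly_fun n q" "C = {As \<in> tuples n q. \<forall>f\<in>F. f As = 0}" by blast
  have "tuples n q - C = {As \<in> tuples n q. \<exists>f\<in>F. f As \<noteq> 0}" using F(2) by blast
  then have "zariski_open n q (tuples n q - C)"
    unfolding zariski_open_def using F(1) by blast
  then show "closedin (zariski n q) C"
    unfolding closedin_def topspace_zariski openin_zariski using F(2) by blast
qed

lemma closedin_subtopology_zariski_iff:
  assumes "S \<subseteq> tuples n q"
  shows "closedin (subtopology (zariski n q) S) C \<longleftrightarrow>
     (\<exists>F \<subseteq> poly_fun n q. C = {s \<in> S. \<forall>f\<in>F. f s = 0})"
proof
  assume "closedin (subtopology (zariski n q) S) C"
  then obtain T F where "F \<subseteq> poly_fun n q" "T = {As \<in> tuples n q. \<forall>f\<in>F. f As = 0}" "C = T \<inter> S"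
    unfolding closedin_subtopology closedin_zariski_iff by blast
  with assms show "\<exists>F \<subseteq> poly_fun n q. C = {s \<in> S. \<forall>f\<in>F. f s = 0}" by blast
next
  assume "\<exists>F \<subseteq> poly_fun n q. C = {s \<in> S. \<forall>f\<in>F. f s = 0}"
  then obtain F where F: "F \<subseteq> poly_fun n q" "C = {s \<in> S. \<forall>f\<in>F. f s = 0}" by blast
  then have "C = {As \<in> tuples n q. \<forall>f\<in>F. f As = 0} \<inter> S" using assms by blast
  then show "closedin (subtopology (zariski n q) S) C"
    unfolding closedin_subtopology closedin_zariski_iff using F(1) by blast
qed

lemma closedin_zero_set:
  assumes "S \<subseteq> tuples n q" "f \<in> poly_fun n q"
  shows "closedin (subtopology (zariski n q) S) {s \<in> S. f s = 0}"
  unfolding closedin_subtopology_zariski_iff[OF assms(1)]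
  using assms(2) by (intro exI[of _ "{f}"]) auto

lemma poly_fun_sum:
  "finite A \<Longrightarrow> (\<And>a. a \<in> A \<Longrightarrow> f a \<in> poly_fun n q) \<Longrightarrow> (\<lambda>s. \<Sum>a\<in>A. f a s) \<in> poly_fun n q"
  by (induction A rule: finite_induct) (auto intro: poly_fun.const poly_fun.add)

lemma poly_fun_power: "f \<in> poly_fun n q \<Longrightarrow> (\<lambda>s. f s ^ k) \<in> poly_fun n q"
  by (induction k) (auto intro: poly_fun.const poly_fun.mult)

section \<open>Rational functions and a lower bound for the dimension\<close>

text \<open>For \<open>D = UNIV\<close> these are polynomial functions.\<close>

inductive_set rat_fun :: "('i \<Rightarrow> complex) set \<Rightarrow> (('i \<Rightarrow> complex) \<Rightarrow> complex) set" for D where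
  const: "(\<lambda>_. c) \<in> rat_fun D"
| coord: "(\<lambda>p. p i) \<in> rat_fun D"
| add: "f \<in> rat_fun D \<Longrightarrow> g \<in> rat_fun D \<Longrightarrow> (\<lambda>p. f p + g p) \<in> rat_fun D"
| mult: "f \<in> rat_fun D \<Longrightarrow> g \<in> rat_fun D \<Longrightarrow> (\<lambda>p. f p * g p) \<in> rat_fun D"
| inverse: "f \<in> rat_fun D \<Longrightarrow> (\<And>p. p \<in> D \<Longrightarrow> f p \<noteq> 0) \<Longrightarrow> (\<lambda>p. inverse (f p)) \<in> rat_fun D"

lemma rat_fun_uminus: "f \<in> rat_fun D \<Longrightarrow> (\<lambda>p. - f p) \<in> rat_fun D"
  using rat_fun.mult[OF rat_fun.const[of "-1"], of f D] by simp

lemma rat_fun_diff: "f \<in> rat_fun D \<Longrightarrow> g \<in> rat_fun D \<Longrightarrow> (\<lambda>p. f p - g p) \<in> rat_fun D"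
  using rat_fun.add[OF _ rat_fun_uminus, of f D g] by simp

lemma rat_fun_divide:
  "f \<in> rat_fun D \<Longrightarrow> g \<in> rat_fun D \<Longrightarrow> (\<And>p. p \<in> D \<Longrightarrow> g p \<noteq> 0) \<Longrightarrow> (\<lambda>p. f p / g p) \<in> rat_fun D"
  unfolding divide_inverse by (intro rat_fun.mult rat_fun.inverse)

lemma rat_fun_sum:
  "(\<And>a. a \<in> A \<Longrightarrow> f a \<in> rat_fun D) \<Longrightarrow> (\<lambda>p. \<Sum>a\<in>A. f a p) \<in> rat_fun D"
  by (induction A rule: infinite_finite_induct) (auto intro: rat_fun.const rat_fun.add)

lemma rat_fun_prod:
  "(\<And>a. a \<in> A \<Longrightarrow> f a \<in> rat_fun D) \<Longrightarrow> (\<lambda>p. \<Prod>a\<in>A. f a p) \<in> rat_fun D"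
  by (induction A rule: infinite_finite_induct) (auto intro: rat_fun.const rat_fun.mult)

lemma rat_fun_UNIV_subset: "f \<in> rat_fun UNIV \<Longrightarrow> f \<in> rat_fun D"
  by (induction rule: rat_fun.induct) (auto intro: rat_fun.intros)

lemmas rat_fun_intros = rat_fun.const rat_fun.coord rat_fun.add rat_fun.mult
  rat_fun_uminus rat_fun_diff rat_fun_divide rat_fun_sum

definition line :: "('i \<Rightarrow> complex) \<Rightarrow> ('i \<Rightarrow> complex) \<Rightarrow> complex \<Rightarrow> 'i \<Rightarrow> complex" where
  "line p p' t = (\<lambda>i. p i + t * (p' i - p i))"

text \<open>A substitute for a dense open set of parameters: density is tested along lines, where it
  becomes a statement about roots of polynomials in one variable. A line between two points that
  agree in a coordinate keeps this coordinate, so frozen coordinates do no harm.\<close>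

definition line_dense :: "('i \<Rightarrow> complex) set \<Rightarrow> bool" where
  "line_dense D \<longleftrightarrow> (\<forall>p\<in>D. \<forall>p'. finite {t. line p p' t \<notin> D})"

lemma line_0 [simp]: "line p p' 0 = p" by (simp add: line_def)
lemma line_1 [simp]: "line p p' 1 = p'" by (simp add: line_def)

lemma rat_fun_line:
  assumes "f \<in> rat_fun D" "p \<in> D"
  shows "\<exists>A B. B \<noteq> 0 \<and> (\<forall>t. line p p' t \<in> D \<longrightarrow>
           poly B t \<noteq> 0 \<and> f (line p p' t) = poly A t / poly B t)"
  using assms(1)
proof induction
  case (const c)
  show ?case by (intro exI[of _ "[:c:]"] exI[of _ 1]) simp
next
  case (coord i)
  show ?case by (intro exI[of _ "[:p i, p' i - p i:]"] exI[of _ 1]) (simp add: line_def)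
next
  case (add f g)
  then obtain A B A' B' where B: "B \<noteq> 0" "B' \<noteq> 0"
    and A: "\<And>t. line p p' t \<in> D \<Longrightarrow> poly B t \<noteq> 0 \<and> f (line p p' t) = poly A t / poly B t"
    and A': "\<And>t. line p p' t \<in> D \<Longrightarrow> poly B' t \<noteq> 0 \<and> g (line p p' t) = poly A' t / poly B' t"
    by blast
  show ?case
    using B A A' by (intro exI[of _ "A * B' + A' * B"] exI[of _ "B * B'"]) (auto simp: field_simps)
next
  case (mult f g)
  then obtain A B A' B' where B: "B \<noteq> 0" "B' \<noteq> 0"
    and A: "\<And>t. line p p' t \<in> D \<Longrightarrow> poly B t \<noteq> 0 \<and> f (line p p' t) = poly A t / poly B t"
    and A': "\<And>t. line p p' t \<in> D \<Longrightarrow> poly B' t \<noteq> 0 \<and> g (line p p' t) = poly A' t / poly B' t"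
    by blast
  show ?case
    using B A A' by (intro exI[of _ "A * A'"] exI[of _ "B * B'"]) auto
next
  case (inverse f)
  then obtain A B where B: "B \<noteq> 0"
    and A: "\<And>t. line p p' t \<in> D \<Longrightarrow> poly B t \<noteq> 0 \<and> f (line p p' t) = poly A t / poly B t"
    by blast
  have *: "poly A t \<noteq> 0" if "line p p' t \<in> D" for t
    using A[OF that] inverse(2)[OF that] by auto
  \<comment> \<open>Since \<open>p\<close> lies in the domain, \<open>t = 0\<close> shows that the
    numerator is not the zero polynomial, so it may become the denominator.\<close>
  from *[of 0] assms(2) have "A \<noteq> 0" by auto
  with * A show ?case by (intro exI[of _ B] exI[of _ A]) (auto simp: field_simps)
qed

lemma line_dense_nonzero:
  assumes "g \<in> rat_fun UNIV"
  shows "line_dense {p. g p \<noteq> 0}"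
  unfolding line_dense_def
proof (intro ballI allI)
  fix p p' assume p: "p \<in> {p. g p \<noteq> 0}"
  obtain A B where B: "\<And>t. poly B t \<noteq> 0 \<and> g (line p p' t) = poly A t / poly B t"
    using rat_fun_line[OF assms, of p p'] by auto
  have "poly A 0 \<noteq> 0" using B[of 0] p by auto
  then have "A \<noteq> 0" by auto
  then have "finite {t. poly A t = 0}" by (rule poly_roots_finite)
  moreover have "{t. line p p' t \<notin> {p. g p \<noteq> 0}} = {t. poly A t = 0}" using B by auto
  ultimately show "finite {t. line p p' t \<notin> {p. g p \<noteq> 0}}" by simp
qed

text \<open>Irreducibility of the parameter set: on the line from a point with \<open>f\<close>
  nonzero to a point with \<open>g\<close> nonzero, each of the three conditions fails for finitely
  many \<open>t\<close> only.\<close>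

lemma rat_fun_common_nonzero:
  assumes D: "line_dense D" and f: "f \<in> rat_fun D" "g \<in> rat_fun D"
    and p: "p \<in> D" "p' \<in> D" "f p \<noteq> 0" "g p' \<noteq> 0"
  shows "\<exists>t. line p p' t \<in> D \<and> f (line p p' t) \<noteq> 0 \<and> g (line p p' t) \<noteq> 0"
proof -
  obtain A B where A: "\<And>t. line p p' t \<in> D \<Longrightarrow> poly B t \<noteq> 0 \<and> f (line p p' t) = poly A t / poly B t"
    using rat_fun_line[OF f(1) p(1)] by blast
  obtain A' B' where A': "\<And>t. line p p' t \<in> D \<Longrightarrow> poly B' t \<noteq> 0 \<and> g (line p p' t) = poly A' t / poly B' t"
    using rat_fun_line[OF f(2) p(1)] by blast
  have "poly A 0 \<noteq> 0" using A[of 0] p by auto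
  then have "A \<noteq> 0" by auto
  have "poly A' 1 \<noteq> 0" using A'[of 1] p by auto
  then have "A' \<noteq> 0" by auto
  have "finite ({t. line p p' t \<notin> D} \<union> {t. poly A t = 0} \<union> {t. poly A' t = 0})"
    using D p(1) \<open>A \<noteq> 0\<close> \<open>A' \<noteq> 0\<close> by (auto simp: line_dense_def poly_roots_finite)
  then obtain t where "t \<notin> {t. line p p' t \<notin> D} \<union> {t. poly A t = 0} \<union> {t. poly A' t = 0}"
    using infinite_UNIV_char_0[where 'a=complex] by (metis ex_new_if_finite)
  then show ?thesis using A[of t] A'[of t] by (intro exI[of _ t]) auto
qed

lemma poly_fun_comp_rat:
  assumes "f \<in> poly_fun n q"
    and "\<And>k i j. k < q \<Longrightarrow> i < n \<Longrightarrow> j < n \<Longrightarrow> (\<lambda>p. (\<phi> p ! k) $$ (i, j)) \<in> rat_fun D"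
  shows "(\<lambda>p. f (\<phi> p)) \<in> rat_fun D"
  using assms(1) by induction (auto intro: rat_fun.intros assms(2))

text \<open>The coordinates are released one group after the other; the closures of the images of the
  resulting sets of parameters form a chain of irreducible sets.\<close>

theorem card_le_zdim:
  fixes \<phi> :: "('i \<Rightarrow> complex) \<Rightarrow> complex mat list" and grp :: "'i \<Rightarrow> nat"
  assumes S: "S \<subseteq> tuples n q" and D: "line_dense D" "b \<in> D"
    and phi: "\<And>p. p \<in> D \<Longrightarrow> \<phi> p \<in> S"
    and rat: "\<And>k i j. k < q \<Longrightarrow> i < n \<Longrightarrow> j < n \<Longrightarrow> (\<lambda>p. (\<phi> p ! k) $$ (i, j)) \<in> rat_fun D"
    and I: "finite I"
    and detect: "\<And>i. i \<in> I \<Longrightarrow> \<exists>f\<in>poly_fun n q. \<exists>c.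
       (\<forall>p\<in>D. p i = b i \<longrightarrow> (\<forall>x. grp i < grp x \<longrightarrow> p x = b x) \<longrightarrow> f (\<phi> p) = c) \<and>
       (\<forall>t. t \<noteq> 0 \<longrightarrow> b(i := b i + t) \<in> D \<longrightarrow> f (\<phi> (b(i := b i + t))) \<noteq> c)"
  shows "enat (card I) \<le> zdim n q S"
proof -
  obtain ys where ys: "set ys = I" "distinct ys" using finite_distinct_list[OF I] by blast
  \<comment> \<open>Sorting by group ensures that whatever is released before \<open>xs ! j\<close>
    is allowed to vary in the detection of \<open>xs ! j\<close>.\<close>
  define xs where "xs = sort_key grp ys"
  have xs: "set xs = I" "distinct xs" "sorted (map grp xs)" "length xs = card I"
    using ys by (auto simp: xs_def distinct_card[OF ys(2), symmetric])
  define A where "A j = {p \<in> D. \<forall>x. x \<notin> set (take j xs) \<longrightarrow> p x = b x}" for j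
  \<comment> \<open>The closure in \<open>S\<close> of the image of \<open>A j\<close>.\<close>
  define Z where "Z j = {s \<in> S. \<forall>f\<in>poly_fun n q. (\<forall>p\<in>A j. f (\<phi> p) = 0) \<longrightarrow> f s = 0}" for j
  let ?T = "subtopology (zariski n q) S"
  have bA: "b \<in> A j" for j using D(2) by (simp add: A_def)
  have phiZ: "\<phi> p \<in> Z j" if "p \<in> A j" for p j
    using that phi[of p] by (auto simp: A_def Z_def)
  have "irreducible_closedin ?T (Z j)" for j
    unfolding irreducible_closedin_def
  proof (intro conjI allI impI)
    show "closedin ?T (Z j)"
      unfolding closedin_subtopology_zariski_iff[OF S] Z_def
      by (intro exI[of _ "{f \<in> poly_fun n q. \<forall>p\<in>A j. f (\<phi> p) = 0}"]) auto
    show "Z j \<noteq> {}" using phiZ[OF bA] by blast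
  next
    fix C C' assume C: "closedin ?T C" "closedin ?T C'" "Z j \<subseteq> C \<union> C'"
    obtain F where F: "F \<subseteq> poly_fun n q" "C = {s \<in> S. \<forall>f\<in>F. f s = 0}"
      using C(1) unfolding closedin_subtopology_zariski_iff[OF S] by blast
    obtain F' where F': "F' \<subseteq> poly_fun n q" "C' = {s \<in> S. \<forall>f\<in>F'. f s = 0}"
      using C(2) unfolding closedin_subtopology_zariski_iff[OF S] by blast
    show "Z j \<subseteq> C \<or> Z j \<subseteq> C'"
    proof (rule ccontr)
      assume neg: "\<not> (Z j \<subseteq> C \<or> Z j \<subseteq> C')"
      then obtain s f where s: "s \<in> Z j" "f \<in> F" "f s \<noteq> 0" unfolding F(2) Z_def by blast
      have "\<exists>p\<in>A j. f (\<phi> p) \<noteq> 0" using s F(1) unfolding Z_def by blast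
      then obtain p where p: "p \<in> A j" "f (\<phi> p) \<noteq> 0" by blast
      from neg obtain s' f' where s': "s' \<in> Z j" "f' \<in> F'" "f' s' \<noteq> 0" unfolding F'(2) Z_def by blast
      have "\<exists>p\<in>A j. f' (\<phi> p) \<noteq> 0" using s' F'(1) unfolding Z_def by blast
      then obtain p' where p': "p' \<in> A j" "f' (\<phi> p') \<noteq> 0" by blast
      have r: "(\<lambda>p. f (\<phi> p)) \<in> rat_fun D" "(\<lambda>p. f' (\<phi> p)) \<in> rat_fun D"
        by (rule poly_fun_comp_rat[OF subsetD[OF F(1) s(2)] rat]; assumption)
          (rule poly_fun_comp_rat[OF subsetD[OF F'(1) s'(2)] rat]; assumption)
      have pD: "p \<in> D" "p' \<in> D" using p(1) p'(1) by (simp_all add: A_def)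
      obtain t where t: "line p p' t \<in> D" "f (\<phi> (line p p' t)) \<noteq> 0" "f' (\<phi> (line p p' t)) \<noteq> 0"
        using rat_fun_common_nonzero[of D "\<lambda>p. f (\<phi> p)" "\<lambda>p. f' (\<phi> p)" p p', OF D(1) r pD p(2) p'(2)]
        by (elim exE conjE)
      have "line p p' t \<in> A j" using t(1) p(1) p'(1) by (auto simp: A_def line_def)
      then have "\<phi> (line p p' t) \<in> C \<union> C'" using C(3) phiZ by blast
      with t s(2) s'(2) F(2) F'(2) show False by auto
    qed
  qed
  moreover have "Z j \<subset> Z (Suc j)" if j: "j < card I" for j
  proof -
    have "A j \<subseteq> A (Suc j)" using xs(4) j by (auto simp: A_def take_Suc_conv_app_nth)
    then have "Z j \<subseteq> Z (Suc j)" unfolding Z_def by blast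
    moreover
    define i where "i = xs ! j"
    have i: "i \<in> I" using xs j by (auto simp: i_def)
    obtain f c where f: "f \<in> poly_fun n q" and
      c: "(\<forall>p\<in>D. p i = b i \<longrightarrow> (\<forall>x. grp i < grp x \<longrightarrow> p x = b x) \<longrightarrow> f (\<phi> p) = c) \<and>
         (\<forall>t. t \<noteq> 0 \<longrightarrow> b(i := b i + t) \<in> D \<longrightarrow> f (\<phi> (b(i := b i + t))) \<noteq> c)"
      using detect[OF i] by (elim bexE exE)
    have g: "(\<lambda>s. f s + (- c)) \<in> poly_fun n q" by (intro poly_fun.add poly_fun.const f)
    have zero: "f (\<phi> p) = c" if p: "p \<in> A j" for p
    proof (rule conjunct1[OF c, rule_format])
      show "p \<in> D" using p by (simp add: A_def)
      have "i \<notin> set (take j xs)"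
        using xs(2) j xs(4) by (auto simp: i_def in_set_conv_nth nth_eq_iff_index_eq)
      then show "p i = b i" using p by (simp add: A_def)
      show "p x = b x" if x: "grp i < grp x" for x
      proof -
        have "x \<notin> set (take j xs)"
        proof
          assume "x \<in> set (take j xs)"
          then obtain l where l: "l < j" "x = xs ! l" using xs(4) j by (auto simp: in_set_conv_nth)
          then have "grp x \<le> grp i"
            using sorted_nth_mono[OF xs(3), of l j] j xs(4) by (auto simp: i_def)
          with x show False by simp
        qed
        then show "p x = b x" using p by (simp add: A_def)
      qed
    qed
    \<comment> \<open>Density along direction \<open>i\<close> provides a nonzero displacement that
      stays in \<open>D\<close>; its image lies in the larger closure and not in the smaller
      one.\<close>
    have "finite {t. line b (b(i := b i + 1)) t \<notin> D}" using D by (auto simp: line_dense_def)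
    then have "finite ({t. line b (b(i := b i + 1)) t \<notin> D} \<union> {0})" by simp
    then obtain t where t: "t \<notin> {t. line b (b(i := b i + 1)) t \<notin> D} \<union> {0}"
      using infinite_UNIV_char_0[where 'a=complex] by (metis ex_new_if_finite)
    have "line b (b(i := b i + 1)) t = b(i := b i + t)" by (auto simp: line_def)
    with t have t: "t \<noteq> 0" "b(i := b i + t) \<in> D" by auto
    then have "b(i := b i + t) \<in> A (Suc j)"
      using xs(4) j by (auto simp: A_def i_def take_Suc_conv_app_nth)
    then have "\<phi> (b(i := b i + t)) \<in> Z (Suc j)" by (rule phiZ)
    moreover have "\<phi> (b(i := b i + t)) \<notin> Z j"
    proof
      assume "\<phi> (b(i := b i + t)) \<in> Z j"
      then have "(\<lambda>s. f s + (- c)) (\<phi> (b(i := b i + t))) = 0"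
        unfolding Z_def using g zero by auto
      with conjunct2[OF c, rule_format, OF t] show False by simp
    qed
    ultimately show ?thesis by blast
  qed
  ultimately have "enat (card I) \<in> {enat d | d. \<exists>Z. (\<forall>i\<le>d. irreducible_closedin ?T (Z i)) \<and> (\<forall>i<d. Z i \<subset> Z (Suc i))}"
    by (intro CollectI exI[of _ "card I"] conjI refl exI[of _ Z]) auto
  then show ?thesis unfolding zdim_def krull_dim_def by (rule Sup_upper)
qed

section \<open>An upper bound for the dimension\<close>

text \<open>The head of the list is the exponent of the variable with the highest index, so that
  prepending an entry adds a new variable. The induction along a chain needs this order.\<close>

fun mon :: "(nat \<Rightarrow> complex) \<Rightarrow> nat list \<Rightarrow> complex" where
  "mon p [] = 1"
| "mon p (j # xs) = p (length xs) ^ j * mon p xs"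

definition exps :: "nat \<Rightarrow> nat \<Rightarrow> nat list set" where
  "exps r d = {xs. set xs \<subseteq> {..r} \<and> length xs = d}"

lemma finite_exps [simp]: "finite (exps r d)"
  unfolding exps_def by (rule finite_lists_length_eq) simp

lemma card_exps: "card (exps r d) = (r + 1) ^ d"
  unfolding exps_def by (subst card_lists_length_eq) auto

lemma exps_0 [simp]: "exps r 0 = {[]}" by (auto simp: exps_def)

lemma sum_exps_Suc:
  "(\<Sum>xs\<in>exps r (Suc d). f xs) = (\<Sum>j\<le>r. \<Sum>xs\<in>exps r d. f (j # xs))"
proof -
  have "exps r (Suc d) = (\<lambda>(j, xs). j # xs) ` ({..r} \<times> exps r d)"
    by (auto simp: exps_def image_iff length_Suc_conv)
  moreover have "inj_on (\<lambda>(j, xs). j # xs) ({..r} \<times> exps r d)" by (auto simp: inj_on_def)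
  ultimately show ?thesis
    by (simp only: sum.reindex) (simp add: sum.cartesian_product case_prod_beta)
qed

lemma length_exps: "xs \<in> exps r d \<Longrightarrow> length xs = d" by (simp add: exps_def)

lemma poly_fun_mon:
  "(\<And>i. i < length xs \<Longrightarrow> f i \<in> poly_fun n q) \<Longrightarrow> (\<lambda>s. mon (\<lambda>i. f i s) xs) \<in> poly_fun n q"
  by (induction xs) (auto intro!: poly_fun.const poly_fun.mult poly_fun_power)

text \<open>The functions \<open>f i\<close> that witness the strict inclusions are algebraically
  independent on the top set. A relation is read as a polynomial in the newest function
  \<open>f d\<close>; after cancelling the lowest power that occurs, restriction to
  \<open>Z d\<close> leaves a relation between the earlier functions.\<close>

lemma chain_independent:
  fixes c :: "nat list \<Rightarrow> complex"
  assumes S: "S \<subseteq> tuples n q"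
    and irr: "\<And>i. i \<le> d \<Longrightarrow> irreducible_closedin (subtopology (zariski n q) S) (Z i)"
    and mono: "\<And>i. i < d \<Longrightarrow> Z i \<subseteq> Z (Suc i)"
    and f: "\<And>i. i < d \<Longrightarrow> f i \<in> poly_fun n q"
      "\<And>i s. i < d \<Longrightarrow> s \<in> Z i \<Longrightarrow> f i s = 0"
      "\<And>i. i < d \<Longrightarrow> \<exists>s\<in>Z (Suc i). f i s \<noteq> 0"
    and "\<And>s. s \<in> Z d \<Longrightarrow> (\<Sum>xs\<in>exps r d. c xs * mon (\<lambda>i. f i s) xs) = 0"
  shows "\<forall>xs\<in>exps r d. c xs = 0"
  using irr mono f assms(7)
proof (induction d arbitrary: c)
  case 0
  then obtain s where "s \<in> Z 0" by (auto simp: irreducible_closedin_def)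
  with 0(6)[of s] show ?case by simp
next
  case (Suc d)
  let ?T = "subtopology (zariski n q) S"
  define G where "G j s = (\<Sum>xs\<in>exps r d. c (j # xs) * mon (\<lambda>i. f i s) xs)" for j s
  have G: "G j \<in> poly_fun n q" for j
    unfolding G_def using Suc.prems(3)
    by (auto intro!: poly_fun_sum poly_fun.mult poly_fun.const poly_fun_mon dest: length_exps)
  have IH: "\<forall>xs\<in>exps r d. c (j # xs) = 0" if "\<And>s. s \<in> Z d \<Longrightarrow> G j s = 0" for j
    using Suc.IH[of "\<lambda>xs. c (j # xs)"] Suc.prems that unfolding G_def by auto
  have sumG: "(\<Sum>j\<le>r. f d s ^ j * G j s) = 0" if "s \<in> Z (Suc d)" for s
    using Suc.prems(6)[OF that] unfolding G_def sum_exps_Suc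
    by (auto simp: sum_distrib_left length_exps algebra_simps cong: sum.cong)
  have "\<forall>j\<le>r. \<forall>xs\<in>exps r d. c (j # xs) = 0"
  proof (rule ccontr)
    assume "\<not> ?thesis"
    then have ex: "\<exists>j. j \<le> r \<and> (\<exists>xs\<in>exps r d. c (j # xs) \<noteq> 0)" by blast
    define m where "m = (LEAST j. j \<le> r \<and> (\<exists>xs\<in>exps r d. c (j # xs) \<noteq> 0))"
    have m: "m \<le> r" "\<exists>xs\<in>exps r d. c (m # xs) \<noteq> 0"
      using LeastI_ex[OF ex] by (auto simp: m_def)
    have less: "G j s = 0" if "j < m" for j s
      using not_less_Least[OF that[unfolded m_def]] that m(1) by (auto simp: G_def)
    \<comment> \<open>The relation divided by \<open>f d ^ m\<close>. Irreducibility of the top set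
      permits the cancellation, because \<open>f d\<close> does not vanish on it
      identically.\<close>
    define H where "H s = (\<Sum>j\<in>{m..r}. f d s ^ (j - m) * G j s)" for s
    have H: "H \<in> poly_fun n q"
      unfolding H_def using Suc.prems(3) G by (auto intro!: poly_fun_sum poly_fun.mult poly_fun_power)
    have "f d s ^ m * H s = 0" if "s \<in> Z (Suc d)" for s
    proof -
      have "f d s ^ m * H s = (\<Sum>j\<in>{m..r}. f d s ^ j * G j s)"
        unfolding H_def sum_distrib_left
        by (rule sum.cong) (auto simp: mult.assoc[symmetric] power_add[symmetric])
      also have "\<dots> = (\<Sum>j\<le>r. f d s ^ j * G j s)"
        using less by (intro sum.mono_neutral_left) auto
      finally show ?thesis using sumG[OF that] by simp
    qed
    then have *: "Z (Suc d) \<subseteq> {s \<in> S. f d s = 0} \<union> {s \<in> S. H s = 0}"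
      using Suc.prems(1)[of "Suc d"] closedin_subset[of ?T "Z (Suc d)"]
      by (auto simp: irreducible_closedin_def)
    have "Z (Suc d) \<subseteq> {s \<in> S. f d s = 0} \<or> Z (Suc d) \<subseteq> {s \<in> S. H s = 0}"
      using Suc.prems(1)[of "Suc d"] * closedin_zero_set[OF S Suc.prems(3)[of d]] closedin_zero_set[OF S H]
      unfolding irreducible_closedin_def by (metis (lifting) lessI order_refl)
    then have Hz: "\<And>s. s \<in> Z (Suc d) \<Longrightarrow> H s = 0" using Suc.prems(5)[of d] by auto
    \<comment> \<open>On \<open>Z d\<close> the function \<open>f d\<close> is zero, so only the
      constant coefficient of \<open>H\<close> survives.\<close>
    have "G m s = 0" if s: "s \<in> Z d" for s
    proof -
      have "H s = (\<Sum>j\<in>{m}. f d s ^ (j - m) * G j s)"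
        unfolding H_def using m(1) Suc.prems(4)[of d s] s
        by (intro sum.mono_neutral_right) (auto simp: power_0_left)
      then show ?thesis using Hz[of s] Suc.prems(2)[of d] s by auto
    qed
    with IH m(2) show False by blast
  qed
  then show ?case by (auto simp: exps_def length_Suc_conv)
qed

text \<open>Padding with zero rows gives a square matrix; it is singular because a unit vector
  annihilates it from the left.\<close>

lemma homogeneous_solution:
  fixes M :: "'b \<Rightarrow> 'a \<Rightarrow> complex"
  assumes A: "finite A" and B: "finite B" and less: "card B < card A"
  shows "\<exists>x. (\<exists>a\<in>A. x a \<noteq> 0) \<and> (\<forall>b\<in>B. (\<Sum>a\<in>A. M b a * x a) = 0)"
proof -
  define N where "N = card A"
  obtain h where h: "bij_betw h {..<N} A" using ex_bij_betw_nat_finite[OF A] by (auto simp: N_def lessThan_atLeast0)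
  obtain h' where h': "bij_betw h' {..<card B} B" using ex_bij_betw_nat_finite[OF B] by (auto simp: lessThan_atLeast0)
  define W where "W = mat N N (\<lambda>(i, j). if i < card B then M (h' i) (h j) else 0)"
  have W: "W \<in> carrier_mat N N" by (simp add: W_def)
  have "transpose_mat W *\<^sub>v unit_vec N (card B) = 0\<^sub>v N"
    using less by (intro eq_vecI) (auto simp: W_def N_def)
  moreover have "unit_vec N (card B) \<noteq> (0\<^sub>v N :: complex vec)"
    using less by (auto simp: N_def)
  ultimately have "det (transpose_mat W) = 0"
    using W by (intro det_0_iff_vec_prod_zero_field[THEN iffD2, of _ N] exI[of _ "unit_vec N (card B)"]) auto
  then have "det W = 0" using W by (simp add: det_transpose)
  then obtain v where v: "v \<in> carrier_vec N" "v \<noteq> 0\<^sub>v N" "W *\<^sub>v v = 0\<^sub>v N"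
    using W det_0_iff_vec_prod_zero_field[of W N] by auto
  define x where "x a = v $ (inv_into {..<N} h a)" for a
  have xh: "x (h i) = v $ i" if "i < N" for i
    using that h by (auto simp: x_def bij_betw_def inv_into_f_f)
  obtain i where i: "i < N" "v $ i \<noteq> 0" using v(1,2) by (metis carrier_vecD eq_vecI index_zero_vec)
  have "(\<Sum>a\<in>A. M b a * x a) = 0" if "b \<in> B" for b
  proof -
    have "b \<in> h' ` {..<card B}" using that bij_betw_imp_surj_on[OF h'] by simp
    then obtain k where k: "b = h' k" "k \<in> {..<card B}" by (rule imageE)
    then have k: "k < card B" "b = h' k" by simp_all
    have "(\<Sum>a\<in>A. M b a * x a) = (\<Sum>i<N. M b (h i) * x (h i))"
      by (rule sum.reindex_bij_betw[OF h, symmetric])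
    also have "\<dots> = (W *\<^sub>v v) $ k"
      using k less v(1) by (auto simp: W_def N_def scalar_prod_def xh lessThan_atLeast0 intro!: sum.cong)
    finally show ?thesis using v(3) k less by (simp add: N_def)
  qed
  moreover have "h i \<in> A" using i h by (auto simp: bij_betw_def)
  ultimately show ?thesis using i xh by (intro exI[of _ x]) force
qed

section \<open>Polynomials in D parameters with bounded degree in each of them\<close>

inductive_set deg_fun :: "nat \<Rightarrow> nat \<Rightarrow> ((nat \<Rightarrow> complex) \<Rightarrow> complex) set" for D e where
  monom: "xs \<in> exps e D \<Longrightarrow> (\<lambda>p. c * mon p xs) \<in> deg_fun D e"
| add: "f \<in> deg_fun D e \<Longrightarrow> g \<in> deg_fun D e \<Longrightarrow> (\<lambda>p. f p + g p) \<in> deg_fun D e"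

lemma exps_mono: "xs \<in> exps e D \<Longrightarrow> e \<le> e' \<Longrightarrow> xs \<in> exps e' D"
  by (force simp: exps_def)

lemma deg_fun_mono:
  assumes "f \<in> deg_fun D e" "e \<le> e'" shows "f \<in> deg_fun D e'"
  using assms(1) by induction (auto intro!: deg_fun.intros exps_mono[OF _ assms(2)])

lemma mon_replicate_0 [simp]: "mon p (replicate d 0) = 1" by (induction d) auto

lemma deg_fun_const: "(\<lambda>p. c) \<in> deg_fun D e"
proof -
  have "replicate D 0 \<in> exps e D" by (auto simp: exps_def)
  from deg_fun.monom[OF this, of c] show ?thesis by simp
qed

lemma mon_single: "i < D \<Longrightarrow> mon p (replicate (D - Suc i) 0 @ Suc 0 # replicate i 0) = p i"
proof (induction D)
  case (Suc D)
  show ?case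
  proof (cases "i = D")
    case False
    then have "i < D" "Suc D - Suc i = Suc (D - Suc i)" using Suc.prems by auto
    then show ?thesis using Suc.IH by simp
  qed auto
qed simp

lemma deg_fun_coord: "i < D \<Longrightarrow> 1 \<le> e \<Longrightarrow> (\<lambda>p. p i) \<in> deg_fun D e"
proof -
  assume i: "i < D" "1 \<le> e"
  then have "replicate (D - Suc i) 0 @ Suc 0 # replicate i 0 \<in> exps e D"
    by (auto simp: exps_def)
  from deg_fun.monom[OF this, of 1] i(1) show ?thesis by (simp add: mon_single)
qed

lemma mon_map2:
  "length xs = length ys \<Longrightarrow> mon p (map2 (+) xs ys) = mon p xs * mon p ys"
  by (induction xs ys rule: list_induct2) (auto simp: power_add)

lemma exps_map2:
  assumes "xs \<in> exps e D" "ys \<in> exps e' D" shows "map2 (+) xs ys \<in> exps (e + e') D"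
proof -
  have "x + y \<le> e + e'" if "(x, y) \<in> set (zip xs ys)" for x y
    using set_zip_leftD[OF that] set_zip_rightD[OF that] assms by (auto simp: exps_def add_mono subset_eq)
  then show ?thesis using assms by (auto simp: exps_def)
qed

lemma deg_fun_mult:
  assumes f: "f \<in> deg_fun D e" and g: "g \<in> deg_fun D e'"
  shows "(\<lambda>p. f p * g p) \<in> deg_fun D (e + e')"
  using f
proof induction
  case (monom xs c)
  show ?case using g
  proof induction
    case (monom ys c')
    have "(\<lambda>p. (c * c') * mon p (map2 (+) xs ys)) \<in> deg_fun D (e + e')"
      using exps_map2[OF \<open>xs \<in> exps e D\<close> monom] by (rule deg_fun.monom)
    moreover have "length xs = length ys"
      using monom \<open>xs \<in> exps e D\<close> by (simp add: exps_def)
    ultimately show ?case by (simp add: mon_map2 mult_ac)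
  next
    case (add f g)
    from deg_fun.add[OF add(3,4)] show ?case by (simp add: algebra_simps)
  qed
next
  case (add f g')
  from deg_fun.add[OF add(3,4)] show ?case by (simp add: algebra_simps)
qed

lemma deg_fun_power:
  "f \<in> deg_fun D e \<Longrightarrow> (\<lambda>p. f p ^ k) \<in> deg_fun D (e * k)"
  by (induction k) (auto intro: deg_fun_const dest: deg_fun_mult)

lemma deg_fun_mon:
  "(\<And>i. i < length xs \<Longrightarrow> f i \<in> deg_fun D e) \<Longrightarrow>
     (\<lambda>p. mon (\<lambda>i. f i p) xs) \<in> deg_fun D (e * sum_list xs)"
proof (induction xs)
  case (Cons j xs)
  have "(\<lambda>p. f (length xs) p ^ j * mon (\<lambda>i. f i p) xs) \<in> deg_fun D (e * j + e * sum_list xs)"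
    using Cons by (intro deg_fun_mult deg_fun_power) auto
  then show ?case by (simp add: algebra_simps)
qed (simp add: deg_fun_const)

lemma deg_fun_repr:
  assumes "f \<in> deg_fun D e" shows "\<exists>c. \<forall>p. f p = (\<Sum>xs\<in>exps e D. c xs * mon p xs)"
  using assms
proof induction
  case (monom xs c)
  then show ?case
    by (intro exI[of _ "\<lambda>ys. if ys = xs then c else 0"]) (auto simp: if_distrib[of "\<lambda>z. z * _"] cong: if_cong)
next
  case (add f g)
  then obtain c c' where "\<forall>p. f p = (\<Sum>xs\<in>exps e D. c xs * mon p xs)" "\<forall>p. g p = (\<Sum>xs\<in>exps e D. c' xs * mon p xs)"
    by blast
  then show ?case
    by (intro exI[of _ "\<lambda>xs. c xs + c' xs"]) (simp add: sum.distrib algebra_simps)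
qed

lemma poly_fun_comp_deg:
  assumes "f \<in> poly_fun n q"
    and "\<And>k i j. k < q \<Longrightarrow> i < n \<Longrightarrow> j < n \<Longrightarrow> (\<lambda>p. (\<phi> p ! k) $$ (i, j)) \<in> deg_fun D e"
  shows "\<exists>m. (\<lambda>p. f (\<phi> p)) \<in> deg_fun D m"
  using assms(1)
proof induction
  case (add f g)
  then obtain m m' where "(\<lambda>p. f (\<phi> p)) \<in> deg_fun D m" "(\<lambda>p. g (\<phi> p)) \<in> deg_fun D m'" by blast
  then have "(\<lambda>p. f (\<phi> p)) \<in> deg_fun D (max m m')" "(\<lambda>p. g (\<phi> p)) \<in> deg_fun D (max m m')"
    by (auto intro: deg_fun_mono)
  then show ?case by (intro exI[of _ "max m m'"] deg_fun.add)
qed (use assms(2) deg_fun_const deg_fun_mult in blast)+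

text \<open>A chain longer than \<open>D\<close> yields \<open>D + 1\<close> functions that are
  algebraically independent on one of its members. But \<open>D + 1\<close> polynomials in
  \<open>D\<close> parameters satisfy a relation, by counting monomials, and the count leaves room
  for one relation that serves all charts at once.\<close>

theorem zdim_le_parameters:
  assumes S: "S \<subseteq> tuples n q" and J: "finite J" and cover: "S \<subseteq> (\<Union>j\<in>J. range (\<phi> j))"
    and deg: "\<And>j k a b. j \<in> J \<Longrightarrow> k < q \<Longrightarrow> a < n \<Longrightarrow> b < n \<Longrightarrow>
                (\<lambda>p. (\<phi> j p ! k) $$ (a, b)) \<in> deg_fun D e"
  shows "zdim n q S \<le> enat D"
  unfolding zdim_def krull_dim_def
proof (rule Sup_least, clarify)
  fix d Z
  let ?T = "subtopology (zariski n q) S"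
  assume irr: "\<forall>i\<le>d. irreducible_closedin ?T (Z i)" and less: "\<forall>i<d. Z i \<subset> Z (Suc i)"
  have "d \<le> D"
  proof (rule ccontr)
    assume "\<not> d \<le> D"
    then have dD: "Suc D \<le> d" by simp
    have "\<exists>f\<in>poly_fun n q. (\<forall>s\<in>Z i. f s = 0) \<and> (\<exists>s\<in>Z (Suc i). f s \<noteq> 0)" if "i < Suc D" for i
    proof -
      have i: "i < d" using that dD by simp
      then have "closedin ?T (Z i)" using irr by (auto simp: irreducible_closedin_def)
      then obtain F where F: "F \<subseteq> poly_fun n q" "Z i = {s \<in> S. \<forall>f\<in>F. f s = 0}"
        unfolding closedin_subtopology_zariski_iff[OF S] by blast
      have "Z i \<subset> Z (Suc i)" using less i by blast
      then obtain s where s: "s \<in> Z (Suc i)" "s \<notin> Z i" by blast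
      have "closedin ?T (Z (Suc i))" using irr i by (auto simp: irreducible_closedin_def)
      then have "s \<in> S" using s closedin_subset[of ?T] by auto
      with s(2) F(2) obtain f where "f \<in> F" "f s \<noteq> 0" by auto
      with F s show ?thesis by blast
    qed
    then obtain f where f: "\<And>i. i < Suc D \<Longrightarrow> f i \<in> poly_fun n q"
      "\<And>i s. i < Suc D \<Longrightarrow> s \<in> Z i \<Longrightarrow> f i s = 0" "\<And>i. i < Suc D \<Longrightarrow> \<exists>s\<in>Z (Suc i). f i s \<noteq> 0"
      by metis
    have "\<exists>m. (\<lambda>p. f i (\<phi> j p)) \<in> deg_fun D m" if "i < Suc D" "j \<in> J" for i j
      using f(1)[OF that(1)] deg[OF that(2)] by (rule poly_fun_comp_deg)
    then obtain m where m: "\<And>i j. i < Suc D \<Longrightarrow> j \<in> J \<Longrightarrow> (\<lambda>p. f i (\<phi> j p)) \<in> deg_fun D (m i j)"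
      by metis
    define M where "M = Max ((\<lambda>(i, j). m i j) ` ({..<Suc D} \<times> J))"
    have "(\<lambda>p. f i (\<phi> j p)) \<in> deg_fun D M" if "i < Suc D" "j \<in> J" for i j
      using m[OF that] by (rule deg_fun_mono) (use that J in \<open>auto simp: M_def intro!: Max_ge\<close>)
    note M = this
    define w where "w = M * Suc D"
    \<comment> \<open>Monomials in the \<open>f i\<close> with exponents up to \<open>r\<close> have
      degree at most \<open>w * r\<close> in the parameters. Since w r + 1 <= (w + 1)(r + 1), this
      \<open>r\<close> makes the (r + 1)^(D + 1) unknown coefficients outnumber the card J * (w r +
      1)^D equations.\<close>
    define r where "r = card J * (w + 1) ^ D"
    have monM: "(\<lambda>p. mon (\<lambda>i. f i (\<phi> j p)) xs) \<in> deg_fun D (w * r)"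
      if "xs \<in> exps r (Suc D)" "j \<in> J" for xs j
    proof -
      have "sum_list xs \<le> r * length xs"
        using that(1) sum_list_mono[of xs "\<lambda>x. x" "\<lambda>_. r"] by (auto simp: exps_def sum_list_triv mult.commute)
      then have "M * sum_list xs \<le> w * r"
        using that(1) unfolding w_def by (simp add: exps_def mult.assoc mult.commute[of r])
          (metis mult.assoc mult.commute mult_le_mono2 mult_Suc)
      moreover have "(\<lambda>p. mon (\<lambda>i. f i (\<phi> j p)) xs) \<in> deg_fun D (M * sum_list xs)"
      proof (rule deg_fun_mon[where f = "\<lambda>i p. f i (\<phi> j p)"])
        show "(\<lambda>p. f i (\<phi> j p)) \<in> deg_fun D M" if "i < length xs" for i
          using M[of i j] that \<open>xs \<in> exps r (Suc D)\<close> \<open>j \<in> J\<close> by (simp add: exps_def)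
      qed
      ultimately show ?thesis by (rule deg_fun_mono[rotated])
    qed
    then have "\<forall>j\<in>J. \<forall>xs\<in>exps r (Suc D). \<exists>c. \<forall>p. mon (\<lambda>i. f i (\<phi> j p)) xs = (\<Sum>ys\<in>exps (w * r) D. c ys * mon p ys)"
      by (blast dest: deg_fun_repr)
    then obtain K where K: "\<And>j xs p. j \<in> J \<Longrightarrow> xs \<in> exps r (Suc D) \<Longrightarrow>
        mon (\<lambda>i. f i (\<phi> j p)) xs = (\<Sum>ys\<in>exps (w * r) D. K j xs ys * mon p ys)"
      by metis
    have "(w * r + 1) ^ D \<le> ((w + 1) * (r + 1)) ^ D" by (intro power_mono) auto
    then have "card J * (w * r + 1) ^ D \<le> r * (r + 1) ^ D"
      unfolding r_def by (simp only: power_mult_distrib mult.assoc mult_le_mono2)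
    also have "\<dots> < (r + 1) * (r + 1) ^ D" by simp
    finally have card: "card (J \<times> exps (w * r) D) < card (exps r (Suc D))"
      by (simp add: card_cartesian_product card_exps del: mult_Suc)
    obtain x where x: "\<exists>xs\<in>exps r (Suc D). x xs \<noteq> 0"
      "\<And>j ys. j \<in> J \<Longrightarrow> ys \<in> exps (w * r) D \<Longrightarrow> (\<Sum>xs\<in>exps r (Suc D). K j xs ys * x xs) = 0"
      using homogeneous_solution[OF finite_exps finite_cartesian_product[OF J finite_exps] card,
          of "\<lambda>jy xs. K (fst jy) xs (snd jy)"]
      by (elim exE conjE) (rule that, assumption, simp add: Ball_def)
    have "(\<Sum>xs\<in>exps r (Suc D). x xs * mon (\<lambda>i. f i s) xs) = 0" if "s \<in> Z (Suc D)" for s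
    proof -
      have "closedin ?T (Z (Suc D))" using irr dD by (auto simp: irreducible_closedin_def)
      then have "s \<in> S" using that closedin_subset[of ?T] by auto
      then obtain j p where j: "j \<in> J" "s = \<phi> j p" using cover by blast
      have "(\<Sum>xs\<in>exps r (Suc D). x xs * mon (\<lambda>i. f i s) xs) =
            (\<Sum>xs\<in>exps r (Suc D). \<Sum>ys\<in>exps (w * r) D. x xs * (K j xs ys * mon p ys))"
        using K[OF j(1)] unfolding j(2) by (simp add: sum_distrib_left)
      also have "\<dots> = (\<Sum>ys\<in>exps (w * r) D. \<Sum>xs\<in>exps r (Suc D). x xs * (K j xs ys * mon p ys))"
        by (rule sum.swap)
      also have "\<dots> = (\<Sum>ys\<in>exps (w * r) D. mon p ys * (\<Sum>xs\<in>exps r (Suc D). K j xs ys * x xs))"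
        by (simp add: sum_distrib_left mult_ac)
      also have "\<dots> = 0" using x(2)[OF j(1)] by simp
      finally show ?thesis .
    qed
    note rel = this
    have "\<forall>xs\<in>exps r (Suc D). x xs = 0"
    proof (rule chain_independent[where f = f and Z = Z, OF S])
      show "irreducible_closedin ?T (Z i)" if "i \<le> Suc D" for i using irr dD that by simp
      show "Z i \<subseteq> Z (Suc i)" if "i < Suc D" for i using less dD that by (simp add: psubset_imp_subset)
    qed (fact f rel)+
    with x(1) show False by blast
  qed
  then show "enat d \<le> enat D" by simp
qed

section \<open>Matrices of rank one shifted by a scalar\<close>

text \<open>The matrix \<epsilon> I + u v^T. Vectors are functions on all indices, so that the same
  \<open>u\<close> and \<open>v\<close> serve for a block of size \<open>k\<close> and for a direct
  sum of size \<open>k + 1\<close>.\<close>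

definition rank1 :: "nat \<Rightarrow> complex \<Rightarrow> (nat \<Rightarrow> complex) \<Rightarrow> (nat \<Rightarrow> complex) \<Rightarrow> complex mat" where
  "rank1 n \<epsilon> u v = mat n n (\<lambda>(a, b). (if a = b then \<epsilon> else 0) + u a * v b)"

definition dot :: "nat \<Rightarrow> (nat \<Rightarrow> complex) \<Rightarrow> (nat \<Rightarrow> complex) \<Rightarrow> complex" where
  "dot n v u = (\<Sum>a<n. v a * u a)"

definition mat_fun :: "nat \<Rightarrow> complex mat \<Rightarrow> (nat \<Rightarrow> complex) \<Rightarrow> nat \<Rightarrow> complex" where
  "mat_fun n P u a = (\<Sum>c<n. P $$ (a, c) * u c)"

definition fun_mat :: "nat \<Rightarrow> (nat \<Rightarrow> complex) \<Rightarrow> complex mat \<Rightarrow> nat \<Rightarrow> complex" where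
  "fun_mat n v P b = (\<Sum>c<n. v c * P $$ (c, b))"

definition kron :: "nat \<Rightarrow> nat \<Rightarrow> complex" where
  "kron i a = (if a = i then 1 else 0)"

lemma kron_simps [simp]: "kron i i = 1" "a \<noteq> i \<Longrightarrow> kron i a = 0"
  by (simp_all add: kron_def)

lemma sum_kron [simp]:
  "(\<Sum>a<n. kron i a * f a) = (if i < n then f i else 0)"
  "(\<Sum>a<n. f a * kron i a) = (if i < n then f i else 0)"
  by (simp_all add: kron_def if_distrib[of "\<lambda>x. x * _"] if_distrib[of "\<lambda>x. _ * x"] cong: if_cong)

lemma rank1_carrier [simp]: "rank1 n \<epsilon> u v \<in> carrier_mat n n"
  "dim_row (rank1 n \<epsilon> u v) = n" "dim_col (rank1 n \<epsilon> u v) = n"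
  by (simp_all add: rank1_def)

lemma rank1_index [simp]:
  "a < n \<Longrightarrow> b < n \<Longrightarrow> rank1 n \<epsilon> u v $$ (a, b) = (if a = b then \<epsilon> else 0) + u a * v b"
  by (simp add: rank1_def)

lemma rank1_cong:
  "(\<And>a b. a < n \<Longrightarrow> b < n \<Longrightarrow> u a * v b = u' a * v' b) \<Longrightarrow> rank1 n \<epsilon> u v = rank1 n \<epsilon> u' v'"
  by (intro eq_matI) auto

lemma index_mult_mat_sum:
  assumes "(A :: complex mat) \<in> carrier_mat n n" "B \<in> carrier_mat n n" "a < n" "b < n"
  shows "(A * B) $$ (a, b) = (\<Sum>c<n. A $$ (a, c) * B $$ (c, b))"
  using assms by (simp add: scalar_prod_def lessThan_atLeast0)

lemma mult_rank1_index:
  assumes "P \<in> carrier_mat n n" "a < n" "b < n"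
  shows "(P * rank1 n \<epsilon> u v) $$ (a, b) = \<epsilon> * P $$ (a, b) + mat_fun n P u a * v b"
proof -
  have "(P * rank1 n \<epsilon> u v) $$ (a, b) =
      (\<Sum>c<n. P $$ (a, c) * ((if c = b then \<epsilon> else 0) + u c * v b))"
    using assms by (subst index_mult_mat_sum) auto
  also have "\<dots> = (\<Sum>c<n. if c = b then \<epsilon> * P $$ (a, b) else 0) + (\<Sum>c<n. P $$ (a, c) * u c) * v b"
    unfolding sum_distrib_right sum.distrib[symmetric] by (rule sum.cong) (auto simp: algebra_simps)
  finally show ?thesis using assms(3) by (simp add: mat_fun_def)
qed

lemma rank1_mult_index:
  assumes "P \<in> carrier_mat n n" "a < n" "b < n"
  shows "(rank1 n \<epsilon> u v * P) $$ (a, b) = \<epsilon> * P $$ (a, b) + u a * fun_mat n v P b"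
proof -
  have "(rank1 n \<epsilon> u v * P) $$ (a, b) =
      (\<Sum>c<n. ((if a = c then \<epsilon> else 0) + u a * v c) * P $$ (c, b))"
    using assms by (subst index_mult_mat_sum) auto
  also have "\<dots> = (\<Sum>c<n. if a = c then \<epsilon> * P $$ (a, b) else 0) + u a * (\<Sum>c<n. v c * P $$ (c, b))"
    unfolding sum_distrib_left sum.distrib[symmetric] by (rule sum.cong) (auto simp: algebra_simps)
  finally show ?thesis using assms(2) by (simp add: fun_mat_def)
qed

lemma conj_rank1:
  assumes P: "P \<in> carrier_mat n n" "Q \<in> carrier_mat n n" "P * Q = 1\<^sub>m n"
  shows "P * rank1 n \<epsilon> u v * Q = rank1 n \<epsilon> (mat_fun n P u) (fun_mat n v Q)"
proof (rule eq_matI)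
  fix a b assume "a < dim_row (rank1 n \<epsilon> (mat_fun n P u) (fun_mat n v Q))"
    "b < dim_col (rank1 n \<epsilon> (mat_fun n P u) (fun_mat n v Q))"
  then have ab: "a < n" "b < n" by simp_all
  have "(P * rank1 n \<epsilon> u v * Q) $$ (a, b) =
      (\<Sum>c<n. (\<epsilon> * P $$ (a, c) + mat_fun n P u a * v c) * Q $$ (c, b))"
    using P ab by (subst index_mult_mat_sum[of _ n]) (auto simp: mult_rank1_index[OF P(1)] simp del: index_mult_mat intro!: sum.cong mult_carrier_mat[of _ n n])
  also have "\<dots> = \<epsilon> * (\<Sum>c<n. P $$ (a, c) * Q $$ (c, b)) + mat_fun n P u a * fun_mat n v Q b"
    unfolding fun_mat_def sum_distrib_left sum.distrib[symmetric] by (rule sum.cong) (auto simp: algebra_simps)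
  also have "(\<Sum>c<n. P $$ (a, c) * Q $$ (c, b)) = 1\<^sub>m n $$ (a, b)"
    using index_mult_mat_sum[OF P(1,2) ab] P(3) by simp
  finally show "(P * rank1 n \<epsilon> u v * Q) $$ (a, b) = rank1 n \<epsilon> (mat_fun n P u) (fun_mat n v Q) $$ (a, b)"
    using ab by simp
qed (use P in auto)

lemma inverse_mat_exists:
  assumes "(P :: complex mat) \<in> carrier_mat n n" "det P \<noteq> 0"
  obtains Q where "Q \<in> carrier_mat n n" "P * Q = 1\<^sub>m n" "Q * P = 1\<^sub>m n"
  using det_non_zero_imp_unit[OF assms, of "()"] unfolding Units_def by (auto simp: ring_mat_def)

lemma permutation_to_front:
  assumes "i < n" "j < n" "i \<noteq> j" "2 \<le> n"
  obtains \<pi> where "bij_betw \<pi> {..<n} {..<n}" "\<pi> 0 = i" "\<pi> (Suc 0) = j"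
proof
  define f where "f = Transposition.transpose (0 :: nat) i"
  define g where "g = Transposition.transpose (f 1) j"
  have f: "bij_betw f {..<n} {..<n}" unfolding f_def using assms by (intro bij_betw_transpose_iff) auto
  have "f 1 < n" using bij_betwE[OF f] assms by auto
  then have g: "bij_betw g {..<n} {..<n}" unfolding g_def using assms by (intro bij_betw_transpose_iff) auto
  show "bij_betw (g \<circ> f) {..<n} {..<n}" using f g by (rule bij_betw_trans)
  have "f 1 \<noteq> f 0" by (simp add: f_def Transposition.transpose_def)
  then show "(g \<circ> f) 0 = i" "(g \<circ> f) (Suc 0) = j"
    using assms(3) by (auto simp: g_def f_def Transposition.transpose_def)
qed

text \<open>One change of basis takes the image \<open>u\<close> to e_0 and the coimage
  \<open>v\<close> to e_1; this is consistent because \<open>v\<close> annihilates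
  \<open>u\<close>.\<close>

lemma rank1_similar:
  assumes u: "\<exists>a<n. u a \<noteq> 0" and v: "\<exists>a<n. v a \<noteq> 0" and vu: "dot n v u = 0"
  shows "similar_mat (rank1 n \<epsilon> u v) (rank1 n \<epsilon> (kron 0) (kron 1))"
proof -
  \<comment> \<open>Otherwise \<open>u\<close> and \<open>v\<close> would be supported at one common
    index, and their product could not be zero.\<close>
  have "\<exists>i<n. \<exists>j<n. i \<noteq> j \<and> u i \<noteq> 0 \<and> v j \<noteq> 0"
  proof (rule ccontr)
    assume neg: "\<not> ?thesis"
    obtain i j where ij: "i < n" "j < n" "u i \<noteq> 0" "v j \<noteq> 0" using u v by blast
    have "i = j" using neg ij by blast
    have "\<And>a. a < n \<Longrightarrow> a \<noteq> i \<Longrightarrow> v a = 0" using neg ij by blast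
    then have "dot n v u = (\<Sum>a\<in>{i}. v a * u a)"
      unfolding dot_def using ij by (intro sum.mono_neutral_right) auto
    with vu ij \<open>i = j\<close> show False by simp
  qed
  then obtain i j where ij: "i < n" "j < n" "i \<noteq> j" "u i \<noteq> 0" "v j \<noteq> 0" by blast
  then have n: "2 \<le> n" by linarith
  obtain \<pi> where \<pi>: "bij_betw \<pi> {..<n} {..<n}" "\<pi> 0 = i" "\<pi> (Suc 0) = j"
    using permutation_to_front[OF ij(1-3) n] by blast
  \<comment> \<open>Row 0 takes the value 1 on \<open>u\<close>; row 1 is \<open>v\<close>; the
    other rows are coordinate functionals corrected so as to vanish on \<open>u\<close>. Hence P u =
    e_0, and v Q is row 1 of P Q, that is e_1.\<close>
  define P where "P = mat n n (\<lambda>(a, b). if a = 0 then kron i b / u i else if a = 1 then v b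
    else kron (\<pi> a) b - u (\<pi> a) / u i * kron i b)"
  have P: "P \<in> carrier_mat n n" by (simp add: P_def)
  have Pu: "mat_fun n P u a = kron 0 a" if "a < n" for a
  proof -
    have \<pi>a: "\<pi> a < n" using bij_betwE[OF \<pi>(1)] that by auto
    consider "a = 0" | "a = 1" | "a \<noteq> 0" "a \<noteq> 1" by blast
    then show ?thesis
    proof cases
      case 3
      have "mat_fun n P u a = (\<Sum>c<n. kron (\<pi> a) c * u c) - u (\<pi> a) / u i * (\<Sum>c<n. kron i c * u c)"
        unfolding mat_fun_def sum_distrib_left sum_subtractf[symmetric]
        using 3 that by (intro sum.cong) (auto simp: P_def algebra_simps)
      then show ?thesis using 3 ij \<pi>a by simp
    next
      case 1
      have "mat_fun n P u a = (\<Sum>c<n. kron i c * u c) / u i"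
        unfolding mat_fun_def sum_divide_distrib using 1 that by (intro sum.cong) (auto simp: P_def)
      then show ?thesis using 1 ij by simp
    next
      case 2
      have "mat_fun n P u a = dot n v u"
        unfolding mat_fun_def dot_def using 2 that by (intro sum.cong) (auto simp: P_def)
      then show ?thesis using 2 vu by simp
    qed
  qed
  have "det P \<noteq> 0"
  proof
    assume "det P = 0"
    then obtain x where x: "x \<in> carrier_vec n" "x \<noteq> 0\<^sub>v n" "P *\<^sub>v x = 0\<^sub>v n"
      using det_0_iff_vec_prod_zero_field[OF P] by blast
    have Px: "(\<Sum>c<n. P $$ (a, c) * x $ c) = 0" if "a < n" for a
      using arg_cong[OF x(3), of "\<lambda>v. v $ a"] that P x(1) by (auto simp: scalar_prod_def lessThan_atLeast0)
    have "(\<Sum>c<n. P $$ (0, c) * x $ c) = (\<Sum>c<n. kron i c * x $ c) / u i"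
      unfolding sum_divide_distrib using n by (intro sum.cong) (auto simp: P_def)
    then have xi: "x $ i = 0" using Px[of 0] n ij by simp
    have xa: "x $ c = 0" if c: "c < n" "c \<noteq> j" for c
    proof (cases "c = i")
      case False
      obtain a where a: "a < n" "\<pi> a = c" using bij_betw_imp_surj_on[OF \<pi>(1)] c(1) by (metis imageE lessThan_iff)
      have a2: "a \<noteq> 0" "a \<noteq> 1" using a(2) \<pi>(2,3) False c(2) by (metis, metis One_nat_def)
      have "(\<Sum>b<n. P $$ (a, b) * x $ b) = (\<Sum>b<n. kron c b * x $ b) - u c / u i * (\<Sum>b<n. kron i b * x $ b)"
        unfolding sum_distrib_left sum_subtractf[symmetric]
        using a a2 by (intro sum.cong) (auto simp: P_def algebra_simps)
      then show ?thesis using Px[OF a(1)] c ij xi by simp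
    qed (simp add: xi)
    have "(\<Sum>c<n. P $$ (1, c) * x $ c) = (\<Sum>c\<in>{j}. v c * x $ c)"
      using n ij xa by (intro sum.mono_neutral_cong_right) (auto simp: P_def)
    then have "x $ j = 0" using Px[of 1] n ij by simp
    with xa have "x $ c = 0" if "c < n" for c using that by (cases "c = j") auto
    then have "x = 0\<^sub>v n" using x(1) by (intro eq_vecI) auto
    with x(2) show False by simp
  qed
  then obtain Q where Q: "Q \<in> carrier_mat n n" "P * Q = 1\<^sub>m n" "Q * P = 1\<^sub>m n"
    using inverse_mat_exists[OF P] by blast
  have vQ: "fun_mat n v Q b = kron 1 b" if "b < n" for b
  proof -
    have "fun_mat n v Q b = (P * Q) $$ (1, b)"
      using P Q(1) that n by (subst index_mult_mat_sum) (auto simp: fun_mat_def P_def)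
    then show ?thesis using Q(2) that n by (simp add: kron_def)
  qed
  have "P * rank1 n \<epsilon> u v * Q = rank1 n \<epsilon> (kron 0) (kron 1)"
    unfolding conj_rank1[OF P Q(1,2)] by (rule rank1_cong) (simp add: Pu vQ)
  then have "similar_mat_wit (rank1 n \<epsilon> (kron 0) (kron 1)) (rank1 n \<epsilon> u v) P Q"
    using P Q by (intro similar_mat_witI[of P Q n]) simp_all
  then have "similar_mat (rank1 n \<epsilon> (kron 0) (kron 1)) (rank1 n \<epsilon> u v)"
    unfolding similar_mat_def by blast
  then show ?thesis by (rule similar_mat_sym)
qed

lemma rank1_minus_smult:
  "rank1 n \<epsilon> u v - \<epsilon> \<cdot>\<^sub>m 1\<^sub>m n = rank1 n 0 u v"
  by (rule eq_matI) auto

section \<open>The conjugacy class\<close>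

definition nilclass :: "complex \<Rightarrow> nat \<Rightarrow> complex mat set" where
  "nilclass \<epsilon> n = conj_class (rank1 n \<epsilon> (kron 0) (kron 1))"

lemma conj_class_eq: "similar_mat A B \<Longrightarrow> conj_class A = conj_class B"
  unfolding conj_class_def by (rule Collect_cong) (meson similar_mat_trans similar_mat_sym)

lemma nilclassI:
  assumes "\<exists>a<n. u a \<noteq> 0" "\<exists>a<n. v a \<noteq> 0" "dot n v u = 0"
  shows "rank1 n \<epsilon> u v \<in> nilclass \<epsilon> n" "conj_class (rank1 n \<epsilon> u v) = nilclass \<epsilon> n"
proof -
  show "conj_class (rank1 n \<epsilon> u v) = nilclass \<epsilon> n"
    unfolding nilclass_def by (rule conj_class_eq[OF rank1_similar[OF assms]])
  show "rank1 n \<epsilon> u v \<in> nilclass \<epsilon> n"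
    using rank1_similar[OF assms, of \<epsilon>] by (simp add: nilclass_def conj_class_def)
qed

lemma similar_mat_witD_right:
  assumes "similar_mat_wit A B P Q" "B \<in> carrier_mat n n"
  shows "A \<in> carrier_mat n n" "P \<in> carrier_mat n n" "Q \<in> carrier_mat n n"
    "P * Q = 1\<^sub>m n" "Q * P = 1\<^sub>m n" "A = P * B * Q"
proof -
  have "B \<in> carrier_mat (dim_row A) (dim_row A)"
    using assms(1) unfolding similar_mat_wit_def Let_def by (auto simp only: insert_subset)
  then have "dim_row A = n" using assms(2) by (metis carrier_matD(1))
  then show "A \<in> carrier_mat n n" "P \<in> carrier_mat n n" "Q \<in> carrier_mat n n"
    "P * Q = 1\<^sub>m n" "Q * P = 1\<^sub>m n" "A = P * B * Q"
    using assms(1) unfolding similar_mat_wit_def Let_def \<open>dim_row A = n\<close> by (auto simp only: insert_subset)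
qed

lemma nilclassE:
  assumes "A \<in> nilclass \<epsilon> n" "2 \<le> n"
  obtains u v where "A = rank1 n \<epsilon> u v" "\<exists>a<n. u a \<noteq> 0" "\<exists>a<n. v a \<noteq> 0" "dot n v u = 0"
proof -
  obtain P Q where wit: "similar_mat_wit A (rank1 n \<epsilon> (kron 0) (kron 1)) P Q"
    using assms(1) unfolding nilclass_def conj_class_def similar_mat_def by blast
  note PQ = similar_mat_witD_right(2-5)[OF wit rank1_carrier(1)]
  note A = similar_mat_witD_right(6)[OF wit rank1_carrier(1)]
  let ?u = "mat_fun n P (kron 0)" and ?v = "fun_mat n (kron 1) Q"
  have u: "?u a = P $$ (a, 0)" and v: "?v a = Q $$ (1, a)" for a
    using assms(2) by (simp_all add: mat_fun_def fun_mat_def)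
  have QP: "(\<Sum>c<n. Q $$ (a, c) * P $$ (c, b)) = 1\<^sub>m n $$ (a, b)" if "a < n" "b < n" for a b
    using index_mult_mat_sum[OF PQ(2,1) that] PQ(4) by simp
  show thesis
  proof
    show "A = rank1 n \<epsilon> ?u ?v" unfolding A by (rule conj_rank1[OF PQ(1-3)])
    show "\<exists>a<n. ?u a \<noteq> 0"
    proof (rule ccontr)
      assume "\<not> ?thesis"
      then have "(\<Sum>c<n. Q $$ (0, c) * P $$ (c, 0)) = 0" unfolding u by (intro sum.neutral) simp
      with QP[of 0 0] assms(2) show False by simp
    qed
    show "\<exists>a<n. ?v a \<noteq> 0"
    proof (rule ccontr)
      assume "\<not> ?thesis"
      then have "(\<Sum>c<n. Q $$ (1, c) * P $$ (c, 1)) = 0" unfolding v by (intro sum.neutral) simp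
      with QP[of 1 1] assms(2) show False by simp
    qed
    show "dot n ?v ?u = 0" using QP[of 1 0] assms(2) unfolding u v dot_def by simp
  qed
qed

lemma nilclass_carrier: "A \<in> nilclass \<epsilon> n \<Longrightarrow> A \<in> carrier_mat n n"
  unfolding nilclass_def conj_class_def similar_mat_def
  by (auto dest: similar_mat_witD_right(1)[OF _ rank1_carrier(1)])

lemma jordan_matrix_replicate:
  fixes \<epsilon> :: complex
  shows "jordan_matrix (replicate m (Suc 0, \<epsilon>)) = \<epsilon> \<cdot>\<^sub>m 1\<^sub>m m"
proof (induction m)
  case 0
  show ?case by (auto simp: jordan_matrix_def)
next
  case (Suc m)
  show ?case unfolding replicate_Suc jordan_matrix_Cons Suc
    by (rule eq_matI) (auto simp: jordan_block_def four_block_mat_def Let_def sum_list_replicate)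
qed

lemma rank1_jordan_nf:
  assumes "2 \<le> n"
  shows "jordan_nf (rank1 n \<epsilon> (kron 0) (kron 1)) ((2, \<epsilon>) # replicate (n - 2) (1, \<epsilon>))"
proof -
  have "rank1 n \<epsilon> (kron 0) (kron 1) = jordan_matrix ((2, \<epsilon>) # replicate (n - 2) (1, \<epsilon>))"
    using assms unfolding jordan_matrix_Cons One_nat_def jordan_matrix_replicate
    by (intro eq_matI) (auto simp: jordan_block_def four_block_mat_def Let_def sum_list_replicate kron_def)
  from similar_mat_refl[OF rank1_carrier(1), of n \<epsilon> "kron 0" "kron 1"]
  have "similar_mat (rank1 n \<epsilon> (kron 0) (kron 1)) (jordan_matrix ((2, \<epsilon>) # replicate (n - 2) (1, \<epsilon>)))"
    by (subst \<open>rank1 n \<epsilon> (kron 0) (kron 1) = _\<close>[symmetric])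
  then show ?thesis unfolding jordan_nf_def by auto
qed

lemma nilclass_jordan_nf:
  assumes "A \<in> nilclass \<epsilon> n" "2 \<le> n"
  shows "jordan_nf A ((2, \<epsilon>) # replicate (n - 2) (1, \<epsilon>))"
  using rank1_jordan_nf[OF assms(2), of \<epsilon>] assms(1) similar_mat_trans
  unfolding jordan_nf_def nilclass_def conj_class_def by blast

lemma det_nilclass:
  assumes "A \<in> nilclass \<epsilon> n" "2 \<le> n" shows "det A = \<epsilon> ^ n"
proof -
  have "upper_triangular (rank1 n \<epsilon> (kron 0) (kron 1))"
    by (auto simp: kron_def intro!: upper_triangularI)
  then have "det (rank1 n \<epsilon> (kron 0) (kron 1)) = prod_list (diag_mat (rank1 n \<epsilon> (kron 0) (kron 1)))"
    by (intro det_upper_triangular[of _ n]) auto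
  also have "diag_mat (rank1 n \<epsilon> (kron 0) (kron 1)) = replicate n \<epsilon>"
    by (auto simp: diag_mat_def kron_def list_eq_iff_nth_eq)
  finally have "det (rank1 n \<epsilon> (kron 0) (kron 1)) = \<epsilon> ^ n" by simp
  then show ?thesis using det_similar assms(1) unfolding nilclass_def conj_class_def by (metis mem_Collect_eq)
qed

lemma trace_nilclass:
  assumes "A \<in> nilclass \<epsilon> n" "2 \<le> n" shows "mat_trace A = of_nat n * \<epsilon>"
proof -
  obtain u v where A: "A = rank1 n \<epsilon> u v" "dot n v u = 0" using nilclassE[OF assms] by metis
  have "mat_trace A = (\<Sum>a<n. \<epsilon> + u a * v a)" unfolding A(1) mat_trace_def by simp
  also have "\<dots> = of_nat n * \<epsilon>" using A(2) by (simp add: sum.distrib dot_def mult.commute)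
  finally show ?thesis .
qed

section \<open>The dimension of the class\<close>

lemma deg_fun_sum:
  "finite A \<Longrightarrow> (\<And>a. a \<in> A \<Longrightarrow> f a \<in> deg_fun D e) \<Longrightarrow> (\<lambda>p. \<Sum>a\<in>A. f a p) \<in> deg_fun D e"
  by (induction A rule: finite_induct) (auto intro: deg_fun_const deg_fun.add)

lemma deg_fun_uminus: "f \<in> deg_fun D e \<Longrightarrow> (\<lambda>p. - f p) \<in> deg_fun D e"
  using deg_fun_mult[OF deg_fun_const[of "-1" D 0], of f e] by simp

lemma singletons_nilclass: "(\<lambda>A. [A]) ` nilclass \<epsilon> n \<subseteq> tuples n 1"
  using nilclass_carrier by (auto simp: tuples_def)

text \<open>There is one chart for each index \<open>i\<close>: an entry \<open>u i\<close> that is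
  nonzero is scaled to 1, and then v . u = 0 determines \<open>v i\<close>. This leaves n - 1
  entries of each vector.\<close>

lemma zdim_nilclass_le:
  assumes n: "2 \<le> n"
  shows "zdim n 1 ((\<lambda>A. [A]) ` nilclass \<epsilon> n) \<le> enat (2 * n - 2)"
proof -
  \<comment> \<open>Renumbers the indices other than \<open>i\<close> without a gap. Parameters
    below n - 1 belong to the image, the following n - 1 to the coimage.\<close>
  define sh where "sh i a = (if a < i then a else a - 1)" for i a :: nat
  define u where "u i p a = (if a = i then 1 else p (sh i a))" for i a :: nat and p :: "nat \<Rightarrow> complex"
  define v where "v i p a = (if a = i then - (\<Sum>c\<in>{..<n} - {i}. p (sh i c) * p (n - 1 + sh i c))
      else p (n - 1 + sh i a))" for i a :: nat and p :: "nat \<Rightarrow> complex"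
  have sh: "sh i a < n - 1" if "a \<noteq> i" "a < n" "i < n" for i a
    using that by (auto simp: sh_def)
  have u: "(\<lambda>p. u i p a) \<in> deg_fun (2 * n - 2) 1" if "a < n" "i < n" for i a
  proof (cases "a = i")
    case False
    from deg_fun_coord[of "sh i a" "2 * n - 2" 1] sh[OF this that] False show ?thesis by (simp add: u_def)
  qed (simp add: u_def deg_fun_const)
  have v: "(\<lambda>p. v i p a) \<in> deg_fun (2 * n - 2) 2" if "a < n" "i < n" for i a
  proof (cases "a = i")
    case False
    then show ?thesis
      using deg_fun_coord[of "n - 1 + sh i a" "2 * n - 2" 2] sh[OF False that] by (simp add: v_def)
  next
    case True
    have "(\<lambda>p. p (sh i c) * p (n - 1 + sh i c)) \<in> deg_fun (2 * n - 2) (1 + 1)" if c: "c \<in> {..<n} - {i}" for c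
    proof -
      have "sh i c < n - 1" using sh[of c i] c \<open>i < n\<close> by blast
      then have "sh i c < 2 * n - 2" "n - 1 + sh i c < 2 * n - 2" by linarith+
      then show ?thesis by (intro deg_fun_mult deg_fun_coord order_refl)
    qed
    then have "(\<lambda>p. - (\<Sum>c\<in>{..<n} - {i}. p (sh i c) * p (n - 1 + sh i c))) \<in> deg_fun (2 * n - 2) 2"
      unfolding one_add_one by (intro deg_fun_uminus deg_fun_sum finite_Diff finite_lessThan)
    then show ?thesis using True by (simp add: v_def)
  qed
  show ?thesis
  proof (rule zdim_le_parameters[OF singletons_nilclass, where J = "{..<n}" and
        \<phi> = "\<lambda>i p. [rank1 n \<epsilon> (u i p) (v i p)]" and e = 3])
    fix j k a b assume j: "j \<in> {..<n}" and k: "k < (1 :: nat)" and ab: "a < n" "b < n"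
    have "(\<lambda>p. u j p a * v j p b) \<in> deg_fun (2 * n - 2) (1 + 2)"
      using u v j ab by (intro deg_fun_mult) auto
    then have "(\<lambda>p. u j p a * v j p b) \<in> deg_fun (2 * n - 2) 3"
      by (rule deg_fun_mono) simp
    then have "(\<lambda>p. (if a = b then \<epsilon> else 0) + u j p a * v j p b) \<in> deg_fun (2 * n - 2) 3"
      by (rule deg_fun.add[OF deg_fun_const])
    then show "(\<lambda>p. ([rank1 n \<epsilon> (u j p) (v j p)] ! k) $$ (a, b)) \<in> deg_fun (2 * n - 2) 3"
      using k ab by simp
  next
    show "(\<lambda>A. [A]) ` nilclass \<epsilon> n \<subseteq> (\<Union>j\<in>{..<n}. range (\<lambda>p. [rank1 n \<epsilon> (u j p) (v j p)]))"
    proof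
      fix As assume "As \<in> (\<lambda>A. [A]) ` nilclass \<epsilon> n"
      then obtain A where A: "As = [A]" "A \<in> nilclass \<epsilon> n" by blast
      obtain x y where xy: "A = rank1 n \<epsilon> x y" "\<exists>a<n. x a \<noteq> 0" "dot n y x = 0"
        using nilclassE[OF A(2) n] by metis
      obtain i where i: "i < n" "x i \<noteq> 0" using xy(2) by blast
      define us where "us a = (if a < i then a else a + 1)" for a
      define p where "p k = (if k < n - 1 then x (us k) / x i else y (us (k - (n - 1))) * x i)" for k
      have us: "us (sh i a) = a" if "a \<noteq> i" for a using that by (auto simp: us_def sh_def)
      have pu: "p (sh i a) = x a / x i" if "a \<noteq> i" "a < n" for a
        using sh[OF that i(1)] us[OF that(1)] by (simp add: p_def)
      have pv: "p (n - 1 + sh i a) = y a * x i" if "a \<noteq> i" "a < n" for a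
        using us[OF that(1)] by (simp add: p_def)
      have pv': "p (n + sh i a - Suc 0) = y a * x i" if "a \<noteq> i" "a < n" for a
        using pv[OF that] n by simp
      have "(\<Sum>c\<in>{..<n} - {i}. p (sh i c) * p (n - 1 + sh i c)) = (\<Sum>c\<in>{..<n} - {i}. y c * x c)"
        using i by (intro sum.cong) (auto simp: pu pv pv')
      also have "\<dots> = - (y i * x i)"
        using xy(3) i(1) sum.remove[of "{..<n}" i "\<lambda>c. y c * x c"] by (simp add: dot_def eq_neg_iff_add_eq_0 add.commute)
      finally have "A = rank1 n \<epsilon> (u i p) (v i p)"
        unfolding xy(1) using i by (intro rank1_cong) (auto simp: u_def v_def pu pv pv')
      then show "As \<in> (\<Union>j\<in>{..<n}. range (\<lambda>p. [rank1 n \<epsilon> (u j p) (v j p)]))"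
        using A(1) i(1) by auto
    qed
  qed simp
qed

text \<open>The chart with \<open>u 0 = 1\<close> suffices. Row 0 of the matrix shows the entries of
  the coimage, and column 1 shows those of the image multiplied by \<open>v 1\<close>, which is 1 at
  the base point.\<close>

lemma zdim_nilclass_ge:
  assumes n: "2 \<le> n"
  shows "enat (2 * n - 2) \<le> zdim n 1 ((\<lambda>A. [A]) ` nilclass \<epsilon> n)"
proof -
  define u where "u p a = (if a = 0 then 1 else p (False, a))" for p :: "bool \<times> nat \<Rightarrow> complex" and a :: nat
  define v where "v p a = (if a = 0 then - (\<Sum>c\<in>{1..<n}. p (True, c) * p (False, c)) else p (True, a))"
    for p :: "bool \<times> nat \<Rightarrow> complex" and a :: nat
  define \<phi> where "\<phi> p = [rank1 n \<epsilon> (u p) (v p)]" for p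
  define D where "D = {p :: bool \<times> nat \<Rightarrow> complex. p (True, 1) \<noteq> 0}"
  define b where "b x = (if x = (True, 1) then 1 else 0 :: complex)" for x :: "bool \<times> nat"
  define I where "I = (UNIV :: bool set) \<times> {1..<n}"
  have "enat (card I) \<le> zdim n 1 ((\<lambda>A. [A]) ` nilclass \<epsilon> n)"
  proof (rule card_le_zdim[OF singletons_nilclass, where D = D and b = b and \<phi> = \<phi> and
        grp = "\<lambda>(t, a). if t then 1 else 0"])
    show "line_dense D" unfolding D_def by (rule line_dense_nonzero) (rule rat_fun.coord)
    show "b \<in> D" by (simp add: D_def b_def)
    show "finite I" by (simp add: I_def)
    show "\<phi> p \<in> (\<lambda>A. [A]) ` nilclass \<epsilon> n" if "p \<in> D" for p
    proof -
      have "dot n (v p) (u p) = v p 0 * u p 0 + (\<Sum>c\<in>{1..<n}. v p c * u p c)"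
        unfolding dot_def using n by (subst lessThan_atLeast0, subst sum.atLeast_Suc_lessThan) auto
      also have "\<dots> = 0" by (simp add: u_def v_def)
      finally have "dot n (v p) (u p) = 0" .
      moreover have "u p 0 \<noteq> 0" "v p 1 \<noteq> 0" using that by (auto simp: u_def v_def D_def)
      then have "\<exists>a<n. u p a \<noteq> 0" "\<exists>a<n. v p a \<noteq> 0" using n
        by (auto intro: exI[of _ "0 :: nat"] exI[of _ "1 :: nat"])
      ultimately have "rank1 n \<epsilon> (u p) (v p) \<in> nilclass \<epsilon> n"
        by (intro nilclassI(1))
      then show ?thesis by (simp add: \<phi>_def)
    qed
    show "(\<lambda>p. (\<phi> p ! k) $$ (i, j)) \<in> rat_fun D" if "k < 1" "i < n" "j < n" for k i j
    proof -
      have "(\<lambda>p. u p i) \<in> rat_fun D"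
        by (cases "i = 0") (auto simp: u_def intro: rat_fun_intros)
      moreover have "(\<lambda>p. v p j) \<in> rat_fun D"
        by (cases "j = 0") (auto simp: v_def intro!: rat_fun.coord rat_fun_uminus rat_fun_sum rat_fun.mult)
      ultimately have "(\<lambda>p. (if i = j then \<epsilon> else 0) + u p i * v p j) \<in> rat_fun D"
        by (intro rat_fun.add rat_fun.const rat_fun.mult)
      then show ?thesis using that by (simp add: \<phi>_def)
    qed
    fix x assume x: "x \<in> I"
    obtain t a where xa: "x = (t, a)" by (cases x)
    then have a: "1 \<le> a" "a < n" using x by (auto simp: I_def)
    show "\<exists>f\<in>poly_fun n 1. \<exists>c.
        (\<forall>p\<in>D. p x = b x \<longrightarrow> (\<forall>y. (case x of (t, a) \<Rightarrow> if t then 1 else 0) < (case y of (t, a) \<Rightarrow> if t then (1 :: nat) else 0) \<longrightarrow> p y = b y) \<longrightarrow> f (\<phi> p) = c) \<and>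
        (\<forall>t. t \<noteq> 0 \<longrightarrow> b(x := b x + t) \<in> D \<longrightarrow> f (\<phi> (b(x := b x + t))) \<noteq> c)"
    proof (cases t)
      case True
      then show ?thesis
        using a n unfolding xa
        by (intro bexI[of _ "\<lambda>As. (As ! 0) $$ (0, a)"] exI[of _ "b (True, a)"])
          (auto simp: \<phi>_def u_def v_def intro: poly_fun.coord)
    next
      case False
      then show ?thesis
        using a n unfolding xa
        by (intro bexI[of _ "\<lambda>As. (As ! 0) $$ (a, 1)"] exI[of _ "if a = 1 then \<epsilon> else 0"])
          (auto simp: \<phi>_def u_def v_def b_def intro: poly_fun.coord)
    qed
  qed
  moreover have "card I = 2 * n - 2" by (simp add: I_def card_cartesian_product)
  ultimately show ?thesis by simp
qed

lemma class_dim_nilclass: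
  assumes "2 \<le> n" shows "class_dim n (nilclass \<epsilon> n) = 2 * n - 2"
proof -
  have "zdim n 1 ((\<lambda>A. [A]) ` nilclass \<epsilon> n) = enat (2 * n - 2)"
    using zdim_nilclass_le[OF assms] zdim_nilclass_ge[OF assms] by (rule antisym)
  then show ?thesis by (simp add: class_dim_def)
qed

lemma \<kappa>_nilclass:
  assumes "2 \<le> n"
  shows "\<kappa> n (replicate (n + 2) (nilclass \<epsilon> n)) = 4 - 2 * int n"
    and "expected_dim n (replicate (n + 2) (nilclass \<epsilon> n)) = (int n)\<^sup>2 + 2 * int n - 3"
proof -
  have "int (2 * n - 2) = 2 * int n - 2" using assms by simp
  then show "\<kappa> n (replicate (n + 2) (nilclass \<epsilon> n)) = 4 - 2 * int n"
    by (simp add: \<kappa>_def class_dim_nilclass[OF assms] sum_list_replicate power2_eq_square algebra_simps)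
  then show "expected_dim n (replicate (n + 2) (nilclass \<epsilon> n)) = (int n)\<^sup>2 + 2 * int n - 3"
    by (simp add: expected_dim_def)
qed

section \<open>Admissibility\<close>

lemma list_all2_replicate: "list_all2 (\<in>) As (replicate q C) \<longleftrightarrow> length As = q \<and> set As \<subseteq> C"
  by (auto simp: list_all2_conv_all_nth in_set_conv_nth subset_iff)

definition nil_jnf :: "nat \<Rightarrow> jnf" where
  "nil_jnf n = {#add_mset 2 (replicate_mset (n - 2) 1)#}"

lemma jnf_of_blocks_nil: "jnf_of_blocks ((2, \<epsilon>) # replicate m (1, \<epsilon>)) = {#add_mset 2 (replicate_mset m 1)#}"
proof -
  define bs where "bs = (2 :: nat, \<epsilon>) # replicate m (1, \<epsilon>)"
  have img: "snd ` set bs = {\<epsilon>}" by (auto simp: bs_def)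
  have fil: "filter_mset (\<lambda>b. snd b = \<epsilon>) (mset bs) = mset bs"
    by (intro filter_mset_eq_conv[THEN iffD2]) (auto simp: bs_def)
  have "jnf_of_blocks bs = {#image_mset fst (mset bs)#}"
    by (simp add: jnf_of_blocks_def img fil)
  then show ?thesis by (simp add: bs_def)
qed

lemma nilclass_subset_mats_of_jnf:
  assumes "2 \<le> n" shows "nilclass \<epsilon> n \<subseteq> mats_of_jnf n (nil_jnf n)"
proof
  fix A assume A: "A \<in> nilclass \<epsilon> n"
  show "A \<in> mats_of_jnf n (nil_jnf n)"
    unfolding mats_of_jnf_def nil_jnf_def mem_Collect_eq
    by (intro conjI nilclass_carrier[OF A] exI[of _ "(2, \<epsilon>) # replicate (n - 2) (1, \<epsilon>)"]
        nilclass_jordan_nf[OF A assms] jnf_of_blocks_nil[symmetric])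
qed

text \<open>The entry 1 above the diagonal is the certificate that a matrix with a block of size 2
  is not scalar.\<close>

lemma jordan_matrix_superdiagonal:
  assumes "(2, a) \<in> set bs"
  shows "\<exists>i. Suc i < sum_list (map fst bs) \<and> jordan_matrix bs $$ (i, Suc i) = (1 :: complex)"
  using assms
proof (induction bs)
  case (Cons b bs)
  obtain m c where b: "b = (m, c)" by (cases b)
  show ?case
  proof (cases "b = (2, a)")
    case True
    then show ?thesis
      by (intro exI[of _ 0]) (auto simp: jordan_matrix_Cons jordan_block_def four_block_mat_def Let_def)
  next
    case False
    then obtain i where "Suc i < sum_list (map fst bs)" "jordan_matrix bs $$ (i, Suc i) = 1"
      using Cons by auto
    then show ?thesis unfolding b
      by (intro exI[of _ "m + i"]) (auto simp: jordan_matrix_Cons jordan_block_def four_block_mat_def Let_def)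
  qed
qed simp

lemma (in vec_space) rank_pos:
  assumes A: "A \<in> carrier_mat n nc" and ne: "A \<noteq> 0\<^sub>m n nc"
  shows "1 \<le> rank A"
proof -
  obtain j where j: "j < nc" "col A j \<noteq> 0\<^sub>v n"
  proof (rule ccontr)
    assume neg: "\<not> thesis"
    then have "col A j = 0\<^sub>v n" if "j < nc" for j using that \<open>\<And>j. j < nc \<Longrightarrow> col A j \<noteq> 0\<^sub>v n \<Longrightarrow> thesis\<close> by blast
    then have "A $$ (i, j) = 0" if "i < n" "j < nc" for i j
      using that A by (metis carrier_matD index_col index_zero_vec(1))
    then have "A = 0\<^sub>m n nc" using A by (intro eq_matI) auto
    with ne show False by simp
  qed
  let ?v = "col A j"
  have v: "?v \<in> carrier_vec n" using A by auto
  have "lin_indpt {?v}"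
  proof
    assume "lin_dep {?v}"
    then obtain a where a: "lincomb a {?v} = 0\<^sub>v n" "a ?v \<noteq> 0"
      unfolding lin_dep_def by (auto simp: subset_singleton_iff)
    have "lincomb a {?v} = a ?v \<cdot>\<^sub>v ?v"
      using v by (simp add: lincomb_def)
    then have "a ?v \<cdot>\<^sub>v ?v = 0\<^sub>v n" using a(1) by simp
    then have "inverse (a ?v) \<cdot>\<^sub>v (a ?v \<cdot>\<^sub>v ?v) = 0\<^sub>v n" by simp
    then have "?v = 0\<^sub>v n" using a(2) v by (simp add: smult_smult_assoc)
    with j show False by simp
  qed
  moreover have "?v \<in> set (cols A)" using j A by (auto simp: cols_def)
  ultimately have "card {?v} \<le> rank A" using A by (intro rank_ge_card_indpt) auto
  then show ?thesis by simp
qed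

lemma min_rank_nil_jnf:
  assumes n: "2 \<le> n" shows "min_rank n (mats_of_jnf n (nil_jnf n)) = 1"
proof -
  let ?S = "{vec_space.rank n (Y - l \<cdot>\<^sub>m 1\<^sub>m n) | Y l. Y \<in> mats_of_jnf n (nil_jnf n)}"
  have ge: "1 \<le> x" if x: "x \<in> ?S" for x
  proof -
    obtain Y l where Y: "Y \<in> mats_of_jnf n (nil_jnf n)" "x = vec_space.rank n (Y - l \<cdot>\<^sub>m 1\<^sub>m n)"
      using x by blast
    obtain bs where bs: "Y \<in> carrier_mat n n" "jordan_nf Y bs" "nil_jnf n = jnf_of_blocks bs"
      using Y(1) unfolding mats_of_jnf_def by blast
    have "add_mset 2 (replicate_mset (n - 2) 1) \<in># jnf_of_blocks bs"
      unfolding bs(3)[symmetric] nil_jnf_def by simp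
    then obtain a where "add_mset 2 (replicate_mset (n - 2) 1) = image_mset fst (filter_mset (\<lambda>b. snd b = a) (mset bs))"
      unfolding jnf_of_blocks_def by auto
    then have "2 \<in># image_mset fst (filter_mset (\<lambda>b. snd b = a) (mset bs))"
      by (metis union_single_eq_member)
    then obtain c where "(2, c) \<in> set bs" by auto
    then obtain i where i: "Suc i < sum_list (map fst bs)" "jordan_matrix bs $$ (i, Suc i) = 1"
      using jordan_matrix_superdiagonal by blast
    have "Y \<noteq> l \<cdot>\<^sub>m 1\<^sub>m n"
    proof
      assume Yl: "Y = l \<cdot>\<^sub>m 1\<^sub>m n"
      have "similar_mat (jordan_matrix bs) Y"
        using bs(2) similar_mat_sym unfolding jordan_nf_def by blast
      then obtain P Q where PQ: "similar_mat_wit (jordan_matrix bs) Y P Q"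
        unfolding similar_mat_def by blast
      note w = similar_mat_witD_right[OF PQ bs(1)]
      have "P * (l \<cdot>\<^sub>m 1\<^sub>m n) = l \<cdot>\<^sub>m P"
        using mult_smult_distrib[OF w(2) one_carrier_mat, of l] w(2) by simp
      then have "jordan_matrix bs = l \<cdot>\<^sub>m P * Q" using w(6) Yl by simp
      also have "\<dots> = l \<cdot>\<^sub>m 1\<^sub>m n" using mult_smult_assoc_mat[OF w(2,3)] w(4) by simp
      finally have J: "jordan_matrix bs = l \<cdot>\<^sub>m 1\<^sub>m n" .
      have "sum_list (map fst bs) = n" using arg_cong[OF J, of dim_row] by simp
      with i J show False by simp
    qed
    have "Y - l \<cdot>\<^sub>m 1\<^sub>m n \<noteq> 0\<^sub>m n n"
    proof
      assume *: "Y - l \<cdot>\<^sub>m 1\<^sub>m n = 0\<^sub>m n n"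
      have "Y $$ (i, j) = (l \<cdot>\<^sub>m 1\<^sub>m n) $$ (i, j)" if "i < n" "j < n" for i j
        using arg_cong[OF *, of "\<lambda>M. M $$ (i, j)"] that bs(1) by simp
      then have "Y = l \<cdot>\<^sub>m 1\<^sub>m n" using bs(1) by (intro eq_matI) auto
      with \<open>Y \<noteq> l \<cdot>\<^sub>m 1\<^sub>m n\<close> show False by contradiction
    qed
    then show ?thesis unfolding Y(2) using bs(1) by (intro vec_space.rank_pos) auto
  qed
  let ?R = "rank1 n 0 (kron 0) (kron 1)"
  have R: "?R \<in> mats_of_jnf n (nil_jnf n)"
  proof (rule subsetD[OF nilclass_subset_mats_of_jnf[OF n]])
    show "?R \<in> nilclass 0 n"
      unfolding nilclass_def conj_class_def using similar_mat_refl[OF rank1_carrier(1)] by blast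
  qed
  have "vec_space.rank n (?R - 0 \<cdot>\<^sub>m 1\<^sub>m n) \<le> 1"
    by (rule vec_space.rank_le_1_product_entries[of _ _ n "kron 0" "kron 1"]) auto
  moreover have "vec_space.rank n (?R - 0 \<cdot>\<^sub>m 1\<^sub>m n) \<in> ?S" using R by blast
  ultimately have "1 \<in> ?S" using ge by (metis (no_types, lifting) le_antisym)
  then have "Inf ?S = 1" using ge by (intro cInf_eq_minimum)
  then show ?thesis unfolding min_rank_def .
qed

lemma ranks_nil_jnf: "2 \<le> n \<Longrightarrow> ranks n (replicate q (nil_jnf n)) = replicate q 1"
  by (simp add: ranks_def min_rank_nil_jnf)

lemma jnf_step_nil_jnf:
  assumes "2 \<le> n" shows "jnf_step (n - 2) (nil_jnf n) (nil_jnf 2)"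
proof -
  have *: "add_mset 2 (replicate_mset (n - 2) 1) = mset (replicate (n - 2) (1 :: nat) @ [2])" by simp
  have "sorted_list_of_multiset (add_mset 2 (replicate_mset (n - 2) 1)) = replicate (n - 2) (1 :: nat) @ [2]"
    unfolding * sorted_list_of_multiset_mset by (intro sorted_sort_id) (simp add: sorted_append)
  then have "decrease_smallest (n - 2) (add_mset 2 (replicate_mset (n - 2) 1)) = {#2#}"
    by (simp add: decrease_smallest_def)
  then show ?thesis
    by (simp add: jnf_step_def nil_jnf_def)
qed

text \<open>With n + 2 classes of rank 1 the reduced size is (n + 2) - n = 2. The n - 2 blocks of
  size 1 disappear and one block of size 2 remains, for which the condition omega reads n + 2 >= 4;
  so the iteration stops after one step.\<close>

lemma admissible_nil_jnf:
  assumes n: "2 < n" shows "admissible_jnfs n (replicate (n + 2) (nil_jnf n))"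
proof -
  have \<beta>: "cond_\<beta> n (replicate (n + 2) (nil_jnf n))"
    unfolding cond_\<beta>_def
  proof (intro allI impI)
    fix j assume j: "j < length (replicate (n + 2) (nil_jnf n))"
    have "(\<Sum>i\<in>{..<n + 2} - {j}. ranks n (replicate (n + 2) (nil_jnf n)) ! i) = (\<Sum>i\<in>{..<n + 2} - {j}. 1)"
      using n by (intro sum.cong) (auto simp: ranks_nil_jnf simp del: replicate_Suc)
    with j show "n \<le> (\<Sum>i\<in>{..<length (replicate (n + 2) (nil_jnf n))} - {j}. ranks n (replicate (n + 2) (nil_jnf n)) ! i)"
      by (simp del: replicate_Suc)
  qed
  have \<omega>: "cond_\<omega> 2 (replicate (n + 2) (nil_jnf 2))"
    using n unfolding cond_\<omega>_def by (simp add: ranks_nil_jnf sum_list_replicate del: replicate_Suc)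
  have "\<not> cond_\<omega> n (replicate (n + 2) (nil_jnf n))"
    using n unfolding cond_\<omega>_def by (simp add: ranks_nil_jnf sum_list_replicate del: replicate_Suc)
  then have "psi_step (n, replicate (n + 2) (nil_jnf n)) (2, replicate (n + 2) (nil_jnf 2))"
    using n \<beta> jnf_step_nil_jnf[of n]
    by (auto simp: psi_step_def ranks_nil_jnf sum_list_replicate list_all2_conv_all_nth simp del: replicate_Suc)
  moreover have "\<not> Domainp psi_step (2, replicate (n + 2) (nil_jnf 2))"
    using \<omega> by (auto simp: psi_step_def Domainp_iff)
  ultimately show ?thesis unfolding admissible_jnfs_def using \<beta> \<omega> by blast
qed

lemma admissible_classes_nilclass:
  assumes n: "2 < n" shows "admissible_classes n (replicate (n + 2) (nilclass \<epsilon> n))"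
  unfolding admissible_classes_def
  using admissible_nil_jnf[OF n] nilclass_subset_mats_of_jnf[of n \<epsilon>] n
  by (intro exI[of _ "replicate (n + 2) (nil_jnf n)"]) (auto simp: list_all2_conv_all_nth simp del: replicate_Suc)

lemma admissible_add_nilclass:
  assumes n: "2 < n" shows "admissible_add n (replicate (n + 2) (nilclass 0 n))"
  unfolding admissible_add_def
proof (intro conjI allI impI admissible_classes_nilclass n)
  show "set (replicate (n + 2) (nilclass 0 n)) \<subseteq> gl_classes n"
    by (auto simp: gl_classes_def nilclass_def)
  fix As assume "list_all2 (\<in>) As (replicate (n + 2) (nilclass 0 n))"
  then have "set As \<subseteq> nilclass 0 n" unfolding list_all2_replicate by blast
  then have "map mat_trace As = map (\<lambda>_. 0) As" using trace_nilclass[of _ 0 n] n by (intro map_cong) auto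
  then show "(\<Sum>A\<leftarrow>As. mat_trace A) = 0" by (simp add: map_replicate_const sum_list_replicate)
qed

lemma admissible_mult_nilclass:
  assumes n: "2 < n" shows "admissible_mult n (replicate (n + 2) (nilclass 1 n))"
  unfolding admissible_mult_def
proof (intro conjI allI impI admissible_classes_nilclass n)
  let ?R = "rank1 n 1 (kron 0) (kron 1)"
  have "?R \<in> nilclass 1 n"
    unfolding nilclass_def conj_class_def using similar_mat_refl[OF rank1_carrier(1)] by blast
  then have "det ?R \<noteq> 0" using det_nilclass[of ?R 1 n] n by simp
  then obtain Q where "Q \<in> carrier_mat n n" "?R * Q = 1\<^sub>m n" "Q * ?R = 1\<^sub>m n"
    using inverse_mat_exists[OF rank1_carrier(1)] by blast
  then have "invertible_mat ?R" unfolding invertible_mat_def inverts_mat_def by auto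
  then show "set (replicate (n + 2) (nilclass 1 n)) \<subseteq> GL_classes n"
    by (auto simp: GL_classes_def nilclass_def)
  fix As assume "list_all2 (\<in>) As (replicate (n + 2) (nilclass 1 n))"
  then have "set As \<subseteq> nilclass 1 n" unfolding list_all2_replicate by blast
  then have "map det As = map (\<lambda>_. 1) As" using det_nilclass[of _ 1 n] n by (intro map_cong) auto
  then show "(\<Prod>M\<leftarrow>As. det M) = 1" by (simp add: map_replicate_const)
qed

section \<open>The additive and the multiplicative equation\<close>

text \<open>Shifting by the eigenvalue turns both equations into the vanishing of a product for
  the operation \<open>N + Y + \<epsilon> N Y\<close>, with \<open>\<epsilon> = 0\<close> in the additive
  and \<open>\<epsilon> = 1\<close> in the multiplicative case.\<close>

definition op_prod :: "nat \<Rightarrow> complex \<Rightarrow> complex mat list \<Rightarrow> complex mat" where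
  "op_prod n \<epsilon> Ns = foldr (\<lambda>N Y. N + Y + \<epsilon> \<cdot>\<^sub>m (N * Y)) Ns (0\<^sub>m n n)"

definition shift :: "nat \<Rightarrow> complex \<Rightarrow> complex mat \<Rightarrow> complex mat" where
  "shift n \<epsilon> A = A - \<epsilon> \<cdot>\<^sub>m 1\<^sub>m n"

definition nil_variety :: "complex \<Rightarrow> nat \<Rightarrow> nat \<Rightarrow> complex mat list set" where
  "nil_variety \<epsilon> n q =
     {As. length As = q \<and> set As \<subseteq> nilclass \<epsilon> n \<and> op_prod n \<epsilon> (map (shift n \<epsilon>) As) = 0\<^sub>m n n}"

lemma op_prod_Nil [simp]: "op_prod n \<epsilon> [] = 0\<^sub>m n n"
  and op_prod_Cons [simp]: "op_prod n \<epsilon> (N # Ns) = N + op_prod n \<epsilon> Ns + \<epsilon> \<cdot>\<^sub>m (N * op_prod n \<epsilon> Ns)"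
  by (simp_all add: op_prod_def)

lemma op_prod_carrier: "set Ns \<subseteq> carrier_mat n n \<Longrightarrow> op_prod n \<epsilon> Ns \<in> carrier_mat n n"
  by (induction Ns) auto

lemma shift_carrier [simp]: "A \<in> carrier_mat n n \<Longrightarrow> shift n \<epsilon> A \<in> carrier_mat n n"
  by (auto simp: shift_def intro!: minus_carrier_mat smult_carrier_mat)

lemma shift_rank1 [simp]: "shift n \<epsilon> (rank1 n \<epsilon> u v) = rank1 n 0 u v"
  by (simp add: shift_def rank1_minus_smult)

lemma sum_eq_op_prod:
  assumes "set As \<subseteq> carrier_mat n n"
  shows "foldr (+) As (0\<^sub>m n n) = op_prod n 0 (map (shift n 0) As)"
  using assms
proof (induction As)
  case (Cons A As)
  then have "op_prod n 0 (map (shift n 0) As) \<in> carrier_mat n n" "A \<in> carrier_mat n n"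
    by (auto intro!: op_prod_carrier simp: subset_iff)
  moreover from this have "shift n 0 A = A" by (intro eq_matI) (auto simp: shift_def)
  ultimately show ?case using Cons by (intro eq_matI) auto
qed simp

lemma prod_eq_op_prod:
  assumes "set As \<subseteq> carrier_mat n n"
  shows "foldr (*) As (1\<^sub>m n) = 1\<^sub>m n + op_prod n 1 (map (shift n 1) As)"
  using assms
proof (induction As)
  case (Cons A As)
  let ?Y = "op_prod n 1 (map (shift n 1) As)"
  have Y: "?Y \<in> carrier_mat n n" and A: "A \<in> carrier_mat n n"
    using Cons.prems by (auto intro!: op_prod_carrier simp: subset_iff)
  have N: "shift n 1 A \<in> carrier_mat n n" using A by simp
  have "A = 1\<^sub>m n + shift n 1 A" using A by (intro eq_matI) (auto simp: shift_def)
  then have "A * (1\<^sub>m n + ?Y) = (1\<^sub>m n + shift n 1 A) * (1\<^sub>m n + ?Y)" by simp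
  also have "\<dots> = 1\<^sub>m n * (1\<^sub>m n + ?Y) + shift n 1 A * (1\<^sub>m n + ?Y)"
    using Y N by (intro add_mult_distrib_mat) auto
  also have "shift n 1 A * (1\<^sub>m n + ?Y) = shift n 1 A * 1\<^sub>m n + shift n 1 A * ?Y"
    using Y N by (intro mult_add_distrib_mat) auto
  finally have "A * (1\<^sub>m n + ?Y) = 1\<^sub>m n + op_prod n 1 (map (shift n 1) (A # As))"
    using Y N by (intro eq_matI) auto
  then show ?case using Cons by simp
qed simp

lemma \<V>_add_nilclass: "\<V>_add n (replicate q (nilclass 0 n)) = nil_variety 0 n q"
proof -
  have "foldr (+) As (0\<^sub>m n n) = op_prod n 0 (map (shift n 0) As)" if "set As \<subseteq> nilclass 0 n" for As
    using that nilclass_carrier by (intro sum_eq_op_prod) blast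
  then show ?thesis unfolding \<V>_add_def nil_variety_def list_all2_replicate by auto
qed

lemma \<V>_mult_nilclass: "\<V>_mult n (replicate q (nilclass 1 n)) = nil_variety 1 n q"
proof -
  have "foldr (*) As (1\<^sub>m n) = 1\<^sub>m n \<longleftrightarrow> op_prod n 1 (map (shift n 1) As) = 0\<^sub>m n n"
    if As: "set As \<subseteq> nilclass 1 n" for As
  proof -
    let ?Y = "op_prod n 1 (map (shift n 1) As)"
    have c: "set As \<subseteq> carrier_mat n n" using As nilclass_carrier by blast
    have Y: "?Y \<in> carrier_mat n n" using c by (intro op_prod_carrier) (auto simp: subset_iff)
    have "1\<^sub>m n + ?Y = 1\<^sub>m n \<longleftrightarrow> ?Y = 0\<^sub>m n n"
    proof
      assume *: "1\<^sub>m n + ?Y = 1\<^sub>m n"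
      have "?Y $$ (i, j) = 0" if "i < n" "j < n" for i j
        using arg_cong[OF *, of "\<lambda>M. M $$ (i, j)"] that Y by simp
      then show "?Y = 0\<^sub>m n n" using Y by (intro eq_matI) auto
    qed simp
    then show ?thesis unfolding prod_eq_op_prod[OF c] .
  qed
  then show ?thesis unfolding \<V>_mult_def nil_variety_def list_all2_replicate by auto
qed

lemma nil_variety_subset_tuples: "nil_variety \<epsilon> n q \<subseteq> tuples n q"
  using nilclass_carrier by (auto simp: nil_variety_def tuples_def)

lemma op_index:
  assumes "Y \<in> carrier_mat n n" "a < n" "b < n"
  shows "(rank1 n 0 u v + Y + \<epsilon> \<cdot>\<^sub>m (rank1 n 0 u v * Y)) $$ (a, b) =
    u a * v b + Y $$ (a, b) + \<epsilon> * (u a * fun_mat n v Y b)"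
  using assms by (simp add: rank1_mult_index[OF assms] del: index_mult_mat(1))

lemma fun_mat_op:
  assumes "Y \<in> carrier_mat n n" "b < n"
  shows "fun_mat n y (rank1 n 0 u v + Y + \<epsilon> \<cdot>\<^sub>m (rank1 n 0 u v * Y)) b =
    dot n y u * v b + fun_mat n y Y b + \<epsilon> * (dot n y u * fun_mat n v Y b)"
proof -
  have "fun_mat n y (rank1 n 0 u v + Y + \<epsilon> \<cdot>\<^sub>m (rank1 n 0 u v * Y)) b =
      (\<Sum>c<n. y c * u c * v b + y c * Y $$ (c, b) + \<epsilon> * (y c * u c * fun_mat n v Y b))"
    unfolding fun_mat_def[of n y] using assms
    by (intro sum.cong) (auto simp: op_index algebra_simps simp del: index_add_mat)
  then show ?thesis
    by (simp add: sum.distrib sum_distrib_left[symmetric] sum_distrib_right[symmetric] dot_def fun_mat_def[of n y])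
qed

lemma fun_mat_rank1: "b < n \<Longrightarrow> fun_mat n y (rank1 n 0 u v) b = dot n y u * v b"
  by (simp add: fun_mat_def dot_def sum_distrib_right mult.assoc)

lemma mat_fun_rank1: "a < n \<Longrightarrow> mat_fun n (rank1 n 0 u v) x a = u a * dot n v x"
  by (simp add: mat_fun_def dot_def sum_distrib_left mult.assoc)

lemma mat_fun_mult:
  assumes "(A :: complex mat) \<in> carrier_mat n n" "B \<in> carrier_mat n n" "a < n"
  shows "mat_fun n (A * B) x a = mat_fun n A (mat_fun n B x) a"
proof -
  have "mat_fun n (A * B) x a = (\<Sum>c<n. \<Sum>d<n. A $$ (a, d) * B $$ (d, c) * x c)"
    unfolding mat_fun_def using assms
    by (intro sum.cong) (auto simp: index_mult_mat_sum sum_distrib_right simp del: index_mult_mat)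
  also have "\<dots> = (\<Sum>d<n. \<Sum>c<n. A $$ (a, d) * B $$ (d, c) * x c)" by (rule sum.swap)
  finally show ?thesis by (simp add: mat_fun_def sum_distrib_left mult.assoc)
qed

lemma mat_fun_op:
  assumes "Y \<in> carrier_mat n n" "a < n"
  shows "mat_fun n (rank1 n 0 u v + Y + \<epsilon> \<cdot>\<^sub>m (rank1 n 0 u v * Y)) x a =
    u a * dot n v x + mat_fun n Y x a + \<epsilon> * (u a * dot n v (mat_fun n Y x))"
proof -
  have "mat_fun n (rank1 n 0 u v + Y + \<epsilon> \<cdot>\<^sub>m (rank1 n 0 u v * Y)) x a =
     mat_fun n (rank1 n 0 u v) x a + mat_fun n Y x a + \<epsilon> * mat_fun n (rank1 n 0 u v * Y) x a"
    unfolding mat_fun_def sum_distrib_left sum.distrib[symmetric] using assms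
    by (intro sum.cong) (auto simp: algebra_simps simp del: index_mult_mat(1))
  then show ?thesis
    using assms by (simp add: mat_fun_rank1 mat_fun_mult[OF rank1_carrier(1)])
qed

section \<open>Tuples with trivial centralizer\<close>

definition det3 :: "(nat \<Rightarrow> nat \<Rightarrow> complex) \<Rightarrow> complex" where
  "det3 f = f 0 0 * (f 1 1 * f 2 2 - f 1 2 * f 2 1) - f 0 1 * (f 1 0 * f 2 2 - f 1 2 * f 2 0)
     + f 0 2 * (f 1 0 * f 2 1 - f 1 1 * f 2 0)"

lemma det3_cong: "(\<And>a b. a < 3 \<Longrightarrow> b < 3 \<Longrightarrow> f a b = g a b) \<Longrightarrow> det3 f = det3 g"
  by (simp add: det3_def)

text \<open>The matrix on the left is U^T V, where the \<open>u i\<close> and the \<open>v i\<close>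
  are the rows of U and V.\<close>

lemma det3_mult:
  "det3 (\<lambda>a b. u 0 a * v 0 b + u 1 a * v 1 b + u 2 a * v 2 b) = det3 u * det3 v"
  by (simp add: det3_def algebra_simps)

lemma det3_cramer:
  assumes "det3 v \<noteq> 0" and "\<And>b. b < 3 \<Longrightarrow> c0 * v 0 b + c1 * v 1 b + c2 * v 2 b = 0"
  shows "c0 = 0" "c1 = 0" "c2 = 0"
proof -
  let ?e = "\<lambda>b. c0 * v 0 b + c1 * v 1 b + c2 * v 2 b"
  have e: "?e 0 = 0" "?e 1 = 0" "?e 2 = 0" by (rule assms(2); simp)+
  have "det3 v * c0 = ?e 0 * (v 1 1 * v 2 2 - v 1 2 * v 2 1) - ?e 1 * (v 1 0 * v 2 2 - v 1 2 * v 2 0)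
      + ?e 2 * (v 1 0 * v 2 1 - v 1 1 * v 2 0)"
    by (simp add: det3_def algebra_simps)
  moreover have "det3 v * c1 = ?e 1 * (v 0 0 * v 2 2 - v 0 2 * v 2 0) - ?e 0 * (v 0 1 * v 2 2 - v 0 2 * v 2 1)
      - ?e 2 * (v 0 0 * v 2 1 - v 0 1 * v 2 0)"
    by (simp add: det3_def algebra_simps)
  moreover have "det3 v * c2 = ?e 0 * (v 0 1 * v 1 2 - v 0 2 * v 1 1) - ?e 1 * (v 0 0 * v 1 2 - v 0 2 * v 1 0)
      + ?e 2 * (v 0 0 * v 1 1 - v 0 1 * v 1 0)"
    by (simp add: det3_def algebra_simps)
  ultimately have "det3 v * c0 = 0" "det3 v * c1 = 0" "det3 v * c2 = 0"
    unfolding e by simp_all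
  then show "c0 = 0" "c1 = 0" "c2 = 0" using assms(1) by auto
qed

text \<open>Subtracting 3 \<epsilon> on the diagonal leaves the sum of the last three rank one
  parts, so by \<open>det3_mult\<close> this is the product of a minor of the images and a minor of
  the coimages.\<close>

definition last_minor :: "complex \<Rightarrow> nat \<Rightarrow> complex mat list \<Rightarrow> complex" where
  "last_minor \<epsilon> q As = det3 (\<lambda>a b. (As ! (q - 3)) $$ (a, b) + (As ! (q - 2)) $$ (a, b)
     + (As ! (q - 1)) $$ (a, b) + (if a = b then - 3 * \<epsilon> else 0))"

lemma det3_poly_fun:
  assumes "\<And>a b. a < 3 \<Longrightarrow> b < 3 \<Longrightarrow> F a b \<in> poly_fun n q"
  shows "(\<lambda>s. det3 (\<lambda>a b. F a b s)) \<in> poly_fun n q"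
proof -
  have d: "(\<lambda>As. f As - g As) \<in> poly_fun n q" if "f \<in> poly_fun n q" "g \<in> poly_fun n q" for f g
    using poly_fun.add[OF that(1) poly_fun.mult[OF poly_fun.const[of "-1"] that(2)]] by simp
  have F: "F 0 0 \<in> poly_fun n q" "F 0 1 \<in> poly_fun n q" "F 0 2 \<in> poly_fun n q"
    "F 1 0 \<in> poly_fun n q" "F 1 1 \<in> poly_fun n q" "F 1 2 \<in> poly_fun n q"
    "F 2 0 \<in> poly_fun n q" "F 2 1 \<in> poly_fun n q" "F 2 2 \<in> poly_fun n q"
    by (rule assms; simp)+
  have m: "(\<lambda>s. F i j s * (F k l s * F x y s - F w z s * F g h s)) \<in> poly_fun n q"
    if "F i j \<in> poly_fun n q" "F k l \<in> poly_fun n q" "F x y \<in> poly_fun n q"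
      "F w z \<in> poly_fun n q" "F g h \<in> poly_fun n q" for i j k l x y w z g h
    using that by (intro d poly_fun.mult)
  show ?thesis
    unfolding det3_def by (intro poly_fun.add d m F)
qed

lemma last_minor_poly_fun:
  assumes "3 \<le> n" "3 \<le> q" shows "last_minor \<epsilon> q \<in> poly_fun n q"
  unfolding last_minor_def[abs_def]
proof (rule det3_poly_fun[where F = "\<lambda>a b As. (As ! (q - 3)) $$ (a, b) + (As ! (q - 2)) $$ (a, b)
     + (As ! (q - 1)) $$ (a, b) + (if a = b then - 3 * \<epsilon> else 0)"])
  fix a b :: nat assume "a < 3" "b < 3"
  then show "(\<lambda>As. (As ! (q - 3)) $$ (a, b) + (As ! (q - 2)) $$ (a, b)
     + (As ! (q - 1)) $$ (a, b) + (if a = b then - 3 * \<epsilon> else 0)) \<in> poly_fun n q"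
    using assms by (intro poly_fun.add poly_fun.coord poly_fun.const) auto
qed

text \<open>A covector that annihilates the image of the left factor N does not see N: y (N + Y +
  \<epsilon> N Y) = y Y.\<close>

lemma left_kernel_op_prod:
  assumes "\<And>i. i < m \<Longrightarrow> dot n y (u i) = 0" "b < n" "Y = op_prod n \<epsilon> Ms" "set Ms \<subseteq> carrier_mat n n"
  shows "fun_mat n y (op_prod n \<epsilon> (map (\<lambda>i. rank1 n 0 (u i) (v i)) [l..<m] @ Ms)) b = fun_mat n y Y b"
proof (induction "m - l" arbitrary: l)
  case (Suc k)
  then have l: "l < m" by simp
  have "op_prod n \<epsilon> (map (\<lambda>i. rank1 n 0 (u i) (v i)) [Suc l..<m] @ Ms) \<in> carrier_mat n n"
    using assms(4) by (intro op_prod_carrier) auto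
  with Suc(1)[of "Suc l"] Suc(2) assms l show ?case
    by (simp add: upt_conv_Cons fun_mat_op)
qed (use assms in auto)

text \<open>Less direct than on the left, since N also acts on Y x: from v . x = 0 one gets Y x +
  \<epsilon> u (v . Y x) = 0. Applying v and using v . u = 0 gives v . Y x = 0, and then Y x =
  0.\<close>

lemma right_kernel_op_prod:
  assumes v: "\<And>i. i < m \<Longrightarrow> dot n (v i) x = 0" and vu: "\<And>i. i < m \<Longrightarrow> dot n (v i) (u i) = 0"
    and Ms: "set Ms \<subseteq> carrier_mat n n"
    and "\<And>a. a < n \<Longrightarrow> mat_fun n (op_prod n \<epsilon> (map (\<lambda>i. rank1 n 0 (u i) (v i)) [l..<m] @ Ms)) x a = 0"
    and "a < n"
  shows "mat_fun n (op_prod n \<epsilon> Ms) x a = 0"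
  using assms(4,5)
proof (induction "m - l" arbitrary: l a)
  case (Suc k)
  then have l: "l < m" by simp
  define Y where "Y = op_prod n \<epsilon> (map (\<lambda>i. rank1 n 0 (u i) (v i)) [Suc l..<m] @ Ms)"
  have Y: "Y \<in> carrier_mat n n" unfolding Y_def
    using Ms by (intro op_prod_carrier) auto
  have eq: "mat_fun n Y x a + \<epsilon> * (u l a * dot n (v l) (mat_fun n Y x)) = 0" if "a < n" for a
    using Suc(3)[OF that] that l v[OF l] by (simp add: upt_conv_Cons mat_fun_op[OF Y] Y_def[symmetric])
  have "(\<Sum>a<n. v l a * (mat_fun n Y x a + \<epsilon> * (u l a * K))) =
      dot n (v l) (mat_fun n Y x) + \<epsilon> * (dot n (v l) (u l) * K)" for K
    unfolding dot_def by (simp add: sum.distrib sum_distrib_left sum_distrib_right algebra_simps)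
  from this[of "dot n (v l) (mat_fun n Y x)"]
  have "dot n (v l) (mat_fun n Y x) = 0" using eq vu[OF l] by simp
  then have "mat_fun n Y x a = 0" if "a < n" for a using eq[OF that] by simp
  then show ?case using Suc(1)[of "Suc l" a] Suc(2,4) unfolding Y_def by simp
qed (use assms in auto)

text \<open>Here y R is a combination of the three coimages and R x one of the three images, with
  coefficients that depend triangularly on the products in question. Independence on the first three
  coordinates makes the coefficients vanish, and back substitution does the rest.\<close>

lemma op_prod_last_three:
  fixes u v :: "nat \<Rightarrow> nat \<Rightarrow> complex" and \<epsilon> :: complex
  assumes u: "det3 u \<noteq> 0" and v: "det3 v \<noteq> 0" and n: "3 \<le> n"
  defines "R \<equiv> op_prod n \<epsilon> [rank1 n 0 (u 0) (v 0), rank1 n 0 (u 1) (v 1), rank1 n 0 (u 2) (v 2)]"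
  shows "(\<And>b. b < n \<Longrightarrow> fun_mat n y R b = 0) \<Longrightarrow> i < 3 \<Longrightarrow> dot n y (u i) = 0"
    and "(\<And>a. a < n \<Longrightarrow> mat_fun n R x a = 0) \<Longrightarrow> i < 3 \<Longrightarrow> dot n (v i) x = 0"
proof -
  define R2 where "R2 = op_prod n \<epsilon> [rank1 n 0 (u 2) (v 2)]"
  define R1 where "R1 = op_prod n \<epsilon> [rank1 n 0 (u 1) (v 1), rank1 n 0 (u 2) (v 2)]"
  have c: "R2 \<in> carrier_mat n n" "R1 \<in> carrier_mat n n" unfolding R1_def R2_def by (auto intro: op_prod_carrier)
  have R: "R = rank1 n 0 (u 0) (v 0) + R1 + \<epsilon> \<cdot>\<^sub>m (rank1 n 0 (u 0) (v 0) * R1)"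
    "R1 = rank1 n 0 (u 1) (v 1) + R2 + \<epsilon> \<cdot>\<^sub>m (rank1 n 0 (u 1) (v 1) * R2)"
    by (simp_all add: R_def R1_def R2_def)
  have i: "i = 0 \<or> i = 1 \<or> i = 2" if "i < 3" using that by auto
  have l2: "fun_mat n y R2 b = dot n y (u 2) * v 2 b" if "b < n" for y b
    using that by (simp add: R2_def fun_mat_def dot_def sum_distrib_right mult.assoc)
  have l1: "fun_mat n y R1 b = dot n y (u 1) * v 1 b + (dot n y (u 2) + \<epsilon> * dot n y (u 1) * dot n (v 1) (u 2)) * v 2 b"
    if "b < n" for y b
    unfolding R(2) using that c by (simp add: fun_mat_op l2 algebra_simps)
  show "dot n y (u i) = 0" if y: "\<And>b. b < n \<Longrightarrow> fun_mat n y R b = 0" and "i < 3"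
  proof -
    have "dot n y (u 0) * v 0 b + (dot n y (u 1) + \<epsilon> * dot n y (u 0) * dot n (v 0) (u 1)) * v 1 b
       + (dot n y (u 2) + \<epsilon> * dot n y (u 1) * dot n (v 1) (u 2)
          + \<epsilon> * dot n y (u 0) * (dot n (v 0) (u 2) + \<epsilon> * dot n (v 0) (u 1) * dot n (v 1) (u 2))) * v 2 b = 0"
      if "b < 3" for b
    proof -
      have "b < n" using that n by simp
      from y[OF this] show ?thesis
        unfolding R(1) using c \<open>b < n\<close> by (simp add: fun_mat_op l1 algebra_simps)
    qed
    from det3_cramer[OF v this] have "dot n y (u 0) = 0" "dot n y (u 1) = 0" "dot n y (u 2) = 0" by auto
    with i[OF \<open>i < 3\<close>] show ?thesis by auto
  qed
  have r2: "mat_fun n R2 x a = u 2 a * dot n (v 2) x" if "a < n" for x a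
    using that by (simp add: R2_def mat_fun_rank1)
  have dot_cong: "dot n w f = dot n w g" if "\<And>a. a < n \<Longrightarrow> f a = g a" for w f g
    unfolding dot_def using that by (intro sum.cong) auto
  have dot_lin: "dot n w (\<lambda>a. f a * s + g a * t) = dot n w f * s + dot n w g * t" for w f g s t
    unfolding dot_def by (simp add: sum.distrib sum_distrib_left algebra_simps)
  have dot_smult: "dot n w (\<lambda>a. f a * s) = dot n w f * s" for w f s
    unfolding dot_def by (simp add: sum_distrib_right mult.assoc)
  have r1: "mat_fun n R1 x a = u 1 a * (dot n (v 1) x + \<epsilon> * dot n (v 1) (u 2) * dot n (v 2) x) + u 2 a * dot n (v 2) x"
    if "a < n" for x a
    unfolding R(2) using that c
    by (simp add: mat_fun_op r2 dot_cong[OF r2] dot_smult algebra_simps)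
  show "dot n (v i) x = 0" if x: "\<And>a. a < n \<Longrightarrow> mat_fun n R x a = 0" and "i < 3"
  proof -
    have "(dot n (v 0) x + \<epsilon> * (dot n (v 0) (u 1) * (dot n (v 1) x + \<epsilon> * dot n (v 1) (u 2) * dot n (v 2) x)
         + dot n (v 0) (u 2) * dot n (v 2) x)) * u 0 a
       + (dot n (v 1) x + \<epsilon> * dot n (v 1) (u 2) * dot n (v 2) x) * u 1 a + dot n (v 2) x * u 2 a = 0"
      if "a < 3" for a
    proof -
      have "a < n" using that n by simp
      have D: "dot n (v 0) (mat_fun n R1 x) = dot n (v 0) (u 1) * (dot n (v 1) x + \<epsilon> * dot n (v 1) (u 2) * dot n (v 2) x)
          + dot n (v 0) (u 2) * dot n (v 2) x"
        by (simp only: dot_cong[OF r1] dot_lin)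
      from x[OF \<open>a < n\<close>] show ?thesis
        unfolding R(1) using c \<open>a < n\<close> by (simp add: mat_fun_op r1 D algebra_simps)
    qed
    from det3_cramer[OF u this] have "dot n (v 0) x = 0" "dot n (v 1) x = 0" "dot n (v 2) x = 0" by auto
    with i[OF \<open>i < 3\<close>] show ?thesis by auto
  qed
qed

text \<open>If the minor does not vanish, then the last three images and coimages lie in the span of
  the others, so there are a vector \<open>x\<close> in all kernels and a covector \<open>y\<close>
  annihilating all images, and \<open>x y\<^sup>T\<close> is in the centralizer.\<close>

lemma last_minor_trivial_part:
  assumes n: "3 \<le> n" and As: "As \<in> trivial_part n (nil_variety \<epsilon> n (n + 2))"
  shows "last_minor \<epsilon> (n + 2) As = 0"
proof (rule ccontr)
  assume minor: "last_minor \<epsilon> (n + 2) As \<noteq> 0"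
  have As': "length As = n + 2" "set As \<subseteq> nilclass \<epsilon> n" "op_prod n \<epsilon> (map (shift n \<epsilon>) As) = 0\<^sub>m n n"
    and triv: "trivial_centralizer n As"
    using As by (auto simp: trivial_part_def nil_variety_def)
  have "\<exists>u v. As ! i = rank1 n \<epsilon> u v \<and> dot n v u = 0" if "i < n + 2" for i
    proof -
    have "As ! i \<in> nilclass \<epsilon> n" using As'(1,2) that by (metis nth_mem subsetD)
    moreover have "2 \<le> n" using n by simp
    ultimately show ?thesis by (metis nilclassE)
  qed
  then obtain u v where uv: "\<And>i. i < n + 2 \<Longrightarrow> As ! i = rank1 n \<epsilon> (u i) (v i)"
    "\<And>i. i < n + 2 \<Longrightarrow> dot n (v i) (u i) = 0" by metis
  \<comment> \<open>The number of matrices before the last three; being n - 1, it guarantees the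
    vectors \<open>x\<close> and \<open>y\<close> below.\<close>
  define m where "m = n - 1"
  have m: "n + 2 = m + 3" "m < n" "n = m + 1" using n by (auto simp: m_def)
  define Ms where "Ms = [rank1 n 0 (u m) (v m), rank1 n 0 (u (m + 1)) (v (m + 1)), rank1 n 0 (u (m + 2)) (v (m + 2))]"
  have "As = map (\<lambda>i. rank1 n \<epsilon> (u i) (v i)) [0..<n + 2]"
    using As'(1) uv(1) by (intro nth_equalityI) (auto simp del: upt_Suc)
  then have "map (shift n \<epsilon>) As = map (\<lambda>i. rank1 n 0 (u i) (v i)) [0..<n + 2]" by simp
  also have "[0..<n + 2] = [0..<m] @ [m, m + 1, m + 2]" unfolding m(1) by (simp add: numeral_3_eq_3)
  finally have split: "map (shift n \<epsilon>) As = map (\<lambda>i. rank1 n 0 (u i) (v i)) [0..<m] @ Ms"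
    by (simp add: Ms_def)
  have Ms: "set Ms \<subseteq> carrier_mat n n" by (auto simp: Ms_def)
  have "last_minor \<epsilon> (n + 2) As = det3 (\<lambda>a b. u (m + 0) a * v (m + 0) b + u (m + 1) a * v (m + 1) b + u (m + 2) a * v (m + 2) b)"
    unfolding last_minor_def
  proof (rule det3_cong)
    fix a b :: nat assume "a < 3" "b < 3"
    then have ab: "a < n" "b < n" using n by simp_all
    have q: "n + 2 - 3 = m" "n + 2 - 2 = m + 1" "n + 2 - 1 = m + 2" using m(1) by linarith+
    have "m < n + 2" "m + 1 < n + 2" "m + 2 < n + 2" using m(1) by linarith+
    then show "(As ! (n + 2 - 3)) $$ (a, b) + (As ! (n + 2 - 2)) $$ (a, b) + (As ! (n + 2 - 1)) $$ (a, b)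
        + (if a = b then - 3 * \<epsilon> else 0) = u (m + 0) a * v (m + 0) b + u (m + 1) a * v (m + 1) b + u (m + 2) a * v (m + 2) b"
      unfolding q using uv(1) ab by simp
  qed
  also have "\<dots> = det3 (\<lambda>i. u (m + i)) * det3 (\<lambda>i. v (m + i))"
    by (rule det3_mult[of "\<lambda>i. u (m + i)" "\<lambda>i. v (m + i)"])
  finally have d: "det3 (\<lambda>i. u (m + i)) \<noteq> 0" "det3 (\<lambda>i. v (m + i)) \<noteq> 0" using minor by auto
  have c: "card {..<m} < card {..<n}" using m by simp
  obtain y where y: "\<exists>a<n. y a \<noteq> 0" "\<And>i. i < m \<Longrightarrow> dot n y (u i) = 0"
    using homogeneous_solution[OF finite_lessThan finite_lessThan c, of u] by (auto simp: dot_def mult.commute)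
  obtain x where x: "\<exists>a<n. x a \<noteq> 0" "\<And>i. i < m \<Longrightarrow> dot n (v i) x = 0"
    using homogeneous_solution[OF finite_lessThan finite_lessThan c, of v] by (auto simp: dot_def)
  have R0: "op_prod n \<epsilon> (map (\<lambda>i. rank1 n 0 (u i) (v i)) [0..<m] @ Ms) = 0\<^sub>m n n"
    using As'(3) unfolding split .
  have "fun_mat n y (op_prod n \<epsilon> Ms) b = 0" if "b < n" for b
    using left_kernel_op_prod[of m n y u b _ \<epsilon> Ms v 0, OF y(2) that refl Ms] that
    unfolding R0 by (simp add: fun_mat_def)
  then have yM: "dot n y (u (m + i)) = 0" if "i < 3" for i
    using op_prod_last_three(1)[OF d n, of y \<epsilon> i] that by (simp add: Ms_def)
  have "mat_fun n (op_prod n \<epsilon> Ms) x a = 0" if "a < n" for a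
  proof (rule right_kernel_op_prod[OF x(2) _ Ms _ that])
    show "dot n (v i) (u i) = 0" if "i < m" for i using uv(2) that m by simp
    show "mat_fun n (op_prod n \<epsilon> (map (\<lambda>i. rank1 n 0 (u i) (v i)) [0..<m] @ Ms)) x a = 0" if "a < n" for a
      unfolding R0 using that by (simp add: mat_fun_def)
  qed
  then have xM: "dot n (v (m + i)) x = 0" if "i < 3" for i
    using op_prod_last_three(2)[OF d n, of \<epsilon> x i] that by (simp add: Ms_def)
  have y: "dot n y (u i) = 0" and x: "dot n (v i) x = 0" if "i < n + 2" for i
    using y(2) x(2) yM[of "i - m"] xM[of "i - m"] that m by (cases "i < m"; simp)+
  note yx = this
  define X where "X = rank1 n 0 x y"
  have "X * As ! i = As ! i * X" if i: "i < n + 2" for i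
  proof -
    have XA: "X \<in> carrier_mat n n" by (simp add: X_def)
    have Xu: "mat_fun n X (u i) a = 0" if "a < n" for a
      using that yx(1)[OF i] unfolding X_def by (simp add: mat_fun_rank1)
    have vX: "fun_mat n (v i) X b = 0" if "b < n" for b
    proof -
      have "fun_mat n (v i) X b = dot n (v i) x * y b"
        unfolding fun_mat_def dot_def X_def using that by (simp add: sum_distrib_right mult.assoc)
      then show ?thesis using yx(2)[OF i] by simp
    qed
    show ?thesis unfolding uv(1)[OF i]
      using XA by (intro eq_matI) (auto simp: mult_rank1_index[OF XA] rank1_mult_index[OF XA] Xu vX simp del: index_mult_mat(1))
  qed
  then have "X \<in> centralizer n As"
    using As'(1) by (auto simp: centralizer_def X_def in_set_conv_nth)
  then obtain s where s: "X = s \<cdot>\<^sub>m 1\<^sub>m n" using triv by (auto simp: trivial_centralizer_def)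
  \<comment> \<open>A nonzero matrix of rank one is not scalar in size at least 2.\<close>
  have X: "x a * y b = (if a = b then s else 0)" if "a < n" "b < n" for a b
    using arg_cong[OF s, of "\<lambda>M. M $$ (a, b)"] that by (simp add: X_def split: if_splits)
  obtain a where a: "a < n" "x a \<noteq> 0"
    using \<open>\<exists>a<n. x a \<noteq> 0\<close> by blast
  obtain b where b: "b < n" "y b \<noteq> 0"
    using \<open>\<exists>a<n. y a \<noteq> 0\<close> by blast
  have "a = b" using X[OF a(1) b(1)] a b by (auto split: if_splits)
  define c where "c = (if a = 0 then 1 else 0 :: nat)"
  have c: "c < n" "c \<noteq> a" using n by (auto simp: c_def)
  have "y c = 0" using X[OF a(1) c(1)] a c by auto
  then have "s = 0" using X[OF c(1) c(1)] by simp
  then show False using X[OF a(1) b(1)] a b by auto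
qed

text \<open>Commutation says (Y u) v^T = u (v^T Y). Comparing at nonzero entries of \<open>u\<close>
  and \<open>v\<close> shows that both are eigenvectors, with one common eigenvalue.\<close>

lemma commute_rank1_eigen:
  assumes Y: "Y \<in> carrier_mat n n" and comm: "Y * rank1 n \<epsilon> u v = rank1 n \<epsilon> u v * Y"
    and u: "\<exists>a<n. u a \<noteq> 0" and v: "\<exists>a<n. v a \<noteq> 0"
  obtains \<mu> where "\<And>a. a < n \<Longrightarrow> mat_fun n Y u a = \<mu> * u a" "\<And>b. b < n \<Longrightarrow> fun_mat n v Y b = \<mu> * v b"
proof -
  have eq: "mat_fun n Y u a * v b = u a * fun_mat n v Y b" if "a < n" "b < n" for a b
    using arg_cong[OF comm, of "\<lambda>M. M $$ (a, b)"] that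
    by (simp add: mult_rank1_index[OF Y] rank1_mult_index[OF Y] del: index_mult_mat(1))
  obtain a0 where a0: "a0 < n" "u a0 \<noteq> 0" using u by blast
  obtain b0 where b0: "b0 < n" "v b0 \<noteq> 0" using v by blast
  define \<mu> where "\<mu> = mat_fun n Y u a0 / u a0"
  have v': "fun_mat n v Y b = \<mu> * v b" if "b < n" for b
    using eq[OF a0(1) that] a0(2) by (simp add: \<mu>_def field_simps)
  have "mat_fun n Y u a = \<mu> * u a" if "a < n" for a
    using eq[OF that b0(1)] v'[OF b0(1)] b0(2) by (simp add: field_simps)
  then show thesis using v' that by blast
qed

text \<open>The first \<open>n\<close> matrices share the coimage e_0, which annihilates all their
  images, so products vanish and only the sum of the images counts; the last two cancel each other.
  A commuting matrix scales e_1, ..., e_(n-1) by the eigenvalue of the covector e_0, and the coimage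
  e_1 with image e_0 makes e_0 an eigenvector for the same eigenvalue.\<close>

lemma trivial_part_nonempty:
  assumes n: "2 \<le> n" shows "trivial_part n (nil_variety \<epsilon> n (n + 2)) \<noteq> {}"
proof -
  \<comment> \<open>\<open>s n\<close> makes the images add up to zero; the other \<open>s k\<close>
    describe the product of the tail starting at index \<open>k\<close>, as needed for the
    induction.\<close>
  define s where "s k a = (if 1 \<le> a \<and> a < k then - 1 else 0 :: complex)" for k a :: nat
  define As where "As = map (\<lambda>l. rank1 n \<epsilon> (kron l) (kron 0)) [1..<n] @
    [rank1 n \<epsilon> (s n) (kron 0), rank1 n \<epsilon> (kron 0) (kron 1), rank1 n \<epsilon> (\<lambda>a. - kron 0 a) (kron 1)]"
  have dot0: "dot n (kron i) f = (if i < n then f i else 0)" for i f by (simp add: dot_def)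
  have in_class: "rank1 n \<epsilon> u (kron i) \<in> nilclass \<epsilon> n" if "i < n" "u i = 0" "a < n" "u a \<noteq> 0" for u i a
    using that by (intro nilclassI(1)) (auto simp: dot0 intro: exI[of _ i])
  have "set As \<subseteq> nilclass \<epsilon> n"
    using n in_class[of 0 "s n" 1] in_class[of 1 "kron 0" 0] in_class[of 1 "\<lambda>a. - kron 0 a" 0]
      in_class[of 0 "kron _" _] unfolding As_def
    by (auto simp: s_def)
  moreover have "op_prod n \<epsilon> (map (shift n \<epsilon>) As) = 0\<^sub>m n n"
  proof -
    let ?T = "[rank1 n 0 (kron 0) (kron 1), rank1 n 0 (\<lambda>a. - kron 0 a) (kron 1)]"
    have "op_prod n \<epsilon> ?T = 0\<^sub>m n n"
      using n by (intro eq_matI) (auto simp: op_index fun_mat_rank1 dot0 kron_def simp del: index_add_mat(1) index_mult_mat(1))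
    then have S: "op_prod n \<epsilon> (rank1 n 0 (s n) (kron 0) # ?T) = rank1 n 0 (s n) (kron 0)"
      by (simp only: op_prod_Cons) (intro eq_matI, auto)
    have "op_prod n \<epsilon> (map (\<lambda>l. rank1 n 0 (kron l) (kron 0)) [k..<n] @ rank1 n 0 (s n) (kron 0) # ?T)
        = rank1 n 0 (s k) (kron 0)" if "1 \<le> k" "k \<le> n" for k
      using that
    proof (induction "n - k" arbitrary: k)
      case 0
      then show ?case using S by simp
    next
      case (Suc d)
      then have "op_prod n \<epsilon> (map (\<lambda>l. rank1 n 0 (kron l) (kron 0)) [Suc k..<n] @ rank1 n 0 (s n) (kron 0) # ?T)
        = rank1 n 0 (s (Suc k)) (kron 0)" by auto
      moreover have "[k..<n] = k # [Suc k..<n]" using Suc by (simp add: upt_conv_Cons)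
      moreover have "rank1 n 0 (kron k) (kron 0) + rank1 n 0 (s (Suc k)) (kron 0) +
         \<epsilon> \<cdot>\<^sub>m (rank1 n 0 (kron k) (kron 0) * rank1 n 0 (s (Suc k)) (kron 0)) = rank1 n 0 (s k) (kron 0)"
      proof (rule eq_matI)
        fix a b assume "a < dim_row (rank1 n 0 (s k) (kron 0))" "b < dim_col (rank1 n 0 (s k) (kron 0))"
        then have ab: "a < n" "b < n" by simp_all
        have "fun_mat n (kron 0) (rank1 n 0 (s (Suc k)) (kron 0)) b = 0"
          using ab n by (simp add: fun_mat_rank1 dot0 s_def)
        then show "(rank1 n 0 (kron k) (kron 0) + rank1 n 0 (s (Suc k)) (kron 0) +
         \<epsilon> \<cdot>\<^sub>m (rank1 n 0 (kron k) (kron 0) * rank1 n 0 (s (Suc k)) (kron 0))) $$ (a, b) = rank1 n 0 (s k) (kron 0) $$ (a, b)"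
          using ab Suc(3) by (auto simp: op_index s_def kron_def simp del: index_add_mat(1) index_mult_mat(1))
      qed auto
      ultimately show ?case by simp
    qed
    from this[of 1] n have "op_prod n \<epsilon> (map (\<lambda>l. rank1 n 0 (kron l) (kron 0)) [1..<n] @ rank1 n 0 (s n) (kron 0) # ?T)
        = rank1 n 0 (s 1) (kron 0)" by simp
    also have "\<dots> = 0\<^sub>m n n" by (intro eq_matI) (auto simp: s_def)
    finally show ?thesis by (simp add: As_def comp_def)
  qed
  moreover have "trivial_centralizer n As"
    unfolding trivial_centralizer_def
  proof
    fix Y assume "Y \<in> centralizer n As"
    then have Y: "Y \<in> carrier_mat n n" and comm: "\<And>A. A \<in> set As \<Longrightarrow> Y * A = A * Y"
      by (auto simp: centralizer_def)
    have m: "mat_fun n Y (kron i) a = Y $$ (a, i)" and f: "fun_mat n (kron i) Y a = Y $$ (i, a)" if "i < n" for i a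
      using that by (simp_all add: mat_fun_def fun_mat_def)
    have k: "\<exists>a<n. kron i a \<noteq> 0" if "i < n" for i using that by (intro exI[of _ i]) simp
    have n0: "0 < n" "1 < n" using n by auto
    have Yl: "Y $$ (a, l) = Y $$ (0, 0) * kron l a" if l: "1 \<le> l" "l < n" "a < n" for a l
    proof -
      have mem: "rank1 n \<epsilon> (kron l) (kron 0) \<in> set As" using l by (auto simp: As_def)
      obtain \<mu>
        where \<mu>: "\<And>a. a < n \<Longrightarrow> mat_fun n Y (kron l) a = \<mu> * kron l a" "\<And>b. b < n \<Longrightarrow> fun_mat n (kron 0) Y b = \<mu> * kron 0 b"
        using commute_rank1_eigen[OF Y comm[OF mem] k[OF l(2)] k[OF n0(1)]] by metis
      show ?thesis using \<mu>(1)[OF l(3)] \<mu>(2)[of 0] l n by (simp add: m f)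
    qed
    have Y0: "Y $$ (a, 0) = Y $$ (0, 0) * kron 0 a" if "a < n" for a
    proof -
      have mem: "rank1 n \<epsilon> (kron 0) (kron 1) \<in> set As" by (auto simp: As_def)
      obtain \<mu> where \<mu>: "\<And>a. a < n \<Longrightarrow> mat_fun n Y (kron 0) a = \<mu> * kron 0 a"
        using commute_rank1_eigen[OF Y comm[OF mem] k[OF n0(1)] k[OF n0(2)]] by metis
      show ?thesis using \<mu>[OF that] \<mu>[of 0] that n by (simp add: m)
    qed
    have "Y = Y $$ (0, 0) \<cdot>\<^sub>m 1\<^sub>m n"
    proof (rule eq_matI)
      fix a b assume "a < dim_row (Y $$ (0, 0) \<cdot>\<^sub>m 1\<^sub>m n)" "b < dim_col (Y $$ (0, 0) \<cdot>\<^sub>m 1\<^sub>m n)"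
      then have ab: "a < n" "b < n" by simp_all
      then show "Y $$ (a, b) = (Y $$ (0, 0) \<cdot>\<^sub>m 1\<^sub>m n) $$ (a, b)"
        using Yl[of b a] Y0[of a] by (cases "b = 0") (auto simp: kron_def)
    qed (use Y in auto)
    then show "Y \<in> range (\<lambda>a. a \<cdot>\<^sub>m 1\<^sub>m n)" by blast
  qed
  moreover have "length As = n + 2" using n by (simp add: As_def)
  ultimately have "As \<in> trivial_part n (nil_variety \<epsilon> n (n + 2))"
    by (simp add: trivial_part_def nil_variety_def)
  then show ?thesis by blast
qed

section \<open>The stratum\<close>

lemma diag_block_mat_pair:
  "diag_block_mat [C, D] = four_block_mat C (0\<^sub>m (dim_row C) (dim_col D)) (0\<^sub>m (dim_row D) (dim_col C)) D"
  by (simp only: diag_block_mat.simps(2)[of C "[D]"] diag_block_mat_singleton Let_def)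

lemma conj_mult:
  assumes P: "(P :: complex mat) \<in> carrier_mat n n" "Q \<in> carrier_mat n n" "Q * P = 1\<^sub>m n"
    and A: "A \<in> carrier_mat n n" "B \<in> carrier_mat n n"
  shows "(P * A * Q) * (P * B * Q) = P * (A * B) * Q"
proof -
  have "P * B * Q = P * (B * Q)" using P A by (intro assoc_mult_mat[of _ n n _ n _ n]) auto
  then have "Q * (P * B * Q) = (Q * P) * (B * Q)"
    using P A assoc_mult_mat[of Q n n P n "B * Q" n] by auto
  also have "\<dots> = B * Q" using P A by simp
  finally have *: "Q * (P * B * Q) = B * Q" .
  have "P * A * Q * (P * B * Q) = P * A * (Q * (P * B * Q))"
    using P A by (intro assoc_mult_mat[of _ n n _ n _ n]) auto
  also have "\<dots> = P * A * (B * Q)" unfolding * ..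
  also have "P * A * (B * Q) = P * A * B * Q"
    using P A by (intro assoc_mult_mat[of _ n n _ n _ n, symmetric]) auto
  also have "P * A * B = P * (A * B)" using P A by (intro assoc_mult_mat[of _ n n _ n _ n]) auto
  finally show ?thesis .
qed

text \<open>The projection onto the first block, carried over by the conjugation, commutes with the
  tuple; it is not scalar because both blocks have positive size.\<close>

lemma decomposable_nontrivial_centralizer:
  assumes kl: "0 < k" "0 < l" and q: "0 < q"
    and Cs: "Cs \<in> tuples k q" and Ds: "Ds \<in> tuples l q" and Bs: "Bs \<in> tuples m q"
    and conj: "simult_conj Bs (block_diag q [Cs, Ds])"
  shows "\<not> trivial_centralizer m Bs"
proof
  assume triv: "trivial_centralizer m Bs"
  obtain P Q where "\<forall>i<length Bs. similar_mat_wit (Bs ! i) (block_diag q [Cs, Ds] ! i) P Q"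
    using conj unfolding simult_conj_def by blast
  then have PQ: "similar_mat_wit (Bs ! i) (diag_block_mat [Cs ! i, Ds ! i]) P Q" if "i < q" for i
    using that Bs by (simp add: block_diag_def tuples_def del: diag_block_mat.simps)
  have C: "Cs ! i \<in> carrier_mat k k" and D: "Ds ! i \<in> carrier_mat l l" if "i < q" for i
    using that Cs Ds by (auto simp: tuples_def)
  have B: "Bs ! i \<in> carrier_mat m m" if "i < q" for i
    using that Bs by (auto simp: tuples_def)
  let ?E = "four_block_mat (1\<^sub>m k) (0\<^sub>m k l) (0\<^sub>m l k) (0\<^sub>m l l) :: complex mat"
  have diag: "diag_block_mat [Cs ! i, Ds ! i] = four_block_mat (Cs ! i) (0\<^sub>m k l) (0\<^sub>m l k) (Ds ! i)"
    if "i < q" for i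
    using C[OF that] D[OF that] by (simp only: diag_block_mat_pair carrier_matD)
  have diag_c: "diag_block_mat [Cs ! i, Ds ! i] \<in> carrier_mat (k + l) (k + l)" if "i < q" for i
    unfolding diag[OF that] using C[OF that] D[OF that] by simp
  note w = similar_mat_witD_right[OF PQ diag_c]
  have m: "m = k + l" using w(1)[OF q q] B[OF q] by auto
  have P: "P \<in> carrier_mat m m" "Q \<in> carrier_mat m m" "P * Q = 1\<^sub>m m" "Q * P = 1\<^sub>m m"
    unfolding m using w(2-5)[OF q q] by auto
  have E: "?E \<in> carrier_mat m m" unfolding m by simp
  define X where "X = P * ?E * Q"
  have X: "X \<in> carrier_mat m m" using P E by (auto simp: X_def)
  have "X * Bs ! i = Bs ! i * X" if i: "i < q" for i
  proof -
    let ?D = "diag_block_mat [Cs ! i, Ds ! i]"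
    have Dm: "?D \<in> carrier_mat m m" unfolding m by (rule diag_c[OF i])
    have ED: "?E * ?D = ?D * ?E"
      unfolding diag[OF i] using C[OF i] D[OF i]
      by (subst (1 2) mult_four_block_mat[of _ k k _ l _ l _ _ k _ l]) auto
    note cancel = conj_mult[OF P(1,2,4)]
    have "Bs ! i = P * ?D * Q" using w(6)[OF i i] .
    then show ?thesis unfolding X_def using cancel[OF E Dm] cancel[OF Dm E] ED by simp
  qed
  then have "X \<in> centralizer m Bs"
    using X Bs by (auto simp: centralizer_def in_set_conv_nth tuples_def)
  then obtain a where a: "X = a \<cdot>\<^sub>m 1\<^sub>m m" using triv by (auto simp: trivial_centralizer_def)
  have "Q * X * P = (Q * P) * ?E * (Q * P)"
    unfolding X_def using P(1,2) E by (simp add: assoc_mult_mat[of _ m m _ m _ m])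
  also have "\<dots> = ?E" unfolding P(4) left_mult_one_mat[OF E] right_mult_one_mat[OF E] ..
  also have "Q * X * P = a \<cdot>\<^sub>m 1\<^sub>m m"
  proof -
    have "Q * (a \<cdot>\<^sub>m 1\<^sub>m m) = a \<cdot>\<^sub>m Q"
      using mult_smult_distrib[OF P(2) one_carrier_mat, of a] P(2) by simp
    then show ?thesis unfolding a using mult_smult_assoc_mat[OF P(2,1)] P(4) by simp
  qed
  finally have *: "a \<cdot>\<^sub>m 1\<^sub>m m = ?E" .
  have "a = 1" using arg_cong[OF *, of "\<lambda>M. M $$ (0, 0)"] kl m by simp
  moreover have "a = 0" using arg_cong[OF *, of "\<lambda>M. M $$ (k, k)"] kl m by simp
  ultimately show False by simp
qed

lemma indecomposable_if_trivial_centralizer: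
  assumes "0 < m" "0 < q" "Bs \<in> tuples m q" "trivial_centralizer m Bs"
  shows "indecomposable m q Bs"
  unfolding indecomposable_def
  using assms decomposable_nontrivial_centralizer by blast

definition scalar_tuple :: "complex \<Rightarrow> nat \<Rightarrow> complex mat list" where
  "scalar_tuple \<epsilon> q = replicate q (mat 1 1 (\<lambda>_. \<epsilon>))"

lemma scalar_tuple_trivial: "trivial_centralizer 1 (scalar_tuple \<epsilon> q)"
  unfolding trivial_centralizer_def
proof
  fix X assume "X \<in> centralizer 1 (scalar_tuple \<epsilon> q)"
  then have "X \<in> carrier_mat 1 1" by (simp add: centralizer_def)
  then have "X = X $$ (0, 0) \<cdot>\<^sub>m 1\<^sub>m 1" by (intro eq_matI) auto
  then show "X \<in> range (\<lambda>a. a \<cdot>\<^sub>m 1\<^sub>m 1)" by blast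
qed

definition stratum_type :: "complex \<Rightarrow> nat \<Rightarrow> nat \<Rightarrow> block_type multiset" where
  "stratum_type \<epsilon> k q = {#(k, replicate q (nilclass \<epsilon> k), True), block_type 1 (scalar_tuple \<epsilon> q)#}"

lemma has_type_stratum_type:
  assumes k: "0 < k" and q: "0 < q" and Bs: "Bs \<in> tuples k q" "trivial_centralizer k Bs"
    and cls: "\<And>B. B \<in> set Bs \<Longrightarrow> conj_class B = nilclass \<epsilon> k"
    and conj: "simult_conj As (block_diag q [Bs, scalar_tuple \<epsilon> q])"
  shows "has_type q As (stratum_type \<epsilon> k q)"
proof -
  have s: "scalar_tuple \<epsilon> q \<in> tuples 1 q" by (auto simp: scalar_tuple_def tuples_def)
  have "map conj_class Bs = replicate q (nilclass \<epsilon> k)"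
    using cls Bs(1) by (intro nth_equalityI) (auto simp: tuples_def)
  then have "block_type k Bs = (k, replicate q (nilclass \<epsilon> k), True)"
    using Bs(2) by (simp add: block_type_def)
  then show ?thesis
    unfolding has_type_def stratum_type_def
    using indecomposable_if_trivial_centralizer[OF k q Bs]
      indecomposable_if_trivial_centralizer[OF _ q s scalar_tuple_trivial] conj
    by (intro exI[of _ "[(k, Bs), (1, scalar_tuple \<epsilon> q)]"]) simp
qed

lemma stratum_type_nontrivial_centralizer:
  assumes q: "0 < q" and As: "As \<in> tuples n q" and type: "has_type q As (stratum_type \<epsilon> k q)"
  shows "\<not> trivial_centralizer n As"
proof -
  obtain blocks where blocks: "\<And>m Bs. (m, Bs) \<in> set blocks \<Longrightarrow> indecomposable m q Bs"
    "simult_conj As (block_diag q (map snd blocks))"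
    "stratum_type \<epsilon> k q = mset (map (\<lambda>(m, Bs). block_type m Bs) blocks)"
    using type unfolding has_type_def by blast
  have "length blocks = 2"
    using arg_cong[OF blocks(3), of size] by (simp add: stratum_type_def)
  then obtain m Cs l Ds where b: "blocks = [(m, Cs), (l, Ds)]"
    by (auto simp: numeral_2_eq_2 length_Suc_conv)
  have "indecomposable m q Cs" "indecomposable l q Ds" using blocks(1) b by auto
  then show ?thesis
    using blocks(2) b decomposable_nontrivial_centralizer[of m l q Cs Ds As n] q As
    by (simp add: indecomposable_def)
qed

text \<open>Each member gives an eigenvalue of Y, and evaluating v_i Y u_j in two ways shows that
  members with v_i . u_j nonzero have the same one. The last three are linked to each other and
  every other member to one of them, so the first \<open>k\<close> coimages, which form a basis, are
  eigenvectors for a single eigenvalue.\<close>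

lemma trivial_centralizer_rank1:
  assumes q: "q = k + 3" and As: "As = map (\<lambda>i. rank1 k \<epsilon> (u i) (v i)) [0..<q]"
    and u: "\<And>i. i < q \<Longrightarrow> \<exists>a<k. u i a \<noteq> 0" and v: "\<And>i. i < q \<Longrightarrow> \<exists>a<k. v i a \<noteq> 0"
    and V: "det (mat k k (\<lambda>(i, c). v i c)) \<noteq> 0"
    and last: "dot k (v (k + 1)) (u k) \<noteq> 0" "dot k (v (k + 2)) (u (k + 1)) \<noteq> 0"
    and conn: "\<And>i. i < k \<Longrightarrow> \<exists>j\<in>{k, k + 1, k + 2}. dot k (v j) (u i) \<noteq> 0"
  shows "trivial_centralizer k As"
  unfolding trivial_centralizer_def
proof
  fix Y assume "Y \<in> centralizer k As"
  then have Y: "Y \<in> carrier_mat k k" and comm: "\<And>A. A \<in> set As \<Longrightarrow> Y * A = A * Y"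
    by (auto simp: centralizer_def)
  have "\<exists>\<mu>. (\<forall>a<k. mat_fun k Y (u i) a = \<mu> * u i a) \<and> (\<forall>b<k. fun_mat k (v i) Y b = \<mu> * v i b)" if i: "i < q" for i
  proof -
    have mem: "rank1 k \<epsilon> (u i) (v i) \<in> set As" using i by (auto simp: As)
    show ?thesis using commute_rank1_eigen[OF Y comm[OF mem] u[OF i] v[OF i]] by metis
  qed
  then obtain \<mu> where mu: "\<And>i a. i < q \<Longrightarrow> a < k \<Longrightarrow> mat_fun k Y (u i) a = \<mu> i * u i a"
    "\<And>i b. i < q \<Longrightarrow> b < k \<Longrightarrow> fun_mat k (v i) Y b = \<mu> i * v i b" by metis
  have eq: "\<mu> i = \<mu> j" if ij: "i < q" "j < q" "dot k (v i) (u j) \<noteq> 0" for i j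
  proof -
    have "\<mu> i * dot k (v i) (u j) = (\<Sum>b<k. fun_mat k (v i) Y b * u j b)"
      unfolding dot_def sum_distrib_left using mu(2)[OF ij(1)] by (intro sum.cong) auto
    also have "\<dots> = (\<Sum>b<k. \<Sum>c<k. v i c * Y $$ (c, b) * u j b)"
      by (simp add: fun_mat_def sum_distrib_right)
    also have "\<dots> = (\<Sum>c<k. \<Sum>b<k. v i c * Y $$ (c, b) * u j b)" by (rule sum.swap)
    also have "\<dots> = (\<Sum>c<k. v i c * mat_fun k Y (u j) c)"
      by (simp add: mat_fun_def sum_distrib_left mult.assoc)
    also have "\<dots> = \<mu> j * dot k (v i) (u j)"
      unfolding dot_def sum_distrib_left using mu(1)[OF ij(2)] by (intro sum.cong) auto
    finally show ?thesis using ij(3) by simp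
  qed
  have e: "\<mu> (k + 1) = \<mu> k" "\<mu> (k + 2) = \<mu> (k + 1)" using eq last q by auto
  have mu_k: "\<mu> i = \<mu> k" if i: "i < k" for i
  proof -
    obtain j where j: "j \<in> {k, k + 1, k + 2}" "dot k (v j) (u i) \<noteq> 0" using conn[OF i] by blast
    have "\<mu> j = \<mu> i" using eq[of j i] j i q by auto
    with j(1) e show ?thesis by auto
  qed
  let ?V = "mat k k (\<lambda>(i, c). v i c)"
  obtain W where W: "W \<in> carrier_mat k k" "W * ?V = 1\<^sub>m k" using inverse_mat_exists[OF mat_carrier V] by blast
  have VY: "?V * Y = \<mu> k \<cdot>\<^sub>m ?V"
  proof (rule eq_matI)
    fix i b assume "i < dim_row (\<mu> k \<cdot>\<^sub>m ?V)" "b < dim_col (\<mu> k \<cdot>\<^sub>m ?V)"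
    then have ib: "i < k" "b < k" by simp_all
    have "(?V * Y) $$ (i, b) = fun_mat k (v i) Y b"
      using ib Y by (subst index_mult_mat_sum[of _ k]) (auto simp: fun_mat_def)
    then show "(?V * Y) $$ (i, b) = (\<mu> k \<cdot>\<^sub>m ?V) $$ (i, b)"
      using mu(2)[of i b] mu_k[of i] ib q by simp
  qed (use Y in auto)
  have "Y = (W * ?V) * Y" using W Y by simp
  also have "\<dots> = W * (?V * Y)" using W Y by (intro assoc_mult_mat) auto
  also have "\<dots> = \<mu> k \<cdot>\<^sub>m (W * ?V)" unfolding VY using W(1) by (intro mult_smult_distrib[of _ k k]) auto
  finally have "Y = \<mu> k \<cdot>\<^sub>m 1\<^sub>m k" using W(2) by simp
  then show "Y \<in> range (\<lambda>a. a \<cdot>\<^sub>m 1\<^sub>m k)" by blast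
qed

section \<open>Conjugation\<close>

lemma fun_mat_mult:
  assumes "(A :: complex mat) \<in> carrier_mat n n" "B \<in> carrier_mat n n" "b < n"
  shows "fun_mat n v (A * B) b = fun_mat n (fun_mat n v A) B b"
proof -
  have "fun_mat n v (A * B) b = (\<Sum>c<n. \<Sum>d<n. v c * A $$ (c, d) * B $$ (d, b))"
    unfolding fun_mat_def using assms
    by (intro sum.cong) (auto simp: index_mult_mat_sum sum_distrib_left mult.assoc simp del: index_mult_mat(1))
  also have "\<dots> = (\<Sum>d<n. \<Sum>c<n. v c * A $$ (c, d) * B $$ (d, b))" by (rule sum.swap)
  finally show ?thesis by (simp add: fun_mat_def sum_distrib_right)
qed

lemma op_prod_conj:
  assumes P: "P \<in> carrier_mat n n" "Q \<in> carrier_mat n n" "Q * P = 1\<^sub>m n"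
    and Ns: "set Ns \<subseteq> carrier_mat n n"
  shows "op_prod n \<epsilon> (map (\<lambda>N. P * N * Q) Ns) = P * op_prod n \<epsilon> Ns * Q"
  using Ns
proof (induction Ns)
  case Nil
  show ?case using P by simp
next
  case (Cons N Ns)
  define Y where "Y = op_prod n \<epsilon> Ns"
  have N: "N \<in> carrier_mat n n" and Y: "Y \<in> carrier_mat n n"
    using Cons.prems by (auto simp: Y_def intro: op_prod_carrier)
  have NY: "(P * N * Q) * (P * Y * Q) = P * (N * Y) * Q" using P N Y by (rule conj_mult)
  have "P * (N + Y + \<epsilon> \<cdot>\<^sub>m (N * Y)) * Q = (P * (N + Y) + P * (\<epsilon> \<cdot>\<^sub>m (N * Y))) * Q"
    using P N Y by (subst mult_add_distrib_mat[of P n n]) auto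
  also have "\<dots> = (P * N + P * Y + \<epsilon> \<cdot>\<^sub>m (P * (N * Y))) * Q"
    using P N Y mult_smult_distrib[of P n n "N * Y" n \<epsilon>] mult_add_distrib_mat[of P n n N n Y] by auto
  also have "\<dots> = P * N * Q + P * Y * Q + \<epsilon> \<cdot>\<^sub>m (P * (N * Y) * Q)"
    using P N Y mult_smult_assoc_mat[of "P * (N * Y)" n n Q n \<epsilon>]
      add_mult_distrib_mat[of "P * N + P * Y" n n "\<epsilon> \<cdot>\<^sub>m (P * (N * Y))" Q n]
      add_mult_distrib_mat[of "P * N" n n "P * Y" Q n] by auto
  finally show ?case using Cons NY by (simp add: Y_def)
qed

section \<open>Matrices of the form 1 + M with M^2 = 0\<close>

definition elem_mat :: "nat \<Rightarrow> (nat \<Rightarrow> nat \<Rightarrow> complex) \<Rightarrow> complex mat" where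
  "elem_mat n M = mat n n (\<lambda>(a, b). (if a = b then 1 else 0) + M a b)"

lemma elem_mat_carrier [simp]: "elem_mat n M \<in> carrier_mat n n"
  by (simp add: elem_mat_def)

lemma mat_fun_elem_mat: "a < n \<Longrightarrow> mat_fun n (elem_mat n M) u a = u a + (\<Sum>c<n. M a c * u c)"
  by (simp add: mat_fun_def elem_mat_def distrib_right sum.distrib if_distrib[of "\<lambda>x. x * _"] cong: if_cong)

lemma fun_mat_elem_mat: "b < n \<Longrightarrow> fun_mat n v (elem_mat n M) b = v b + (\<Sum>c<n. v c * M c b)"
  by (simp add: fun_mat_def elem_mat_def distrib_left sum.distrib if_distrib[of "\<lambda>x. _ * x"] cong: if_cong)

lemma elem_mat_inverse:
  assumes "\<And>a b c. M a c * M c b = 0"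
  shows "elem_mat n M * elem_mat n (\<lambda>a b. - M a b) = 1\<^sub>m n"
proof (rule eq_matI)
  fix a b assume "a < dim_row (1\<^sub>m n :: complex mat)" "b < dim_col (1\<^sub>m n :: complex mat)"
  then have ab: "a < n" "b < n" by simp_all
  have "(elem_mat n M * elem_mat n (\<lambda>a b. - M a b)) $$ (a, b)
      = (\<Sum>c<n. (if a = c then (if c = b then 1 else 0) - M a b else 0) + (if c = b then M a b else 0))"
  proof (subst index_mult_mat_sum[of _ n], simp_all only: elem_mat_carrier ab, rule sum.cong)
    fix c assume "c \<in> {..<n}"
    then show "elem_mat n M $$ (a, c) * elem_mat n (\<lambda>a b. - M a b) $$ (c, b)
        = (if a = c then (if c = b then 1 else 0) - M a b else 0) + (if c = b then M a b else 0)"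
      using ab assms[of a c b] by (cases "a = c"; cases "c = b") (auto simp: elem_mat_def algebra_simps)
  qed simp
  also have "\<dots> = (1\<^sub>m n :: complex mat) $$ (a, b)" using ab by (simp add: sum.distrib)
  finally show "(elem_mat n M * elem_mat n (\<lambda>a b. - M a b)) $$ (a, b) = (1\<^sub>m n :: complex mat) $$ (a, b)" .
qed (simp_all add: elem_mat_def)

section \<open>Closing up a tuple whose images lie in a three-dimensional space\<close>

text \<open>The first three rows of the inverse, for the operation \<open>N + Y + \<epsilon> N Y\<close>, of
  the product of the first \<open>i\<close> matrices \<open>u j v j\<^sup>T\<close>; the other rows vanish.\<close>

primrec inv_prod :: "complex \<Rightarrow> (nat \<Rightarrow> nat \<Rightarrow> complex) \<Rightarrow> (nat \<Rightarrow> nat \<Rightarrow> complex) \<Rightarrow> nat \<Rightarrow> nat \<Rightarrow> nat \<Rightarrow> complex"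
where
  "inv_prod \<epsilon> u v 0 = (\<lambda>r c. 0)"
| "inv_prod \<epsilon> u v (Suc i) = (\<lambda>r c. inv_prod \<epsilon> u v i r c - u i r *
     (v i c + \<epsilon> * (v i 0 * inv_prod \<epsilon> u v i 0 c + v i 1 * inv_prod \<epsilon> u v i 1 c + v i 2 * inv_prod \<epsilon> u v i 2 c)))"

lemma dot_three:
  assumes "3 \<le> n" "\<And>a. 3 \<le> a \<Longrightarrow> f a = 0 \<or> g a = 0"
  shows "dot n f g = f 0 * g 0 + f 1 * g 1 + f 2 * g 2"
proof -
  have "dot n f g = (\<Sum>a<3. f a * g a)"
    unfolding dot_def using assms by (intro sum.mono_neutral_right) (auto simp: not_less)
  then show ?thesis by (simp add: numeral_3_eq_3 numeral_2_eq_2)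
qed

lemma inv_prod_zero:
  "(\<And>j. j < i \<Longrightarrow> u j r = 0) \<Longrightarrow> inv_prod \<epsilon> u v i r c = 0"
  by (induction i) auto

text \<open>Since v . u = 0, the inverse of N = u v^T for the operation is -N, and the recursion of
  \<open>inv_prod\<close> multiplies by -N from the left. Multiplying by N thus undoes one step of
  it.\<close>

lemma op_prod_inv_prod:
  assumes n: "3 \<le> n" and vu: "\<And>j. j < i \<Longrightarrow> dot n (v j) (u j) = 0"
    and u: "\<And>j a. j < i \<Longrightarrow> 3 \<le> a \<Longrightarrow> u j a = 0"
    and Ms: "op_prod n \<epsilon> Ms = mat n n (\<lambda>(r, c). inv_prod \<epsilon> u v i r c)"
  shows "op_prod n \<epsilon> (map (\<lambda>j. rank1 n 0 (u j) (v j)) [0..<i] @ Ms) = 0\<^sub>m n n"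
  using vu u Ms
proof (induction i arbitrary: Ms)
  case 0
  then show ?case by (auto intro!: eq_matI)
next
  case (Suc i)
  let ?X = "inv_prod \<epsilon> u v"
  let ?M = "mat n n (\<lambda>(r, c). ?X (Suc i) r c)"
  have c: "?M \<in> carrier_mat n n" by simp
  have "op_prod n \<epsilon> (rank1 n 0 (u i) (v i) # Ms) = mat n n (\<lambda>(r, c). ?X i r c)"
  proof (rule eq_matI)
    fix r b assume "r < dim_row (mat n n (\<lambda>(r, c). ?X i r c))" "b < dim_col (mat n n (\<lambda>(r, c). ?X i r c))"
    then have rb: "r < n" "b < n" by simp_all
    define s where "s = v i 0 * ?X i 0 b + v i 1 * ?X i 1 b + v i 2 * ?X i 2 b"
    have z: "u i a = 0" "?X i a b = 0" if "3 \<le> a" for a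
      using that Suc.prems(2) by (auto intro: inv_prod_zero)
    have "fun_mat n (v i) ?M b = dot n (v i) (\<lambda>a. ?X (Suc i) a b)"
      using rb by (simp add: fun_mat_def dot_def)
    also have "\<dots> = v i 0 * ?X (Suc i) 0 b + v i 1 * ?X (Suc i) 1 b + v i 2 * ?X (Suc i) 2 b"
      using z by (intro dot_three[OF n]) simp
    also have "\<dots> = s - (v i 0 * u i 0 + v i 1 * u i 1 + v i 2 * u i 2) * (v i b + \<epsilon> * s)"
      by (simp add: s_def algebra_simps)
    also have "v i 0 * u i 0 + v i 1 * u i 1 + v i 2 * u i 2 = dot n (v i) (u i)"
      using z by (intro dot_three[OF n, symmetric]) simp
    finally have "fun_mat n (v i) ?M b = s" using Suc.prems(1)[of i] by simp
    moreover have "?X (Suc i) r b = ?X i r b - u i r * (v i b + \<epsilon> * s)" by (simp add: s_def)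
    ultimately show "op_prod n \<epsilon> (rank1 n 0 (u i) (v i) # Ms) $$ (r, b) = mat n n (\<lambda>(r, c). ?X i r c) $$ (r, b)"
      unfolding op_prod_Cons Suc.prems(3) op_index[OF c rb]
      using rb by (simp add: algebra_simps del: inv_prod.simps)
  qed (simp_all add: Suc.prems(3))
  from Suc.IH[OF _ _ this] Suc.prems(1,2) show ?case by simp
qed

section \<open>The trace or determinant condition\<close>

definition tr3 :: "(nat \<Rightarrow> nat \<Rightarrow> complex) \<Rightarrow> complex" where
  "tr3 x = x 0 0 + x 1 1 + x 2 2"

definition minors3 :: "(nat \<Rightarrow> nat \<Rightarrow> complex) \<Rightarrow> complex" where
  "minors3 x = (x 0 0 * x 1 1 - x 0 1 * x 1 0) + (x 0 0 * x 2 2 - x 0 2 * x 2 0) + (x 1 1 * x 2 2 - x 1 2 * x 2 1)"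

text \<open>The trace for \<open>\<epsilon> = 0\<close>, and \<open>det (1 + x) - 1\<close> for \<open>\<epsilon> = 1\<close>.\<close>

definition defect :: "complex \<Rightarrow> (nat \<Rightarrow> nat \<Rightarrow> complex) \<Rightarrow> complex" where
  "defect \<epsilon> x = tr3 x + \<epsilon> * minors3 x + \<epsilon>\<^sup>2 * det3 x"

text \<open>The change of the characteristic coefficients under a rank one update. The three groups
  on the right are w . u, (tr x) w . u - w . x u, and w . adj(x) u.\<close>

lemma defect_update:
  "defect \<epsilon> (\<lambda>r c. x r c - u r * w c) = defect \<epsilon> x -
     (w 0 * u 0 + w 1 * u 1 + w 2 * u 2
      + \<epsilon> * (tr3 x * (w 0 * u 0 + w 1 * u 1 + w 2 * u 2)
         - (w 0 * (x 0 0 * u 0 + x 0 1 * u 1 + x 0 2 * u 2) + w 1 * (x 1 0 * u 0 + x 1 1 * u 1 + x 1 2 * u 2)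
            + w 2 * (x 2 0 * u 0 + x 2 1 * u 1 + x 2 2 * u 2)))
      + \<epsilon>\<^sup>2 * (w 0 * ((x 1 1 * x 2 2 - x 1 2 * x 2 1) * u 0 - (x 0 1 * x 2 2 - x 0 2 * x 2 1) * u 1 + (x 0 1 * x 1 2 - x 0 2 * x 1 1) * u 2)
         + w 1 * (- (x 1 0 * x 2 2 - x 1 2 * x 2 0) * u 0 + (x 0 0 * x 2 2 - x 0 2 * x 2 0) * u 1 - (x 0 0 * x 1 2 - x 0 2 * x 1 0) * u 2)
         + w 2 * ((x 1 0 * x 2 1 - x 1 1 * x 2 0) * u 0 - (x 0 0 * x 2 1 - x 0 1 * x 2 0) * u 1 + (x 0 0 * x 1 1 - x 0 1 * x 1 0) * u 2)))"
  by (simp add: defect_def tr3_def minors3_def det3_def algebra_simps power2_eq_square)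

text \<open>One has 1 + \<epsilon> defect = det (1 + \<epsilon> x), which is multiplicative, and the
  new factor has determinant 1 because v . u = 0. For \<epsilon> = 0 the same formula is the
  additivity of the trace.\<close>

lemma defect_step:
  assumes "v 0 * u 0 + v 1 * u 1 + v 2 * u 2 = 0"
  shows "defect \<epsilon> (\<lambda>r c. x r c - u r * (v c + \<epsilon> * (v 0 * x 0 c + v 1 * x 1 c + v 2 * x 2 c))) = defect \<epsilon> x"
proof -
  have "defect \<epsilon> (\<lambda>r c. x r c - u r * (v c + \<epsilon> * (v 0 * x 0 c + v 1 * x 1 c + v 2 * x 2 c)))
     = defect \<epsilon> x - (v 0 * u 0 + v 1 * u 1 + v 2 * u 2) * (1 + \<epsilon> * defect \<epsilon> x)"
    unfolding defect_update by (simp add: defect_def tr3_def minors3_def det3_def algebra_simps power2_eq_square)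
  then show ?thesis using assms by simp
qed

lemma defect_inv_prod:
  assumes "\<And>j. j < i \<Longrightarrow> v j 0 * u j 0 + v j 1 * u j 1 + v j 2 * u j 2 = 0"
  shows "defect \<epsilon> (inv_prod \<epsilon> u v i) = 0"
  using assms
proof (induction i)
  case 0
  then show ?case by (simp add: defect_def tr3_def minors3_def det3_def)
next
  case (Suc i)
  then show ?case unfolding inv_prod.simps(2)
    by (subst defect_step[of "v i" "u i"]) auto
qed

text \<open>In the basis \<open>e\<^sub>0, x e\<^sub>0, x\<^sup>2 e\<^sub>0\<close> the matrix \<open>x\<close> is a companion matrix, which is a
  product of three matrices of rank one; its rows in this basis are \<open>row1, row2, row3\<close>.\<close>

locale companion =
  fixes n :: nat and \<epsilon> :: complex and x :: "nat \<Rightarrow> nat \<Rightarrow> complex"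
begin

definition g2 :: "nat \<Rightarrow> complex" where
  "g2 r = (if r < 3 then x r 0 else 0)"
definition g3 :: "nat \<Rightarrow> complex" where
  "g3 r = (if r < 3 then x r 0 * x 0 0 + x r 1 * x 1 0 + x r 2 * x 2 0 else 0)"
text \<open>The determinant of e_0, x e_0, x^2 e_0 for the leading block of \<open>x\<close>; it is
  nonzero if and only if e_0 is a cyclic vector.\<close>

definition \<Delta> :: complex where "\<Delta> = g2 1 * g3 2 - g2 2 * g3 1"
definition row2 :: "nat \<Rightarrow> complex" where "row2 c = (g3 2 * x 1 c - g3 1 * x 2 c) / \<Delta>"
definition row3 :: "nat \<Rightarrow> complex" where "row3 c = (g2 1 * x 2 c - g2 2 * x 1 c) / \<Delta>"
definition row1 :: "nat \<Rightarrow> complex" where "row1 c = x 0 c - g2 0 * row2 c - g3 0 * row3 c"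
text \<open>On the first three coordinates \<rho>1, \<rho>2, \<rho>3 are the basis dual to e_0,
  \<open>g2\<close>, \<open>g3\<close>; the lemmas \<open>gram1\<close>, \<open>gram2\<close> and
  \<open>gram3\<close> express this. Further entries are inherited from the other columns of
  \<open>x\<close>.\<close>

definition \<rho>3 :: "nat \<Rightarrow> complex" where "\<rho>3 c = row1 c / det3 x"
definition \<rho>1 :: "nat \<Rightarrow> complex" where "\<rho>1 c = row2 c + minors3 x * \<rho>3 c"
definition \<rho>2 :: "nat \<Rightarrow> complex" where "\<rho>2 c = row3 c - tr3 x * \<rho>3 c"
text \<open>\<open>w\<close> is solved from the last column det3 x e_0 - minors3 x g2 + tr3 x g3 of
  the companion matrix, after the contributions \<epsilon> w2 g3 and \<epsilon> det3 x g2 of the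
  products have been removed. It must have no component along \<open>g3\<close>, since \<rho>3 has
  to annihilate it.\<close>

definition w2 :: complex where "w2 = - minors3 x - \<epsilon> * det3 x"
definition w :: "nat \<Rightarrow> complex" where "w r = det3 x * kron 0 r + w2 * g2 r"

end

locale companion_closing = companion +
  assumes n: "3 \<le> n" and \<Delta>: "\<Delta> \<noteq> 0" and det: "det3 x \<noteq> 0" and defect: "defect \<epsilon> x = 0"
    and x0: "\<And>r c. 3 \<le> r \<Longrightarrow> x r c = 0"
begin

lemma support: "3 \<le> a \<Longrightarrow> g2 a = 0" "3 \<le> a \<Longrightarrow> g3 a = 0" "3 \<le> a \<Longrightarrow> w a = 0"
  by (simp_all add: g2_def g3_def w_def)

lemma x_g2: "r < 3 \<Longrightarrow> x r 0 * g2 0 + x r 1 * g2 1 + x r 2 * g2 2 = g3 r"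
  by (simp add: g2_def g3_def)

text \<open>The Cayley-Hamilton theorem applied to e_0.\<close>

lemma x_g3:
  assumes "r < 3"
  shows "x r 0 * g3 0 + x r 1 * g3 1 + x r 2 * g3 2
     = tr3 x * g3 r - minors3 x * g2 r + det3 x * kron 0 r"
proof -
  consider "r = 0" | "r = 1" | "r = 2" using assms by linarith
  then show ?thesis
    by cases (simp_all add: g2_def g3_def tr3_def minors3_def det3_def algebra_simps)
qed

lemma comb: "(a * p0 - b * q0) / d * s0 + (a * p1 - b * q1) / d * s1 + (a * p2 - b * q2) / d * s2
   = (a * (p0 * s0 + p1 * s1 + p2 * s2) - b * (q0 * s0 + q1 * s1 + q2 * s2)) / (d :: complex)"
  by (simp add: diff_divide_distrib add_divide_distrib algebra_simps)

lemma row2_dot: "row2 0 = 1" "row2 0 * g2 0 + row2 1 * g2 1 + row2 2 * g2 2 = 0"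
  "row2 0 * g3 0 + row2 1 * g3 1 + row2 2 * g3 2 = - minors3 x"
proof -
  have "g3 2 * x 1 0 - g3 1 * x 2 0 = \<Delta>" by (simp add: \<Delta>_def g2_def)
  then show "row2 0 = 1" using \<Delta> by (simp add: row2_def)
  show "row2 0 * g2 0 + row2 1 * g2 1 + row2 2 * g2 2 = 0"
    unfolding row2_def comb using x_g2[of 1] x_g2[of 2] by simp
  have "g3 2 * (tr3 x * g3 1 - minors3 x * g2 1) - g3 1 * (tr3 x * g3 2 - minors3 x * g2 2) = - minors3 x * \<Delta>"
    by (simp add: \<Delta>_def algebra_simps)
  then show "row2 0 * g3 0 + row2 1 * g3 1 + row2 2 * g3 2 = - minors3 x"
    unfolding row2_def comb using x_g3[of 1] x_g3[of 2] \<Delta> by simp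
qed

lemma row3_dot: "row3 0 = 0" "row3 0 * g2 0 + row3 1 * g2 1 + row3 2 * g2 2 = 1"
  "row3 0 * g3 0 + row3 1 * g3 1 + row3 2 * g3 2 = tr3 x"
proof -
  show "row3 0 = 0" by (simp add: row3_def g2_def)
  have "g2 1 * g3 2 - g2 2 * g3 1 = \<Delta>" by (simp add: \<Delta>_def)
  then show "row3 0 * g2 0 + row3 1 * g2 1 + row3 2 * g2 2 = 1"
    unfolding row3_def comb using x_g2[of 1] x_g2[of 2] \<Delta> by simp
  have "g2 1 * (tr3 x * g3 2 - minors3 x * g2 2) - g2 2 * (tr3 x * g3 1 - minors3 x * g2 1) = tr3 x * \<Delta>"
    by (simp add: \<Delta>_def algebra_simps)
  then show "row3 0 * g3 0 + row3 1 * g3 1 + row3 2 * g3 2 = tr3 x"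
    unfolding row3_def comb using x_g3[of 1] x_g3[of 2] \<Delta> by simp
qed

lemma row1_dot: "row1 0 = 0" "row1 0 * g2 0 + row1 1 * g2 1 + row1 2 * g2 2 = 0"
  "row1 0 * g3 0 + row1 1 * g3 1 + row1 2 * g3 2 = det3 x"
proof -
  have *: "row1 0 * h 0 + row1 1 * h 1 + row1 2 * h 2 = (x 0 0 * h 0 + x 0 1 * h 1 + x 0 2 * h 2)
      - g2 0 * (row2 0 * h 0 + row2 1 * h 1 + row2 2 * h 2) - g3 0 * (row3 0 * h 0 + row3 1 * h 1 + row3 2 * h 2)" for h
    by (simp add: row1_def algebra_simps)
  show "row1 0 = 0" using row2_dot(1) row3_dot(1) by (simp add: row1_def g2_def)
  show "row1 0 * g2 0 + row1 1 * g2 1 + row1 2 * g2 2 = 0"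
    unfolding * row2_dot(2,3) row3_dot(2,3) using x_g2[of 0] by simp
  show "row1 0 * g3 0 + row1 1 * g3 1 + row1 2 * g3 2 = det3 x"
    unfolding * row2_dot(2,3) row3_dot(2,3) using x_g3[of 0] by (simp add: algebra_simps)
qed

lemma x_rows: "x r c = kron 0 r * row1 c + g2 r * row2 c + g3 r * row3 c"
proof -
  have 1: "g2 1 * row2 c + g3 1 * row3 c = x 1 c"
  proof -
    have "g2 1 * row2 c + g3 1 * row3 c = \<Delta> * x 1 c / \<Delta>"
      unfolding row2_def row3_def times_divide_eq_right add_divide_distrib[symmetric]
      by (simp add: \<Delta>_def algebra_simps)
    then show ?thesis using \<Delta> by simp
  qed
  have 2: "g2 2 * row2 c + g3 2 * row3 c = x 2 c"
  proof -
    have "g2 2 * row2 c + g3 2 * row3 c = \<Delta> * x 2 c / \<Delta>"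
      unfolding row2_def row3_def times_divide_eq_right add_divide_distrib[symmetric]
      by (simp add: \<Delta>_def algebra_simps)
    then show ?thesis using \<Delta> by simp
  qed
  consider "r = 0" | "r = 1" | "r = 2" | "3 \<le> r" by linarith
  then show ?thesis
  proof cases
    case 4
    then show ?thesis using x0[OF 4] support(1,2)[OF 4] by simp
  qed (use 1 2 in \<open>simp_all add: row1_def\<close>)
qed

lemma d: "dot n f g2 = f 0 * g2 0 + f 1 * g2 1 + f 2 * g2 2"
  "dot n f g3 = f 0 * g3 0 + f 1 * g3 1 + f 2 * g3 2"
  "dot n f w = det3 x * f 0 + w2 * dot n f g2"
proof -
  show g2: "dot n f g2 = f 0 * g2 0 + f 1 * g2 1 + f 2 * g2 2"
    and "dot n f g3 = f 0 * g3 0 + f 1 * g3 1 + f 2 * g3 2"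
    by (rule dot_three[OF n]; simp add: support)+
  have "dot n f w = f 0 * w 0 + f 1 * w 1 + f 2 * w 2"
    by (rule dot_three[OF n]) (simp add: support)
  then show "dot n f w = det3 x * f 0 + w2 * dot n f g2"
    unfolding g2 by (simp add: w_def algebra_simps)
qed

lemma gram3: "\<rho>3 0 = 0" "dot n \<rho>3 g2 = 0" "dot n \<rho>3 g3 = 1" "dot n \<rho>3 w = 0"
proof -
  show z: "\<rho>3 0 = 0" by (simp add: \<rho>3_def row1_dot(1))
  have *: "\<rho>3 0 * h 0 + \<rho>3 1 * h 1 + \<rho>3 2 * h 2 = (row1 0 * h 0 + row1 1 * h 1 + row1 2 * h 2) / det3 x" for h
    by (simp add: \<rho>3_def add_divide_distrib)
  show a: "dot n \<rho>3 g2 = 0" unfolding d * row1_dot(2,3) by simp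
  show "dot n \<rho>3 g3 = 1" unfolding d * row1_dot(2,3) using det by simp
  show "dot n \<rho>3 w = 0" unfolding d(3) a z by simp
qed

lemma gram1: "\<rho>1 0 = 1" "dot n \<rho>1 g2 = 0" "dot n \<rho>1 g3 = 0" "dot n \<rho>1 w = det3 x"
proof -
  show z: "\<rho>1 0 = 1" by (simp add: \<rho>1_def row2_dot(1) gram3(1))
  have *: "\<rho>1 0 * h 0 + \<rho>1 1 * h 1 + \<rho>1 2 * h 2 = (row2 0 * h 0 + row2 1 * h 1 + row2 2 * h 2)
      + minors3 x * (\<rho>3 0 * h 0 + \<rho>3 1 * h 1 + \<rho>3 2 * h 2)" for h
    by (simp add: \<rho>1_def algebra_simps)
  note g = gram3(2,3)[unfolded d]
  show a: "dot n \<rho>1 g2 = 0" unfolding d * row2_dot(2,3) g by simp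
  show "dot n \<rho>1 g3 = 0" unfolding d * row2_dot(2,3) g by simp
  show "dot n \<rho>1 w = det3 x" unfolding d(3) a z by simp
qed

lemma gram2: "\<rho>2 0 = 0" "dot n \<rho>2 g2 = 1" "dot n \<rho>2 g3 = 0" "dot n \<rho>2 w = w2"
proof -
  show z: "\<rho>2 0 = 0" by (simp add: \<rho>2_def row3_dot(1) gram3(1))
  have *: "\<rho>2 0 * h 0 + \<rho>2 1 * h 1 + \<rho>2 2 * h 2 = (row3 0 * h 0 + row3 1 * h 1 + row3 2 * h 2)
      - tr3 x * (\<rho>3 0 * h 0 + \<rho>3 1 * h 1 + \<rho>3 2 * h 2)" for h
    by (simp add: \<rho>2_def algebra_simps)
  note g = gram3(2,3)[unfolded d]
  show a: "dot n \<rho>2 g2 = 1" unfolding d * row3_dot(2,3) g by simp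
  show "dot n \<rho>2 g3 = 0" unfolding d * row3_dot(2,3) g by simp
  show "dot n \<rho>2 w = w2" unfolding d(3) a z by simp
qed

lemma op_prod_closing:
  "op_prod n \<epsilon> [rank1 n 0 g2 \<rho>1, rank1 n 0 g3 \<rho>2, rank1 n 0 w \<rho>3] = mat n n (\<lambda>(r, c). x r c)"
proof (rule eq_matI)
  fix a b assume "a < dim_row (mat n n (\<lambda>(r, c). x r c))" "b < dim_col (mat n n (\<lambda>(r, c). x r c))"
  then have ab: "a < n" "b < n" by simp_all
  define R1 where "R1 = op_prod n \<epsilon> [rank1 n 0 g3 \<rho>2, rank1 n 0 w \<rho>3]"
  have c: "rank1 n 0 w \<rho>3 \<in> carrier_mat n n" "R1 \<in> carrier_mat n n"
    unfolding R1_def by (auto intro: op_prod_carrier)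
  have R1: "R1 = rank1 n 0 g3 \<rho>2 + rank1 n 0 w \<rho>3 + \<epsilon> \<cdot>\<^sub>m (rank1 n 0 g3 \<rho>2 * rank1 n 0 w \<rho>3)"
    by (simp add: R1_def)
  \<comment> \<open>Vanishing of the defect is what equates the coefficient \<open>tr3 x\<close> of
    \<open>g3\<close> with the product term \<open>\<epsilon> * w2\<close>.\<close>
  have "defect \<epsilon> x = tr3 x - \<epsilon> * w2" by (simp add: defect_def w2_def algebra_simps power2_eq_square)
  then have t: "tr3 x = \<epsilon> * w2" using defect by simp
  have "op_prod n \<epsilon> [rank1 n 0 g2 \<rho>1, rank1 n 0 g3 \<rho>2, rank1 n 0 w \<rho>3] $$ (a, b)
      = (rank1 n 0 g2 \<rho>1 + R1 + \<epsilon> \<cdot>\<^sub>m (rank1 n 0 g2 \<rho>1 * R1)) $$ (a, b)"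
    by (simp add: R1_def)
  also have "\<dots> = g2 a * \<rho>1 b + (g3 a * \<rho>2 b + w a * \<rho>3 b + \<epsilon> * (g3 a * (w2 * \<rho>3 b))) + \<epsilon> * (g2 a * (det3 x * \<rho>3 b))"
    unfolding op_index[OF c(2) ab] unfolding R1 op_index[OF c(1) ab] fun_mat_op[OF c(1) ab(2)] fun_mat_rank1[OF ab(2)] gram1 gram2
    using ab by simp
  also have "\<dots> = kron 0 a * (det3 x * \<rho>3 b) + g2 a * (\<rho>1 b - minors3 x * \<rho>3 b) + g3 a * (\<rho>2 b + tr3 x * \<rho>3 b)"
    unfolding t by (simp add: w_def w2_def algebra_simps)
  also have "\<dots> = x a b"
    unfolding x_rows[of a b] using det by (simp add: \<rho>1_def \<rho>2_def \<rho>3_def)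
  finally show "op_prod n \<epsilon> [rank1 n 0 g2 \<rho>1, rank1 n 0 g3 \<rho>2, rank1 n 0 w \<rho>3] $$ (a, b)
      = mat n n (\<lambda>(r, c). x r c) $$ (a, b)" using ab by simp
qed simp_all

lemma det3_transpose: "det3 (\<lambda>a b. f b a) = det3 f"
  by (simp add: det3_def algebra_simps)

text \<open>A vector of the three-space annihilated by all three coimages would be annihilated by
  the rows of \<open>x\<close>, against \<open>det3 x \<noteq> 0\<close>. This links every image to
  one of the last three matrices.\<close>

lemma detects:
  assumes u: "\<And>a. 3 \<le> a \<Longrightarrow> u a = 0" and ne: "\<exists>a<n. u a \<noteq> 0"
  shows "dot n \<rho>1 u \<noteq> 0 \<or> dot n \<rho>2 u \<noteq> 0 \<or> dot n \<rho>3 u \<noteq> 0"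
proof (rule ccontr)
  assume neg: "\<not> ?thesis"
  have d: "dot n f u = f 0 * u 0 + f 1 * u 1 + f 2 * u 2" for f
    by (rule dot_three[OF n]) (simp add: u)
  have r1: "dot n row1 u = det3 x * dot n \<rho>3 u" unfolding d \<rho>3_def using det by (simp add: algebra_simps)
  have r2: "dot n row2 u = dot n \<rho>1 u - minors3 x * dot n \<rho>3 u" unfolding d \<rho>1_def by (simp add: algebra_simps)
  have r3: "dot n row3 u = dot n \<rho>2 u + tr3 x * dot n \<rho>3 u" unfolding d \<rho>2_def by (simp add: algebra_simps)
  have "u 0 * x b 0 + u 1 * x b 1 + u 2 * x b 2 = 0" for b
  proof -
    have "u 0 * x b 0 + u 1 * x b 1 + u 2 * x b 2 = kron 0 b * dot n row1 u + g2 b * dot n row2 u + g3 b * dot n row3 u"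
      unfolding x_rows[of b] d by (simp add: algebra_simps)
    then show ?thesis using neg r1 r2 r3 by simp
  qed
  then have "u 0 = 0" "u 1 = 0" "u 2 = 0"
    using det3_cramer[of "\<lambda>i b. x b i" "u 0" "u 1" "u 2"] det det3_transpose[of x] by auto
  moreover obtain a where "a < n" "u a \<noteq> 0" using ne by blast
  moreover have "a = 0 \<or> a = 1 \<or> a = 2 \<or> 3 \<le> a" by linarith
  ultimately show False using u[of a] by auto
qed

text \<open>The images have determinant \<open>det3 x * \<Delta>\<close>, and the coimages, as a
  dual basis, have an invertible one.\<close>

lemma closing_minor:
  "det3 (\<lambda>a b. g2 a * \<rho>1 b + g3 a * \<rho>2 b + w a * \<rho>3 b) \<noteq> 0"
proof -
  define U where "U = (\<lambda>i :: nat. if i = 0 then g2 else if i = 1 then g3 else w)"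
  define V where "V = (\<lambda>i :: nat. if i = 0 then \<rho>1 else if i = 1 then \<rho>2 else \<rho>3)"
  define H where "H = (\<lambda>i :: nat. if i = 0 then kron 0 else if i = 1 then g2 else g3)"
  have "det3 U = det3 x * \<Delta>"
    unfolding det3_def[of U] by (simp add: U_def w_def \<Delta>_def algebra_simps)
  then have 1: "det3 U \<noteq> 0" using det \<Delta> by simp
  have HV: "H b 0 * V a 0 + H b 1 * V a 1 + H b 2 * V a 2 = (if a = b then 1 else 0)" if "a < 3" "b < 3" for a b
  proof -
    have a: "a = 0 \<or> a = 1 \<or> a = 2" and b: "b = 0 \<or> b = 1 \<or> b = 2" using that by auto
    from a b show ?thesis
      using gram1 gram2 gram3 unfolding d by (elim disjE) (auto simp: H_def V_def mult.commute)
  qed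
  have "det3 (\<lambda>i b. H b i) * det3 (\<lambda>i a. V a i)
      = det3 (\<lambda>b a. H b 0 * V a 0 + H b 1 * V a 1 + H b 2 * V a 2)"
    by (rule det3_mult[symmetric])
  also have "\<dots> = det3 (\<lambda>b a. if a = b then 1 else 0)"
    by (rule det3_cong, rule HV)
  also have "\<dots> = 1" by (simp add: det3_def)
  finally have 2: "det3 V \<noteq> 0" using det3_transpose[of V] by auto
  have "det3 (\<lambda>a b. g2 a * \<rho>1 b + g3 a * \<rho>2 b + w a * \<rho>3 b) = det3 U * det3 V"
    unfolding det3_mult[symmetric] by (simp add: U_def V_def)
  with 1 2 show ?thesis by simp
qed

end

section \<open>A family in the stratum\<close>

text \<open>\<open>SP i\<close> and \<open>VP i\<close> are the free entries of the image and the coimage of the \<open>i\<close>-th matrix, for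
  \<open>i < k\<close>; \<open>ZP\<close> and \<open>LP\<close> are the entries of the matrices by which the direct sum with the scalar
  block is conjugated, and move its kernel and its three-dimensional image.\<close>

datatype coord = ZP nat | SP nat nat | VP nat nat | LP nat nat

text \<open>The order of release. Recovering a \<open>ZP\<close> requires all other kinds at their
  base values, recovering a \<open>VP\<close> requires the \<open>LP\<close> to be frozen, and the
  functions recovering \<open>SP\<close> and \<open>LP\<close> tolerate everything released
  before.\<close>

fun coord_group :: "coord \<Rightarrow> nat" where
  "coord_group (ZP _) = 0"
| "coord_group (SP _ _) = 1"
| "coord_group (VP _ _) = 2"
| "coord_group (LP _ _) = 3"

locale family =
  fixes \<epsilon> :: complex and k :: nat
  assumes k: "4 \<le> k"
begin

abbreviation "n \<equiv> Suc k"
abbreviation "q \<equiv> k + 3"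

text \<open>The three-space is spanned by the first three coordinates. Each image has an entry
  normalised to 1, so that v . u = 0 can be solved for the corresponding entry of the coimage: entry
  \<open>i\<close> for the first three matrices, entry 0 for the others.\<close>

definition uf :: "(coord \<Rightarrow> complex) \<Rightarrow> nat \<Rightarrow> nat \<Rightarrow> complex" where
  "uf p i a = (if i < 3 then kron i a else if a = 0 then 1 else if a < 3 then p (SP i a) else 0)"

definition vf :: "(coord \<Rightarrow> complex) \<Rightarrow> nat \<Rightarrow> nat \<Rightarrow> complex" where
  "vf p i c = (if k \<le> c then 0 else if i < 3 then (if c = i then 0 else p (VP i c))
     else if c = 0 then - (p (SP i 1) * p (VP i 1) + p (SP i 2) * p (VP i 2)) else p (VP i c))"

definition X :: "(coord \<Rightarrow> complex) \<Rightarrow> nat \<Rightarrow> nat \<Rightarrow> complex" where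
  "X p = inv_prod \<epsilon> (uf p) (vf p) k"

definition ua :: "(coord \<Rightarrow> complex) \<Rightarrow> nat \<Rightarrow> nat \<Rightarrow> complex" where
  "ua p i = (if i < k then uf p i else if i = k then companion.g2 (X p)
     else if i = k + 1 then companion.g3 (X p) else companion.w \<epsilon> (X p))"

definition va :: "(coord \<Rightarrow> complex) \<Rightarrow> nat \<Rightarrow> nat \<Rightarrow> complex" where
  "va p i = (if i < k then vf p i else if i = k then companion.\<rho>1 (X p)
     else if i = k + 1 then companion.\<rho>2 (X p) else companion.\<rho>3 (X p))"

definition Vmat :: "(coord \<Rightarrow> complex) \<Rightarrow> complex mat" where
  "Vmat p = mat k k (\<lambda>(i, c). vf p i c)"

text \<open>The first two factors allow the tuple to be closed up; the third makes the first
  \<open>k\<close> coimages a basis, from which the centralizer of the block is determined.\<close>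

definition D :: "(coord \<Rightarrow> complex) set" where
  "D = {p. companion.\<Delta> (X p) * det3 (X p) * det (Vmat p) \<noteq> 0}"

definition colm :: "(coord \<Rightarrow> complex) \<Rightarrow> nat \<Rightarrow> nat \<Rightarrow> complex" where
  "colm p a b = (if a < k \<and> b = k then p (ZP a) else 0)"

definition low :: "(coord \<Rightarrow> complex) \<Rightarrow> nat \<Rightarrow> nat \<Rightarrow> complex" where
  "low p a b = (if 3 \<le> a \<and> b < 3 then p (LP a b) else 0)"

text \<open>\<open>su\<close> and \<open>sv\<close> are the effects on image and coimage of
  conjugation by (1 + low)(1 + colm). The images have entry 0 at index \<open>k\<close> and are
  fixed by the second factor.\<close>

definition su :: "(coord \<Rightarrow> complex) \<Rightarrow> (nat \<Rightarrow> complex) \<Rightarrow> nat \<Rightarrow> complex" where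
  "su p u a = u a + (\<Sum>c<n. low p a c * u c)"

definition sz :: "(coord \<Rightarrow> complex) \<Rightarrow> (nat \<Rightarrow> complex) \<Rightarrow> nat \<Rightarrow> complex" where
  "sz p v b = v b - (\<Sum>c<n. v c * colm p c b)"

definition sv :: "(coord \<Rightarrow> complex) \<Rightarrow> (nat \<Rightarrow> complex) \<Rightarrow> nat \<Rightarrow> complex" where
  "sv p v b = sz p v b - (\<Sum>c<n. sz p v c * low p c b)"

definition \<phi> :: "(coord \<Rightarrow> complex) \<Rightarrow> complex mat list" where
  "\<phi> p = map (\<lambda>i. rank1 n \<epsilon> (su p (ua p i)) (sv p (va p i))) [0..<q]"

lemma uf_support: "3 \<le> a \<Longrightarrow> uf p i a = 0"
  by (simp add: uf_def kron_def)

lemma uf_vf: "vf p i 0 * uf p i 0 + vf p i 1 * uf p i 1 + vf p i 2 * uf p i 2 = 0"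
proof -
  consider "i = 0" | "i = 1" | "i = 2" | "3 \<le> i" by linarith
  then show ?thesis
    by cases (use k in \<open>auto simp: uf_def vf_def kron_def algebra_simps\<close>)
qed

lemma X_support: "3 \<le> r \<Longrightarrow> X p r c = 0"
  unfolding X_def by (rule inv_prod_zero) (rule uf_support)

lemma X_last_column: "X p r k = 0"
proof -
  have "inv_prod \<epsilon> (uf p) (vf p) i r k = 0" for i r
    by (induction i arbitrary: r) (auto simp: vf_def)
  then show ?thesis by (simp add: X_def)
qed

text \<open>The size \<open>m\<close> is free: size \<open>k\<close> serves for the centralizer of
  the block, size \<open>n\<close> for the equation.\<close>

lemma closing:
  assumes p: "p \<in> D" and m: "3 \<le> m" shows "companion_closing m \<epsilon> (X p)"
proof
  show "defect \<epsilon> (X p) = 0" unfolding X_def by (rule defect_inv_prod) (rule uf_vf)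
qed (use p m X_support in \<open>auto simp: D_def\<close>)

lemma ua_support: "3 \<le> a \<Longrightarrow> ua p i a = 0"
  by (simp add: ua_def uf_support companion.g2_def companion.g3_def companion.w_def)

text \<open>The closing coimages are combinations of rows of \<open>x\<close>, whose column
  \<open>k\<close> is zero; thus the scalar block splits off.\<close>

lemma va_last: "va p i k = 0"
  by (simp add: va_def vf_def companion.\<rho>1_def companion.\<rho>2_def companion.\<rho>3_def
      companion.row1_def companion.row2_def companion.row3_def X_last_column)

lemma vf_nonzero:
  assumes "p \<in> D" "i < k" shows "\<exists>c<k. vf p i c \<noteq> 0"
proof (rule ccontr)
  assume neg: "\<not> ?thesis"
  have "det (Vmat p) \<noteq> 0" using assms(1) by (simp add: D_def)
  then obtain W where W: "W \<in> carrier_mat k k" "Vmat p * W = 1\<^sub>m k"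
    using inverse_mat_exists[of "Vmat p" k] by (auto simp: Vmat_def)
  have "(Vmat p * W) $$ (i, i) = (\<Sum>c<k. vf p i c * W $$ (c, i))"
    using W(1) assms(2) by (subst index_mult_mat_sum[of _ k]) (auto simp: Vmat_def)
  also have "\<dots> = 0" using neg by (intro sum.neutral) auto
  finally show False using W(2) assms(2) by simp
qed

lemma nonzero_if_dot: "dot m f g \<noteq> 0 \<Longrightarrow> (\<exists>a<m. f a \<noteq> 0) \<and> (\<exists>a<m. g a \<noteq> 0)"
proof -
  assume "dot m f g \<noteq> 0"
  then obtain a where "a \<in> {..<m}" "f a * g a \<noteq> 0"
    unfolding dot_def by (rule sum.not_neutral_contains_not_neutral)
  then show ?thesis by (auto intro: exI[of _ a])
qed

lemma ua_va:
  assumes p: "p \<in> D" and i: "i < q"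
  shows "\<exists>a<k. ua p i a \<noteq> 0" "\<exists>a<k. va p i a \<noteq> 0" "3 \<le> m \<Longrightarrow> dot m (va p i) (ua p i) = 0"
proof -
  interpret companion_closing k \<epsilon> "X p" using p k by (intro closing) auto
  have uf: "\<exists>a<k. uf p i a \<noteq> 0"
    using k by (cases "i < 3") (auto simp: uf_def intro!: exI[of _ "if i < 3 then i else 0"])
  have *: "\<exists>a<k. g2 a \<noteq> 0" "\<exists>a<k. g3 a \<noteq> 0" "\<exists>a<k. w a \<noteq> 0"
    "\<exists>a<k. \<rho>1 a \<noteq> 0" "\<exists>a<k. \<rho>2 a \<noteq> 0" "\<exists>a<k. \<rho>3 a \<noteq> 0"
    using nonzero_if_dot[of k \<rho>2 g2] nonzero_if_dot[of k \<rho>3 g3] nonzero_if_dot[of k \<rho>1 w] gram1 gram2 gram3 det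
    by auto
  consider "i < k" | "i = k" | "i = k + 1" | "i = k + 2" using i by linarith
  then show "\<exists>a<k. ua p i a \<noteq> 0" "\<exists>a<k. va p i a \<noteq> 0"
    by (cases; use uf * vf_nonzero[OF p] in \<open>simp add: ua_def va_def\<close>)+
  assume m: "3 \<le> m"
  interpret m: companion_closing m \<epsilon> "X p" using p m by (rule closing)
  from \<open>i < q\<close> consider "i < k" | "i = k" | "i = k + 1" | "i = k + 2" by linarith
  then show "dot m (va p i) (ua p i) = 0"
  proof cases
    case 1
    have "dot m (vf p i) (uf p i) = vf p i 0 * uf p i 0 + vf p i 1 * uf p i 1 + vf p i 2 * uf p i 2"
      using uf_support by (intro dot_three[OF m]) simp
    then show ?thesis using 1 uf_vf by (simp add: ua_def va_def)
  qed (simp_all add: ua_def va_def m.gram1 m.gram2 m.gram3)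
qed

text \<open>The last three matrices are linked by \<rho>2 . g2 = 1 and \<rho>3 . g3 = 1, and
  \<open>detects\<close> links each of the others to one of them.\<close>

lemma block_trivial_centralizer:
  assumes p: "p \<in> D"
  shows "trivial_centralizer k (map (\<lambda>i. rank1 k \<epsilon> (ua p i) (va p i)) [0..<q])"
proof (rule trivial_centralizer_rank1[OF refl refl])
  interpret companion_closing k \<epsilon> "X p" using p k by (intro closing) auto
  show "\<exists>a<k. ua p i a \<noteq> 0" "\<exists>a<k. va p i a \<noteq> 0" if "i < q" for i using ua_va[OF p that] by auto
  have "mat k k (\<lambda>(i, c). va p i c) = Vmat p" by (intro eq_matI) (auto simp: Vmat_def va_def)
  then show "det (mat k k (\<lambda>(i, c). va p i c)) \<noteq> 0" using p by (simp add: D_def)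
  show "dot k (va p (k + 1)) (ua p k) \<noteq> 0" "dot k (va p (k + 2)) (ua p (k + 1)) \<noteq> 0"
    by (simp_all add: ua_def va_def gram2 gram3)
  show "\<exists>j\<in>{k, k + 1, k + 2}. dot k (va p j) (ua p i) \<noteq> 0" if "i < k" for i
    using detects[of "ua p i"] ua_support ua_va(1)[OF p, of i] that by (auto simp: va_def)
qed

definition Pmat :: "(coord \<Rightarrow> complex) \<Rightarrow> complex mat" where
  "Pmat p = elem_mat n (low p) * elem_mat n (colm p)"

definition Qmat :: "(coord \<Rightarrow> complex) \<Rightarrow> complex mat" where
  "Qmat p = elem_mat n (\<lambda>a b. - colm p a b) * elem_mat n (\<lambda>a b. - low p a b)"

lemma PQ: "Pmat p \<in> carrier_mat n n" "Qmat p \<in> carrier_mat n n"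
  "Pmat p * Qmat p = 1\<^sub>m n" "Qmat p * Pmat p = 1\<^sub>m n"
proof -
  show c: "Pmat p \<in> carrier_mat n n" "Qmat p \<in> carrier_mat n n"
    unfolding Pmat_def Qmat_def by (auto intro: mult_carrier_mat[of _ n n])
  have z: "colm p a c * colm p c b = 0" "low p a c * low p c b = 0" for a b c
    by (auto simp: colm_def low_def)
  note ZZ = elem_mat_inverse[of "colm p", OF z(1), of n]
  note LL = elem_mat_inverse[of "low p", OF z(2), of n]
  let ?L = "elem_mat n (low p)" and ?Z = "elem_mat n (colm p)"
  let ?L' = "elem_mat n (\<lambda>a b. - low p a b)" and ?Z' = "elem_mat n (\<lambda>a b. - colm p a b)"
  have "Pmat p * Qmat p = ?L * (?Z * (?Z' * ?L'))"
    unfolding Pmat_def Qmat_def by (intro assoc_mult_mat[of _ n n _ n _ n]) (auto intro: mult_carrier_mat[of _ n n])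
  also have "?Z * (?Z' * ?L') = (?Z * ?Z') * ?L'"
    by (intro assoc_mult_mat[of _ n n _ n _ n, symmetric]) auto
  also have "\<dots> = ?L'" unfolding ZZ by (intro left_mult_one_mat[of _ n n]) auto
  finally show PQ: "Pmat p * Qmat p = 1\<^sub>m n" unfolding LL .
  then show "Qmat p * Pmat p = 1\<^sub>m n" using mat_mult_left_right_inverse[OF c] by simp
qed

lemma Pmat_conj:
  assumes u: "u k = 0"
  shows "Pmat p * rank1 n \<delta> u v * Qmat p = rank1 n \<delta> (su p u) (sv p v)"
proof -
  have Z: "mat_fun n (elem_mat n (colm p)) u a = u a" if "a < n" for a
  proof -
    have "(\<Sum>c<n. colm p a c * u c) = 0" using u by (intro sum.neutral) (auto simp: colm_def)
    then show ?thesis using that by (simp add: mat_fun_elem_mat del: sum.lessThan_Suc)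
  qed
  have 1: "mat_fun n (Pmat p) u a = su p u a" if "a < n" for a
  proof -
    have "mat_fun n (Pmat p) u a = mat_fun n (elem_mat n (low p)) (mat_fun n (elem_mat n (colm p)) u) a"
      unfolding Pmat_def using that by (intro mat_fun_mult) auto
    also have "\<dots> = mat_fun n (elem_mat n (low p)) u a"
      unfolding mat_fun_def[of n "elem_mat n (low p)"] using Z by (intro sum.cong) auto
    finally show ?thesis using that by (simp add: mat_fun_elem_mat su_def del: sum.lessThan_Suc)
  qed
  have Z': "fun_mat n v (elem_mat n (\<lambda>a b. - colm p a b)) b = sz p v b" if "b < n" for b
    using that by (simp add: fun_mat_elem_mat sz_def sum_negf del: sum.lessThan_Suc)
  have 2: "fun_mat n v (Qmat p) b = sv p v b" if "b < n" for b
  proof -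
    have "fun_mat n v (Qmat p) b = fun_mat n (fun_mat n v (elem_mat n (\<lambda>a b. - colm p a b))) (elem_mat n (\<lambda>a b. - low p a b)) b"
      unfolding Qmat_def using that by (intro fun_mat_mult) auto
    also have "\<dots> = fun_mat n (sz p v) (elem_mat n (\<lambda>a b. - low p a b)) b"
      unfolding fun_mat_def[of n _ "elem_mat n (\<lambda>a b. - low p a b)"] using Z' by (intro sum.cong) auto
    finally show ?thesis using that by (simp add: fun_mat_elem_mat sv_def sum_negf del: sum.lessThan_Suc)
  qed
  show ?thesis
    unfolding conj_rank1[OF PQ(1-3)] by (rule rank1_cong) (simp add: 1 2)
qed

lemma \<phi>_nth: "i < q \<Longrightarrow> \<phi> p ! i = Pmat p * rank1 n \<epsilon> (ua p i) (va p i) * Qmat p"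
  using k ua_support[of k p i] by (simp add: \<phi>_def Pmat_conj del: upt_Suc)

lemma \<phi>_nil_variety:
  assumes p: "p \<in> D" shows "\<phi> p \<in> nil_variety \<epsilon> n q"
proof -
  interpret companion_closing n \<epsilon> "X p" using p k by (intro closing) auto
  have len: "length (\<phi> p) = q" by (simp add: \<phi>_def)
  have "\<phi> p ! i \<in> nilclass \<epsilon> n" if i: "i < q" for i
  proof -
    have "similar_mat_wit (\<phi> p ! i) (rank1 n \<epsilon> (ua p i) (va p i)) (Pmat p) (Qmat p)"
      unfolding \<phi>_nth[OF i] using PQ[of p] by (intro similar_mat_witI[of _ _ n]) (auto intro!: mult_carrier_mat[of _ n n])
    then have "similar_mat (\<phi> p ! i) (rank1 n \<epsilon> (ua p i) (va p i))"
      unfolding similar_mat_def by blast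
    moreover have "rank1 n \<epsilon> (ua p i) (va p i) \<in> nilclass \<epsilon> n"
      using ua_va[OF p i] k by (intro nilclassI(1)) (auto intro: less_SucI)
    ultimately show ?thesis
      unfolding nilclass_def conj_class_def using similar_mat_trans by blast
  qed
  then have "set (\<phi> p) \<subseteq> nilclass \<epsilon> n" using len by (auto simp: in_set_conv_nth)
  moreover have "op_prod n \<epsilon> (map (shift n \<epsilon>) (\<phi> p)) = 0\<^sub>m n n"
  proof -
    let ?Ns = "map (\<lambda>i. rank1 n 0 (ua p i) (va p i)) [0..<q]"
    have "map (shift n \<epsilon>) (\<phi> p) = map (\<lambda>N. Pmat p * N * Qmat p) ?Ns"
      using k ua_support[of k p] by (simp add: \<phi>_def Pmat_conj comp_def del: upt_Suc)
    moreover have "set ?Ns \<subseteq> carrier_mat n n" by auto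
    ultimately have "op_prod n \<epsilon> (map (shift n \<epsilon>) (\<phi> p)) = Pmat p * op_prod n \<epsilon> ?Ns * Qmat p"
      using op_prod_conj[OF PQ(1)[of p] PQ(2)[of p] PQ(4)[of p], of ?Ns \<epsilon>] by (simp only:)
    moreover have "op_prod n \<epsilon> ?Ns = 0\<^sub>m n n"
    proof -
      have "[0..<q] = [0..<k] @ [k, k + 1, k + 2]" by (simp add: numeral_3_eq_3)
      then have "?Ns = map (\<lambda>j. rank1 n 0 (uf p j) (vf p j)) [0..<k] @ [rank1 n 0 g2 \<rho>1, rank1 n 0 g3 \<rho>2, rank1 n 0 w \<rho>3]"
        by (simp add: ua_def va_def)
      moreover have "op_prod n \<epsilon> (map (\<lambda>j. rank1 n 0 (uf p j) (vf p j)) [0..<k] @ [rank1 n 0 g2 \<rho>1, rank1 n 0 g3 \<rho>2, rank1 n 0 w \<rho>3]) = 0\<^sub>m n n"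
      proof (rule op_prod_inv_prod)
        show "dot n (vf p j) (uf p j) = 0" if "j < k" for j
          using ua_va(3)[OF p, of j n] that k by (simp add: ua_def va_def)
        show "op_prod n \<epsilon> [rank1 n 0 g2 \<rho>1, rank1 n 0 g3 \<rho>2, rank1 n 0 w \<rho>3] =
            mat n n (\<lambda>(r, c). inv_prod \<epsilon> (uf p) (vf p) k r c)"
          using op_prod_closing by (simp only: X_def)
      qed (use k uf_support in auto)
      ultimately show ?thesis by simp
    qed
    ultimately show ?thesis using PQ(1,2)[of p] by simp
  qed
  ultimately show ?thesis using len by (simp add: nil_variety_def)
qed

lemma \<phi>_has_type:
  assumes p: "p \<in> D" shows "has_type q (\<phi> p) (stratum_type \<epsilon> k q)"
proof (rule has_type_stratum_type[OF _ _ _ block_trivial_centralizer[OF p]])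
  let ?B = "map (\<lambda>i. rank1 k \<epsilon> (ua p i) (va p i)) [0..<q]"
  show "0 < k" "0 < q" using k by auto
  show "?B \<in> tuples k q" by (auto simp: tuples_def)
  show "conj_class B = nilclass \<epsilon> k" if B: "B \<in> set ?B" for B
  proof -
    obtain i where i: "i < q" "B = rank1 k \<epsilon> (ua p i) (va p i)" using B by auto
    show ?thesis unfolding i(2) using ua_va[OF p i(1)] k by (intro nilclassI(2)) auto
  qed
  show "simult_conj (\<phi> p) (block_diag q [?B, scalar_tuple \<epsilon> q])"
    unfolding simult_conj_def
  proof (intro conjI exI allI impI)
    show "length (\<phi> p) = length (block_diag q [?B, scalar_tuple \<epsilon> q])"
      by (simp add: \<phi>_def block_diag_def)
    fix i assume "i < length (\<phi> p)"
    then have i: "i < q" by (simp add: \<phi>_def)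
    have "diag_block_mat [rank1 k \<epsilon> (ua p i) (va p i), mat 1 1 (\<lambda>_. \<epsilon>)] = rank1 n \<epsilon> (ua p i) (va p i)"
    proof -
      have z: "ua p i k = 0" "va p i k = 0" using ua_support[of k p i] va_last[of p i] k by auto
      show ?thesis unfolding diag_block_mat_pair
        by (intro eq_matI) (auto simp: four_block_mat_def Let_def less_Suc_eq z)
    qed
    then have "block_diag q [?B, scalar_tuple \<epsilon> q] ! i = rank1 n \<epsilon> (ua p i) (va p i)"
      using i by (simp add: block_diag_def scalar_tuple_def del: diag_block_mat.simps upt_Suc)
    then show "similar_mat_wit (\<phi> p ! i) (block_diag q [?B, scalar_tuple \<epsilon> q] ! i) (Pmat p) (Qmat p)"
      unfolding \<phi>_nth[OF i] using PQ[of p]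
      by (intro similar_mat_witI[of _ _ n]) (auto intro!: mult_carrier_mat[of _ n n])
  qed
qed

end

lemma rat_fun_det3:
  assumes "\<And>a b. (\<lambda>p. F p a b) \<in> rat_fun D" shows "(\<lambda>p. det3 (F p)) \<in> rat_fun D"
  unfolding det3_def by (intro rat_fun.add rat_fun_diff rat_fun.mult assms)

context family
begin

section \<open>Rationality of the family\<close>

lemma rat_uf: "(\<lambda>p. uf p i a) \<in> rat_fun UNIV"
  by (cases "i < 3"; cases "a = 0"; cases "a < 3") (auto simp: uf_def intro: rat_fun.const rat_fun.coord)

lemma rat_vf: "(\<lambda>p. vf p i c) \<in> rat_fun UNIV"
proof -
  have "(\<lambda>p. - (p (SP i 1) * p (VP i 1) + p (SP i 2) * p (VP i 2))) \<in> rat_fun UNIV"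
    by (intro rat_fun_uminus rat_fun.add rat_fun.mult rat_fun.coord)
  then show ?thesis
    by (cases "k \<le> c"; cases "i < 3"; cases "c = i"; cases "c = 0")
      (use k in \<open>auto simp: vf_def intro: rat_fun.const rat_fun.coord\<close>)
qed

lemma rat_X: "(\<lambda>p. X p r c) \<in> rat_fun UNIV"
proof -
  have "(\<lambda>p. inv_prod \<epsilon> (uf p) (vf p) i r c) \<in> rat_fun UNIV" for i
    by (induction i arbitrary: r c)
      (simp_all only: inv_prod.simps, intro rat_fun.const,
       intro rat_fun_diff rat_fun.mult rat_fun.add rat_fun.const rat_uf rat_vf)
  then show ?thesis unfolding X_def .
qed

lemma rat_g2: "(\<lambda>p. companion.g2 (X p) r) \<in> rat_fun UNIV"
  by (cases "r < 3") (simp_all add: companion.g2_def rat_X rat_fun.const)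

lemma rat_g3: "(\<lambda>p. companion.g3 (X p) r) \<in> rat_fun UNIV"
proof -
  have "(\<lambda>p. X p r 0 * X p 0 0 + X p r 1 * X p 1 0 + X p r 2 * X p 2 0) \<in> rat_fun UNIV"
    by (intro rat_fun.add rat_fun.mult rat_X)
  then show ?thesis by (cases "r < 3") (simp_all add: companion.g3_def rat_fun.const)
qed

lemma rat_\<Delta>: "(\<lambda>p. companion.\<Delta> (X p)) \<in> rat_fun UNIV"
  unfolding companion.\<Delta>_def by (intro rat_fun_diff rat_fun.mult rat_g2 rat_g3)

lemma rat_det3: "(\<lambda>p. det3 (X p)) \<in> rat_fun UNIV"
  by (rule rat_fun_det3) (rule rat_X)

lemma rat_tr3: "(\<lambda>p. tr3 (X p)) \<in> rat_fun UNIV"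
  unfolding tr3_def by (intro rat_fun.add rat_X)

lemma rat_minors3: "(\<lambda>p. minors3 (X p)) \<in> rat_fun UNIV"
  unfolding minors3_def by (intro rat_fun.add rat_fun_diff rat_fun.mult rat_X)

lemma rat_det_Vmat: "(\<lambda>p. det (Vmat p)) \<in> rat_fun UNIV"
proof -
  have "det (Vmat p) = (\<Sum>\<sigma> | \<sigma> permutes {0..<k}. signof \<sigma> * (\<Prod>i = 0..<k. vf p i (\<sigma> i)))" for p
    unfolding det_def'[of "Vmat p" k, unfolded Vmat_def, OF mat_carrier, folded Vmat_def]
    by (intro sum.cong refl arg_cong2[where f = "(*)"] prod.cong) (auto simp: Vmat_def permutes_in_image)
  moreover have "(\<lambda>p. \<Sum>\<sigma> | \<sigma> permutes {0..<k}. signof \<sigma> * (\<Prod>i = 0..<k. vf p i (\<sigma> i))) \<in> rat_fun UNIV"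
    by (intro rat_fun_sum rat_fun.mult rat_fun.const rat_fun_prod rat_vf)
  ultimately show ?thesis by simp
qed

lemma line_dense_D: "line_dense D"
  unfolding D_def
  by (rule line_dense_nonzero) (intro rat_fun.mult rat_\<Delta> rat_det3 rat_det_Vmat)

lemma D_nonzero: "p \<in> D \<Longrightarrow> companion.\<Delta> (X p) \<noteq> 0" "p \<in> D \<Longrightarrow> det3 (X p) \<noteq> 0"
  by (simp_all add: D_def)

lemmas rat_on_D = rat_g2[THEN rat_fun_UNIV_subset] rat_g3[THEN rat_fun_UNIV_subset]
  rat_X[THEN rat_fun_UNIV_subset] rat_\<Delta>[THEN rat_fun_UNIV_subset] rat_det3[THEN rat_fun_UNIV_subset]
  rat_tr3[THEN rat_fun_UNIV_subset] rat_minors3[THEN rat_fun_UNIV_subset]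

lemma rat_row2: "(\<lambda>p. companion.row2 (X p) c) \<in> rat_fun D"
  unfolding companion.row2_def
  by (intro rat_fun_divide rat_fun_diff rat_fun.mult rat_on_D D_nonzero)

lemma rat_row3: "(\<lambda>p. companion.row3 (X p) c) \<in> rat_fun D"
  unfolding companion.row3_def
  by (intro rat_fun_divide rat_fun_diff rat_fun.mult rat_on_D D_nonzero)

lemma rat_\<rho>3: "(\<lambda>p. companion.\<rho>3 (X p) c) \<in> rat_fun D"
  unfolding companion.\<rho>3_def companion.row1_def
  by (intro rat_fun_divide rat_fun_diff rat_fun.mult rat_on_D rat_row2 rat_row3 D_nonzero)

lemma rat_ua: "(\<lambda>p. ua p i a) \<in> rat_fun D"
proof -
  have "(\<lambda>p. companion.w \<epsilon> (X p) a) \<in> rat_fun D"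
    unfolding companion.w_def companion.w2_def
    by (intro rat_fun.add rat_fun_diff rat_fun_uminus rat_fun.mult rat_fun.const rat_on_D)
  then show ?thesis
    using rat_fun_UNIV_subset[OF rat_uf] rat_on_D by (cases "i < k"; cases "i = k"; cases "i = k + 1") (simp_all add: ua_def)
qed

lemma rat_va: "(\<lambda>p. va p i c) \<in> rat_fun D"
proof -
  have "(\<lambda>p. companion.\<rho>1 (X p) c) \<in> rat_fun D"
    unfolding companion.\<rho>1_def
    by (intro rat_fun.add rat_fun.mult rat_row2 rat_\<rho>3 rat_on_D)
  moreover have "(\<lambda>p. companion.\<rho>2 (X p) c) \<in> rat_fun D"
    unfolding companion.\<rho>2_def
    by (intro rat_fun_diff rat_fun.mult rat_row3 rat_\<rho>3 rat_on_D)
  ultimately show ?thesis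
    using rat_fun_UNIV_subset[OF rat_vf] rat_\<rho>3
    by (cases "i < k"; cases "i = k"; cases "i = k + 1") (simp_all add: va_def)
qed

lemma rat_low: "(\<lambda>p. low p a c) \<in> rat_fun D"
  by (cases "3 \<le> a \<and> c < 3") (auto simp: low_def intro: rat_fun.const rat_fun.coord)

lemma rat_colm: "(\<lambda>p. colm p a c) \<in> rat_fun D"
  by (cases "a < k \<and> c = k") (auto simp: colm_def intro: rat_fun.const rat_fun.coord)

lemma \<phi>_index:
  "l < q \<Longrightarrow> i < n \<Longrightarrow> j < n \<Longrightarrow>
     (\<phi> p ! l) $$ (i, j) = (if i = j then \<epsilon> else 0) + su p (ua p l) i * sv p (va p l) j"
  by (simp add: \<phi>_def del: upt_Suc)

lemma rat_\<phi>:
  assumes "l < q" "i < n" "j < n"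
  shows "(\<lambda>p. (\<phi> p ! l) $$ (i, j)) \<in> rat_fun D"
  unfolding \<phi>_index[OF assms] su_def sv_def sz_def
  by (intro rat_fun.add rat_fun.const rat_fun.mult rat_fun_diff rat_fun_sum rat_ua rat_va rat_low rat_colm)

section \<open>The base point\<close>

text \<open>The first three coimages become e_(i+1 mod 3) + e_3. Their cyclic parts make e_0 a
  cyclic vector and \<open>det3\<close> nonzero; the summand e_3, which exists because
  \<open>k\<close> is at least 4, makes the \<open>LP\<close> recoverable. The remaining coimages
  e_i complete them to a basis.\<close>

definition base :: "coord \<Rightarrow> complex" where
  "base x = (case x of VP i c \<Rightarrow> if i < 3 then (if c = Suc i mod 3 \<or> c = 3 then 1 else 0) else kron i c | _ \<Rightarrow> 0)"

lemma base_simps [simp]: "base (ZP c) = 0" "base (SP i j) = 0" "base (LP a j) = 0"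
  "base (VP i c) = (if i < 3 then (if c = Suc i mod 3 \<or> c = 3 then 1 else 0) else kron i c)"
  by (simp_all add: base_def)

lemma vf_base:
  assumes "\<And>i c. p (VP i c) = base (VP i c)" "\<And>i j. p (SP i j) = base (SP i j)" "c < k"
  shows "vf p i c = (if i < 3 then kron (Suc i mod 3) c + kron 3 c else kron i c)"
proof (cases "i < 3")
  case True
  then have "i = 0 \<or> i = 1 \<or> i = 2" by auto
  then show ?thesis using assms by (elim disjE) (auto simp: vf_def kron_def)
qed (use assms in \<open>auto simp: vf_def kron_def\<close>)

text \<open>At the base point the coimages with index at least 3 vanish on the first three
  coordinates, so later factors leave these columns unchanged.\<close>

lemma X_base: "c < 3 \<Longrightarrow> X base r c = inv_prod \<epsilon> (uf base) (vf base) 3 r c"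
proof -
  assume c: "c < 3"
  have "inv_prod \<epsilon> (uf base) (vf base) i r c = inv_prod \<epsilon> (uf base) (vf base) 3 r c" if "3 \<le> i" for i
    using that
  proof (induction i rule: dec_induct)
    case (step i)
    have z: "vf base i b = 0" if "b < 3" for b
      using vf_base[of base b i] that step(1) k by (auto simp: kron_def)
    have "inv_prod \<epsilon> (uf base) (vf base) (Suc i) r c = inv_prod \<epsilon> (uf base) (vf base) i r c"
      unfolding inv_prod.simps using z[of 0] z[of 1] z[of 2] z[OF c] by simp
    then show ?case using step.IH by (rule trans)
  qed simp
  from this[of k] k show ?thesis unfolding X_def by simp
qed

text \<open>Minus a cyclic permutation matrix, with one correction \<epsilon> from the product of
  the second and the third factor.\<close>

lemma X_base_values:
  "X base 0 0 = 0" "X base 0 1 = - 1" "X base 0 2 = 0" "X base 1 0 = 0" "X base 1 1 = 0" "X base 1 2 = - 1"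
  "X base 2 0 = - 1" "X base 2 1 = \<epsilon>" "X base 2 2 = 0"
proof -
  have u: "uf base 0 = kron 0" "uf base 1 = kron 1" "uf base 2 = kron 2" by (auto simp: uf_def)
  have v: "vf base i c = kron (Suc i mod 3) c" if "i < 3" "c < 3" for i c
    using vf_base[of base c i] that k by (auto simp: kron_def)
  let ?X = "inv_prod \<epsilon> (uf base) (vf base)"
  have v0: "vf base 0 c = kron 1 c" and v1: "vf base (Suc 0) c = kron 2 c" and v2: "vf base (Suc (Suc 0)) c = kron 0 c"
    if "c < 3" for c
    using v[of 0 c] v[of "Suc 0" c] v[of "Suc (Suc 0)" c] that by (simp_all add: numeral_2_eq_2)
  have u': "uf base (Suc 0) = kron 1" "uf base (Suc (Suc 0)) = kron 2" using u by (simp_all add: numeral_2_eq_2)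
  have e1: "?X (Suc 0) r c = - (kron 0 r * kron 1 c)" if "c < 3" for r c
    unfolding inv_prod.simps u v0[OF that] by simp
  have e2: "?X (Suc (Suc 0)) r c = - (kron 0 r * kron 1 c) - kron 1 r * kron 2 c" if "c < 3" for r c
    unfolding inv_prod.simps(2)[of _ _ _ "Suc 0"] e1[OF that] u' using v1[of 0] v1[of 1] v1[OF that] by simp
  have e3: "?X 3 r c = - (kron 0 r * kron 1 c) - kron 1 r * kron 2 c - kron 2 r * (kron 0 c - \<epsilon> * kron 1 c)" if "c < 3" for r c
    unfolding numeral_3_eq_3 inv_prod.simps(2)[of _ _ _ "Suc (Suc 0)"] e2[OF that] u'
    using v2[of 0] v2[of 1] v2[of 2] v2[OF that] by simp
  show "X base 0 0 = 0" "X base 0 1 = - 1" "X base 0 2 = 0" "X base 1 0 = 0" "X base 1 1 = 0" "X base 1 2 = - 1"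
    "X base 2 0 = - 1" "X base 2 1 = \<epsilon>" "X base 2 2 = 0"
    by (subst X_base, simp, subst e3, simp, simp add: kron_def)+
qed

lemma base_in_D: "base \<in> D"
proof -
  have "det3 (X base) = - 1" unfolding det3_def X_base_values by simp
  moreover have "companion.\<Delta> (X base) = 1"
    unfolding companion.\<Delta>_def companion.g2_def companion.g3_def by (simp add: X_base_values[simplified])
  moreover have "det (Vmat base) \<noteq> 0"
  proof
    assume "det (Vmat base) = 0"
    then obtain x where x: "x \<in> carrier_vec k" "x \<noteq> 0\<^sub>v k" "Vmat base *\<^sub>v x = 0\<^sub>v k"
      using det_0_iff_vec_prod_zero_field[of "Vmat base" k] by (auto simp: Vmat_def)
    have V: "(\<Sum>c<k. vf base i c * x $ c) = 0" if "i < k" for i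
      using arg_cong[OF x(3), of "\<lambda>v. v $ i"] that x(1)
      by (auto simp: Vmat_def scalar_prod_def lessThan_atLeast0)
    have high: "x $ i = 0" if "3 \<le> i" "i < k" for i
    proof -
      have "(\<Sum>c<k. vf base i c * x $ c) = (\<Sum>c<k. kron i c * x $ c)"
        using that by (intro sum.cong) (auto simp: vf_base)
      then show ?thesis using V[OF that(2)] that by simp
    qed
    have low: "x $ (Suc i mod 3) = 0" if "i < 3" for i
    proof -
      have "(\<Sum>c<k. vf base i c * x $ c) = (\<Sum>c<k. kron (Suc i mod 3) c * x $ c) + (\<Sum>c<k. kron 3 c * x $ c)"
        unfolding sum.distrib[symmetric] using that by (intro sum.cong) (auto simp: vf_base algebra_simps)
      moreover have "Suc i mod 3 < k" using k mod_less_divisor[of 3 "Suc i"] by linarith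
      ultimately show ?thesis using V[of i] high[of 3] that k by simp
    qed
    have "x $ i = 0" if i: "i < k" for i
    proof -
      consider "i = 0" | "i = 1" | "i = 2" | "3 \<le> i" by linarith
      then show ?thesis using low[of 0] low[of 1] low[of 2] high i by cases (auto simp: numeral_2_eq_2)
    qed
    then have "x = 0\<^sub>v k" using x(1) by (intro eq_vecI) auto
    with x(2) show False by simp
  qed
  ultimately show ?thesis by (simp add: D_def)
qed

lemma su_low: "a < 3 \<Longrightarrow> su p u a = u a"
  by (simp add: su_def low_def)

lemma su_kron: "3 \<le> a \<Longrightarrow> j < 3 \<Longrightarrow> su p (kron j) a = p (LP a j)"
  using k sum_kron(2)[where f = "low p a" and n = n and i = j]
  by (simp add: su_def low_def del: sum.lessThan_Suc)

lemma sz_less: "b < k \<Longrightarrow> sz p v b = v b"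
  by (simp add: sz_def colm_def)

lemma sz_last: "sz p v k = v k - (\<Sum>c<k. v c * p (ZP c))"
  by (simp add: sz_def colm_def)

lemma sv_high: "3 \<le> b \<Longrightarrow> sv p v b = sz p v b"
  by (simp add: sv_def low_def)

lemma sv_LP: "(\<And>a j. p (LP a j) = 0) \<Longrightarrow> sv p v b = sz p v b"
  by (simp add: sv_def low_def)

lemma last_minor_base: "last_minor \<epsilon> q (\<phi> base) \<noteq> 0"
proof -
  interpret companion_closing n \<epsilon> "X base" using k by (intro closing base_in_D) auto
  have "last_minor \<epsilon> q (\<phi> base) = det3 (\<lambda>a b. g2 a * \<rho>1 b + g3 a * \<rho>2 b + w a * \<rho>3 b)"
    unfolding last_minor_def
  proof (rule det3_cong)
    fix a b :: nat assume ab: "a < 3" "b < 3"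
    have e: "(\<phi> base ! l) $$ (a, b) = (if a = b then \<epsilon> else 0) + ua base l a * va base l b" if "l < q" for l
      using that ab k by (subst \<phi>_index) (simp_all add: su_low sv_LP sz_less)
    have q': "q - 3 = k" "q - 2 = k + 1" "q - 1 = k + 2" by linarith+
    show "(\<phi> base ! (q - 3)) $$ (a, b) + (\<phi> base ! (q - 2)) $$ (a, b) + (\<phi> base ! (q - 1)) $$ (a, b)
        + (if a = b then - 3 * \<epsilon> else 0) = g2 a * \<rho>1 b + g3 a * \<rho>2 b + w a * \<rho>3 b"
      unfolding q' using e[of k] e[of "k + 1"] e[of "k + 2"] by (simp add: ua_def va_def)
  qed
  then show ?thesis using closing_minor by simp
qed

section \<open>Counting and recovering the parameters\<close>

definition params :: "coord set" where
  "params = ZP ` {..<k} \<union> (\<lambda>(i, j). SP i j) ` ({3..<k} \<times> {1, 2})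
     \<union> (\<lambda>(i, c). VP i c) ` (SIGMA i:{..<k}. {..<k} - {if i < 3 then i else 0})
     \<union> (\<lambda>(a, j). LP a j) ` ({3..<n} \<times> {..<3})"

lemma finite_params: "finite params"
  by (auto simp: params_def)

lemma card_params: "card params = k + 2 * (k - 3) + k * (k - 1) + 3 * (k - 2)"
proof -
  let ?A = "ZP ` {..<k}" and ?B = "(\<lambda>(i, j). SP i j) ` ({3..<k} \<times> {1, 2})"
  let ?C = "(\<lambda>(i, c). VP i c) ` (SIGMA i:{..<k}. {..<k} - {if i < 3 then i else 0})"
  let ?E = "(\<lambda>(a, j). LP a j) ` ({3..<n} \<times> {..<3})"
  have A: "card ?A = k" by (subst card_image) (auto simp: inj_on_def)
  have B: "card ?B = 2 * (k - 3)"
    by (subst card_image) (auto simp: inj_on_def card_cartesian_product)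
  have C: "card ?C = k * (k - 1)"
  proof -
    have "card ({..<k} - {if i < 3 then i else 0}) = k - 1" if "i < k" for i
      using that by (subst card_Diff_singleton) auto
    then have "card (SIGMA i:{..<k}. {..<k} - {if i < 3 then i else 0}) = k * (k - 1)"
      by (subst card_SigmaI) auto
    then show ?thesis by (subst card_image) (auto simp: inj_on_def)
  qed
  have E: "card ?E = 3 * (k - 2)"
    using k by (subst card_image) (auto simp: inj_on_def card_cartesian_product)
  have "card (?A \<union> ?B \<union> ?C \<union> ?E) = card ?A + card ?B + card ?C + card ?E"
  proof -
    have "?A \<inter> ?B = {}" "(?A \<union> ?B) \<inter> ?C = {}" "(?A \<union> ?B \<union> ?C) \<inter> ?E = {}" by auto
    moreover have "finite ?A" "finite ?B" "finite ?C" "finite ?E" by auto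
    ultimately show ?thesis by (simp only: card_Un_disjoint finite_Un simp_thms)
  qed
  then show ?thesis unfolding params_def A B C E .
qed

text \<open>A row in which the image has entry 1 and which the conjugation leaves alone.\<close>

definition pivot :: "nat \<Rightarrow> nat" where "pivot i = (if i < 3 then i else 0)"

lemma pivot: "pivot i < 3" "uf p i (pivot i) = 1"
  by (simp_all add: pivot_def uf_def)

lemma poly_fun_entry: "l < q \<Longrightarrow> i < n \<Longrightarrow> j < n \<Longrightarrow> (\<lambda>As. (As ! l) $$ (i, j)) \<in> poly_fun n q"
  by (rule poly_fun.coord)

text \<open>Column \<open>k\<close> shows minus the coimages applied to the vector of the
  \<open>ZP\<close>. At the base point the coimage is e_c itself for c >= 3. For smaller
  \<open>c\<close> it is e_c + e_3, taken from the matrix preceding \<open>c\<close> in the cycle,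
  and matrix 3 supplies the term to be subtracted.\<close>

lemma detect_ZP:
  assumes c: "c < k"
  shows "\<exists>f\<in>poly_fun n q. \<forall>p. (\<forall>x. 0 < coord_group x \<longrightarrow> p x = base x) \<longrightarrow> f (\<phi> p) = - p (ZP c)"
proof -
  have entry: "(\<phi> p ! l) $$ (pivot l, k) = - (\<Sum>a<k. vf p l a * p (ZP a))"
    if "l < k" for l p
  proof -
    have lt: "pivot l < n" "pivot l \<noteq> k" using pivot(1)[of l] k by auto
    have "vf p l k = 0" by (simp add: vf_def)
    then show ?thesis
      using that lt pivot(1)[of l] k
      by (subst \<phi>_index) (simp_all add: su_low sv_high sz_last ua_def va_def pivot(2))
  qed
  have high: "(\<phi> p ! l) $$ (pivot l, k) = - p (ZP l)"
    if l: "3 \<le> l" "l < k" and p: "\<forall>x. 0 < coord_group x \<longrightarrow> p x = base x" for l p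
  proof -
    have "(\<Sum>a<k. vf p l a * p (ZP a)) = (\<Sum>a<k. kron l a * p (ZP a))"
      using p l by (intro sum.cong) (auto simp: vf_base simp del: base_simps)
    then show ?thesis unfolding entry[OF l(2)] using l by simp
  qed
  show ?thesis
  proof (cases "3 \<le> c")
    case True
    then show ?thesis using high[OF True c] pivot(1)[of c] c k
      by (intro bexI[OF _ poly_fun_entry[of c "pivot c" k]]) auto
  next
    case False
    \<comment> \<open>The predecessor of \<open>c\<close> in the cycle 0, 1, 2.\<close>
    define l where "l = (c + 2) mod 3"
    have l: "l < 3" "Suc l mod 3 = c" using False by (auto simp: l_def mod_Suc_eq mod_simps)
    have low: "(\<phi> p ! l) $$ (pivot l, k) = - p (ZP c) - p (ZP 3)"
      if p: "\<forall>x. 0 < coord_group x \<longrightarrow> p x = base x" for p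
    proof -
      have "(\<Sum>a<k. vf p l a * p (ZP a)) = (\<Sum>a<k. kron c a * p (ZP a)) + (\<Sum>a<k. kron 3 a * p (ZP a))"
        unfolding sum.distrib[symmetric]
        using p l by (intro sum.cong) (auto simp: vf_base algebra_simps simp del: base_simps)
      then show ?thesis using entry[of l p] l c k by simp
    qed
    have "(\<lambda>As. (As ! l) $$ (pivot l, k) + (- 1) * (As ! 3) $$ (pivot 3, k)) \<in> poly_fun n q"
      using pivot(1)[of l] pivot(1)[of 3] l k by (intro poly_fun.add poly_fun.mult poly_fun.const poly_fun.coord) auto
    then show ?thesis
      using low high[of 3] k by (intro bexI[of _ "\<lambda>As. (As ! l) $$ (pivot l, k) + (- 1) * (As ! 3) $$ (pivot 3, k)"]) auto
  qed
qed

lemma detect: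
  assumes x: "x \<in> params"
  shows "\<exists>f\<in>poly_fun n q. \<exists>c.
    (\<forall>p\<in>D. p x = base x \<longrightarrow> (\<forall>y. coord_group x < coord_group y \<longrightarrow> p y = base y) \<longrightarrow> f (\<phi> p) = c) \<and>
    (\<forall>t. t \<noteq> 0 \<longrightarrow> base(x := base x + t) \<in> D \<longrightarrow> f (\<phi> (base(x := base x + t))) \<noteq> c)"
proof (cases x)
  case (ZP c)
  then have "c < k" using x by (auto simp: params_def)
  then obtain f where f: "f \<in> poly_fun n q"
    "\<And>p. (\<forall>x. 0 < coord_group x \<longrightarrow> p x = base x) \<Longrightarrow> f (\<phi> p) = - p (ZP c)"
    using detect_ZP by metis
  have "f (\<phi> (base(x := base x + t))) = - t" for t
    using f(2)[of "base(x := base x + t)"] ZP by simp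
  then show ?thesis using f ZP by (intro bexI[OF _ f(1)] exI[of _ 0]) auto
next
  case (SP i j)
  then have ij: "3 \<le> i" "i < k" "j = 1 \<or> j = 2" using x by (auto simp: params_def)
  \<comment> \<open>The factor \<open>VP i i\<close> is harmless while \<open>SP i j\<close> is 0,
    and it equals 1 at the base point.\<close>
  have f: "(\<phi> p ! i) $$ (j, i) = p (SP i j) * p (VP i i)" for p
    using ij by (subst \<phi>_index) (auto simp: su_low sv_high sz_less ua_def va_def uf_def vf_def)
  show ?thesis
    using ij f by (intro bexI[OF _ poly_fun_entry[of i j i]] exI[of _ 0]) (auto simp: SP)
next
  case (VP i c)
  then have ic: "i < k" "c < k" "c \<noteq> (if i < 3 then i else 0)" using x by (auto simp: params_def)
  \<comment> \<open>Columns below 3 of the coimages are changed by \<open>low\<close>, so the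
    \<open>LP\<close> still have to be zero here.\<close>
  have f: "(\<phi> p ! i) $$ (pivot i, c) = (if pivot i = c then \<epsilon> else 0) + p (VP i c)"
    if "\<forall>a j. p (LP a j) = 0" for p
    using ic that pivot(1)[of i] k
    by (subst \<phi>_index) (auto simp: su_low sv_LP sz_less ua_def va_def vf_def pivot(2))
  show ?thesis
    using ic f pivot(1)[of i] k
    by (intro bexI[OF _ poly_fun_entry[of i "pivot i" c]] exI[of _ "(if pivot i = c then \<epsilon> else 0) + base (VP i c)"])
      (auto simp: VP simp del: base_simps(4))
next
  case (LP a j)
  then have aj: "3 \<le> a" "a < n" "j < 3" using x by (auto simp: params_def)
  \<comment> \<open>Column 3 is affected neither by \<open>low\<close> nor by \<open>colm\<close>;
    its entry \<open>VP j 3\<close> is 1 at the base point and exposes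
    \<open>LP a j\<close>.\<close>
  have f: "(\<phi> p ! j) $$ (a, 3) = (if a = 3 then \<epsilon> else 0) + p (LP a j) * p (VP j 3)" for p
  proof -
    have "uf p j = kron j" using aj by (auto simp: uf_def)
    then show ?thesis using aj k
      by (subst \<phi>_index) (auto simp: su_kron sv_high sz_less ua_def va_def vf_def)
  qed
  show ?thesis
    using aj f k by (intro bexI[OF _ poly_fun_entry[of j a 3]] exI[of _ "if a = 3 then \<epsilon> else 0"]) (auto simp: LP)
qed

definition stratum :: "complex mat list set" where
  "stratum = {As \<in> nil_variety \<epsilon> n q. has_type q As (stratum_type \<epsilon> k q)}"

lemma \<phi>_stratum: "p \<in> D \<Longrightarrow> \<phi> p \<in> stratum"
  by (simp add: stratum_def \<phi>_nil_variety \<phi>_has_type)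

lemma stratum_subset_tuples: "stratum \<subseteq> tuples n q"
  using nil_variety_subset_tuples by (auto simp: stratum_def)

lemma zdim_stratum: "enat (card params) \<le> zdim n q stratum"
  by (rule card_le_zdim[OF stratum_subset_tuples line_dense_D base_in_D \<phi>_stratum rat_\<phi> finite_params detect])

lemma stratum_not_in_closure:
  "\<not> stratum \<subseteq> zariski n q closure_of trivial_part n (nil_variety \<epsilon> n q)"
proof
  assume *: "stratum \<subseteq> zariski n q closure_of trivial_part n (nil_variety \<epsilon> n q)"
  let ?Z = "{As \<in> tuples n q. \<forall>f\<in>{last_minor \<epsilon> q}. f As = 0}"
  have nq: "q = n + 2" "3 \<le> n" using k by auto
  have "trivial_part n (nil_variety \<epsilon> n q) \<subseteq> ?Z"
    using last_minor_trivial_part[OF nq(2), of _ \<epsilon>] nil_variety_subset_tuples[of \<epsilon> n q]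
    unfolding nq(1) trivial_part_def by auto
  moreover have "closedin (zariski n q) ?Z"
    unfolding closedin_zariski_iff using last_minor_poly_fun[of n q \<epsilon>] k
    by (intro exI[of _ "{last_minor \<epsilon> q}"]) auto
  ultimately have "zariski n q closure_of trivial_part n (nil_variety \<epsilon> n q) \<subseteq> ?Z"
    by (rule closure_of_minimal)
  with * \<phi>_stratum[OF base_in_D] last_minor_base show False by auto
qed

end

text \<open>In terms of k = n - 1 the expected dimension is k^2 + 4k, and the family has k^2 + 5k -
  12 parameters, so k >= 13 is required.\<close>

lemma nil_variety_stratum:
  assumes n: "14 \<le> n"
  shows "\<exists>U. is_stratum (n + 2) (nil_variety \<epsilon> n (n + 2)) U \<and> U \<noteq> {} \<and>
    (\<forall>As\<in>U. \<not> trivial_centralizer n As) \<and>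
    \<not> U \<subseteq> zariski n (n + 2) closure_of trivial_part n (nil_variety \<epsilon> n (n + 2)) \<and>
    enat (nat (expected_dim n (replicate (n + 2) (nilclass \<epsilon> n)))) < zdim n (n + 2) U"
proof -
  obtain k where nk: "n = Suc k" "13 \<le> k" using n by (cases n) auto
  interpret family \<epsilon> k using nk by unfold_locales auto
  have q: "Suc k + 2 = k + 3" by simp
  have "is_stratum (k + 3) (nil_variety \<epsilon> (Suc k) (k + 3)) stratum"
    unfolding is_stratum_def stratum_def by blast
  moreover have "stratum \<noteq> {}" using \<phi>_stratum[OF base_in_D] by blast
  moreover have "\<forall>As\<in>stratum. \<not> trivial_centralizer (Suc k) As"
    using stratum_type_nontrivial_centralizer[of "k + 3" _ "Suc k"] stratum_subset_tuples
    by (auto simp: stratum_def)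
  moreover have "nat (expected_dim (Suc k) (replicate (Suc k + 2) (nilclass \<epsilon> (Suc k)))) < card params"
  proof -
    \<comment> \<open>Writing \<open>k\<close> as \<open>m + 13\<close> removes the truncated
      subtractions from \<open>card_params\<close>.\<close>
    obtain m where m: "k = m + 13" using nk(2) by (metis add.commute le_Suc_ex)
    have "expected_dim (Suc k) (replicate (Suc k + 2) (nilclass \<epsilon> (Suc k))) = int (k * k + 4 * k)"
      by (subst \<kappa>_nilclass(2)) (use nk in \<open>auto simp: power2_eq_square algebra_simps\<close>)
    moreover have "k * k + 4 * k < card params"
      unfolding card_params by (simp add: m algebra_simps)
    ultimately show ?thesis by (simp only: nat_int)
  qed
  then have "enat (nat (expected_dim (Suc k) (replicate (Suc k + 2) (nilclass \<epsilon> (Suc k))))) < zdim (Suc k) (k + 3) stratum"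
    using zdim_stratum by (meson enat_ord_simps(2) less_le_trans)
  ultimately show ?thesis using stratum_not_in_closure unfolding nk(1) q by blast
qed

theorem mainTheorem2:
  fixes N :: nat
  shows "\<exists>n p :: nat. 1 \<le> n \<and>
    (\<exists>cs. length cs = p + 1 \<and> admissible_add n cs \<and> int N \<le> - \<kappa> n cs \<and>
       trivial_part n (\<V>_add n cs) \<noteq> {} \<and>
       (\<exists>U. is_stratum (p + 1) (\<V>_add n cs) U \<and> U \<noteq> {} \<and>
          (\<forall>As\<in>U. \<not> trivial_centralizer n As) \<and>
          \<not> U \<subseteq> zariski n (p + 1) closure_of trivial_part n (\<V>_add n cs) \<and>
          enat (nat (expected_dim n cs)) < zdim n (p + 1) U)) \<and>
    (\<exists>Cs. length Cs = p + 1 \<and> admissible_mult n Cs \<and> int N \<le> - \<kappa> n Cs \<and>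
       trivial_part n (\<V>_mult n Cs) \<noteq> {} \<and>
       (\<exists>U. is_stratum (p + 1) (\<V>_mult n Cs) U \<and> U \<noteq> {} \<and>
          (\<forall>Ms\<in>U. \<not> trivial_centralizer n Ms) \<and>
          \<not> U \<subseteq> zariski n (p + 1) closure_of trivial_part n (\<V>_mult n Cs) \<and>
          enat (nat (expected_dim n Cs)) < zdim n (p + 1) U))"
proof -
  \<comment> \<open>The summand 14 is the bound for the dimension, and \<open>N\<close> makes
    -\<kappa> = 2n - 4 large enough.\<close>
  define n where "n = N + 14"
  have n: "14 \<le> n" "2 \<le> n" "2 < n" "1 \<le> n" by (simp_all add: n_def)
  have \<kappa>: "int N \<le> - \<kappa> n (replicate (n + 2) (nilclass \<epsilon> n))" for \<epsilon>
    unfolding \<kappa>_nilclass(1)[OF n(2)] by (simp add: n_def)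
  have p: "n + 1 + 1 = n + 2" by simp
  note rules = conjI length_replicate n \<kappa> trivial_part_nonempty nil_variety_stratum
  show ?thesis
    by (rule exI[of _ n], rule exI[of _ "n + 1"], unfold p, intro conjI, rule n(4),
        rule exI[of _ "replicate (n + 2) (nilclass 0 n)"], unfold \<V>_add_nilclass,
        intro rules admissible_add_nilclass,
        rule exI[of _ "replicate (n + 2) (nilclass 1 n)"], unfold \<V>_mult_nilclass,
        intro rules admissible_mult_nilclass)
qed

end
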